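(* If $V$ is a simple object of $\mathcal{W}(0)$, then $V\cong L(0, \xi, h)$ for some $\xi, h \in \mathbb{C}$.
   Context: $\mathfrak{g}$ is the Virasoro Lie algebra over $\mathbb{C}$, with basis $\{z, d_k \mid k \in \mathbb{Z}\}$ and bracket $[d_k,d_j]=(k-j)d_{k+j}+\delta_{j,-k}\frac{k^3-k}{12}z$, $[z,d_k]=0$; $\mathfrak{n}^+=\mathrm{span}_{\mathbb{C}}\{d_k \mid k>0\}$ and $\mathfrak{h}=\mathrm{span}_{\mathbb{C}}\{d_0,z\}$. $\mathcal{W}$ is the full subcategory of $\mathfrak{g}$-modules on which $\mathfrak{n}^+$ acts locally finitely. $\mathcal{W}(0)$ is the full subcategory of those $V\in\mathcal{W}$ such that for every $v\in V$ and all $x\in\mathfrak{n}^+$, $x^kv=0$ for $k\gg 0$. For $\xi,h\in\mathbb{C}$, $M(0,\xi,h)=U(\mathfrak{g})\otimes_{U(\mathfrak{h}\oplus\mathfrak{n}^+)}\mathbb{C}_{(\xi,h)}$, where $\mathbb{C}_{(\xi,h)}$ is the one-dimensional $\mathfrak{h}\oplus\mathfrak{n}^+$-module on which $z$ acts by $\xi$, $d_0$ acts by $h$, and $\mathfrak{n}^+$ acts by $0$. $L(0,\xi,h)$ denotes the unique simple quotient of $M(0,\xi,h)$. *)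

theory Defs
  imports "HOL-Algebra.Free_Abelian_Groups" "HOL-Algebra.QuotRing" "HOL-Algebra.Module"
    "HOL-Algebra.Algebraic_Closure_Type"
begin

section \<open>Complex Lie algebras and their modules\<close>

text \<open>
  As for modules in HOL-Algebra, Lie algebras and their modules are records with an explicit
  carrier. The fields \<^const>\<open>monoid.mult\<close> and \<^const>\<open>monoid.one\<close> inherited from rings carry no
  meaning, as is the case for \<^locale>\<open>module\<close>.
\<close>

abbreviation complex_ring :: "complex ring" where
  "complex_ring \<equiv> ring_of_type_algebra"

record 'g lie = "(complex, 'g) module" +
  lbracket :: "'g \<Rightarrow> 'g \<Rightarrow> 'g"

locale lie_algebra = module complex_ring L for L :: "'g lie" +
  assumes lbracket_closed:
      "\<lbrakk>x \<in> carrier L; y \<in> carrier L\<rbrakk> \<Longrightarrow> lbracket L x y \<in> carrier L"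
    and lbracket_add_left: "\<lbrakk>x \<in> carrier L; y \<in> carrier L; w \<in> carrier L\<rbrakk> \<Longrightarrow>
      lbracket L (x \<oplus>\<^bsub>L\<^esub> y) w = lbracket L x w \<oplus>\<^bsub>L\<^esub> lbracket L y w"
    and lbracket_add_right: "\<lbrakk>x \<in> carrier L; y \<in> carrier L; w \<in> carrier L\<rbrakk> \<Longrightarrow>
      lbracket L w (x \<oplus>\<^bsub>L\<^esub> y) = lbracket L w x \<oplus>\<^bsub>L\<^esub> lbracket L w y"
    and lbracket_smult_left: "\<lbrakk>x \<in> carrier L; y \<in> carrier L\<rbrakk> \<Longrightarrow>
      lbracket L (c \<odot>\<^bsub>L\<^esub> x) y = c \<odot>\<^bsub>L\<^esub> lbracket L x y"
    and lbracket_smult_right: "\<lbrakk>x \<in> carrier L; y \<in> carrier L\<rbrakk> \<Longrightarrow>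
      lbracket L x (c \<odot>\<^bsub>L\<^esub> y) = c \<odot>\<^bsub>L\<^esub> lbracket L x y"
    and lbracket_self: "x \<in> carrier L \<Longrightarrow> lbracket L x x = \<zero>\<^bsub>L\<^esub>"
    and jacobi: "\<lbrakk>x \<in> carrier L; y \<in> carrier L; w \<in> carrier L\<rbrakk> \<Longrightarrow>
      lbracket L x (lbracket L y w) \<oplus>\<^bsub>L\<^esub> lbracket L y (lbracket L w x)
        \<oplus>\<^bsub>L\<^esub> lbracket L w (lbracket L x y) = \<zero>\<^bsub>L\<^esub>"

record ('g, 'v) rep = "(complex, 'v) module" +
  act :: "'g \<Rightarrow> 'v \<Rightarrow> 'v"

locale lie_module = lie: lie_algebra L + module complex_ring V
  for L :: "'g lie" and V :: "('g, 'v) rep" +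
  assumes act_closed: "\<lbrakk>x \<in> carrier L; v \<in> carrier V\<rbrakk> \<Longrightarrow> act V x v \<in> carrier V"
    and act_add_left: "\<lbrakk>x \<in> carrier L; y \<in> carrier L; v \<in> carrier V\<rbrakk> \<Longrightarrow>
      act V (x \<oplus>\<^bsub>L\<^esub> y) v = act V x v \<oplus>\<^bsub>V\<^esub> act V y v"
    and act_smult_left: "\<lbrakk>x \<in> carrier L; v \<in> carrier V\<rbrakk> \<Longrightarrow>
      act V (c \<odot>\<^bsub>L\<^esub> x) v = c \<odot>\<^bsub>V\<^esub> act V x v"
    and act_add_right: "\<lbrakk>x \<in> carrier L; v \<in> carrier V; w \<in> carrier V\<rbrakk> \<Longrightarrow>
      act V x (v \<oplus>\<^bsub>V\<^esub> w) = act V x v \<oplus>\<^bsub>V\<^esub> act V x w"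
    and act_smult_right: "\<lbrakk>x \<in> carrier L; v \<in> carrier V\<rbrakk> \<Longrightarrow>
      act V x (c \<odot>\<^bsub>V\<^esub> v) = c \<odot>\<^bsub>V\<^esub> act V x v"
    and act_lbracket: "\<lbrakk>x \<in> carrier L; y \<in> carrier L; v \<in> carrier V\<rbrakk> \<Longrightarrow>
      act V (lbracket L x y) v = act V x (act V y v) \<ominus>\<^bsub>V\<^esub> act V y (act V x v)"

definition lie_submodule :: "'g lie \<Rightarrow> ('g, 'v) rep \<Rightarrow> 'v set \<Rightarrow> bool" where
  "lie_submodule L V N \<longleftrightarrow>
     submodule N complex_ring V \<and> (\<forall>x\<in>carrier L. \<forall>v\<in>N. act V x v \<in> N)"

definition simple_lie_module :: "'g lie \<Rightarrow> ('g, 'v) rep \<Rightarrow> bool" where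
  "simple_lie_module L V \<longleftrightarrow> lie_module L V \<and> carrier V \<noteq> {\<zero>\<^bsub>V\<^esub>} \<and>
     (\<forall>N. lie_submodule L V N \<longrightarrow> N = {\<zero>\<^bsub>V\<^esub>} \<or> N = carrier V)"

definition quotient_rep :: "('g, 'v) rep \<Rightarrow> 'v set \<Rightarrow> ('g, 'v set) rep" where
  "quotient_rep V N =
     \<lparr>carrier = a_rcosets\<^bsub>V\<^esub> N, monoid.mult = undefined, one = undefined,
      zero = N, add = set_add V,
      module.smult = (\<lambda>c A. \<Union>v\<in>A. N +>\<^bsub>V\<^esub> (c \<odot>\<^bsub>V\<^esub> v)),
      act = (\<lambda>x A. \<Union>v\<in>A. N +>\<^bsub>V\<^esub> act V x v)\<rparr>"

definition lie_module_isomorphic :: "'g lie \<Rightarrow> ('g, 'v) rep \<Rightarrow> ('g, 'w) rep \<Rightarrow> bool" where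
  "lie_module_isomorphic L V W \<longleftrightarrow>
     (\<exists>\<phi>. \<phi> \<in> iso (add_monoid V) (add_monoid W) \<and>
          (\<forall>c. \<forall>v\<in>carrier V. \<phi> (c \<odot>\<^bsub>V\<^esub> v) = c \<odot>\<^bsub>W\<^esub> \<phi> v) \<and>
          (\<forall>x\<in>carrier L. \<forall>v\<in>carrier V. \<phi> (act V x v) = act W x (\<phi> v)))"

definition lin_span :: "(complex, 'v, 'm) module_scheme \<Rightarrow> 'v set \<Rightarrow> 'v set" where
  "lin_span V S = \<Inter>{H. submodule H complex_ring V \<and> S \<subseteq> H}"


section \<open>The universal enveloping algebra\<close>

text \<open>
  The free associative algebra on a set is the monoid algebra of the free monoid on it. Since
  \<^typ>\<open>'a \<Rightarrow>\<^sub>0 complex\<close> carries the convolution product for additively written monoids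
  \<^typ>\<open>'a\<close>, concatenation of words is written as addition.
\<close>

datatype 'g word = Word (letters: "'g list")

instantiation word :: (type) monoid_add
begin

definition zero_word :: "'a word" where "0 = Word []"

definition plus_word :: "'a word \<Rightarrow> 'a word \<Rightarrow> 'a word" where
  "u + v = Word (letters u @ letters v)"

instance by standard (auto simp: zero_word_def plus_word_def)

end

definition free_algebra :: "'g set \<Rightarrow> ('g word \<Rightarrow>\<^sub>0 complex) ring" where
  "free_algebra S =
     \<lparr>carrier = {t. \<forall>w\<in>Poly_Mapping.keys t. set (letters w) \<subseteq> S}, monoid.mult = (*), one = 1,
      zero = 0, add = (+)\<rparr>"

abbreviation gen :: "'g \<Rightarrow> 'g word \<Rightarrow>\<^sub>0 complex" where
  "gen x \<equiv> Poly_Mapping.single (Word [x]) 1"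

abbreviation scalar :: "complex \<Rightarrow> 'g word \<Rightarrow>\<^sub>0 complex" where
  "scalar c \<equiv> Poly_Mapping.single 0 c"

text \<open>
  The first two families of relations turn the free algebra on the underlying set of \<open>L\<close> into
  the tensor algebra of the vector space \<open>L\<close>.
\<close>

definition uea_ideal :: "'g lie \<Rightarrow> ('g word \<Rightarrow>\<^sub>0 complex) set" where
  "uea_ideal L = Idl\<^bsub>free_algebra (carrier L)\<^esub>
     ({gen (x \<oplus>\<^bsub>L\<^esub> y) - gen x - gen y | x y. x \<in> carrier L \<and> y \<in> carrier L} \<union>
      {gen (c \<odot>\<^bsub>L\<^esub> x) - scalar c * gen x | c x. x \<in> carrier L} \<union>
      {gen x * gen y - gen y * gen x - gen (lbracket L x y) | x y.
         x \<in> carrier L \<and> y \<in> carrier L})"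

definition uea :: "'g lie \<Rightarrow> ('g word \<Rightarrow>\<^sub>0 complex) set ring" where
  "uea L = free_algebra (carrier L) Quot uea_ideal L"

definition uea_class :: "'g lie \<Rightarrow> ('g word \<Rightarrow>\<^sub>0 complex) \<Rightarrow> ('g word \<Rightarrow>\<^sub>0 complex) set" where
  "uea_class L t = uea_ideal L +>\<^bsub>free_algebra (carrier L)\<^esub> t"

text \<open>The algebra homomorphism \<open>U(B) \<rightarrow> U(L)\<close> induced by the inclusion of a subalgebra \<open>B\<close> of \<open>L\<close>.\<close>

definition uea_inclusion :: "'g lie \<Rightarrow> ('g word \<Rightarrow>\<^sub>0 complex) set \<Rightarrow> ('g word \<Rightarrow>\<^sub>0 complex) set"
  where "uea_inclusion L A = (\<Union>t\<in>A. uea_class L t)"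

definition word_act :: "('g, 'v) rep \<Rightarrow> 'g word \<Rightarrow> 'v \<Rightarrow> 'v" where
  "word_act V w v = foldr (act V) (letters w) v"

definition free_act :: "('g, 'v) rep \<Rightarrow> ('g word \<Rightarrow>\<^sub>0 complex) \<Rightarrow> 'v \<Rightarrow> 'v" where
  "free_act V t v = (\<Oplus>\<^bsub>V\<^esub>w\<in>Poly_Mapping.keys t. Poly_Mapping.lookup t w \<odot>\<^bsub>V\<^esub> word_act V w v)"

text \<open>
  The action of \<open>U(L)\<close> on an \<open>L\<close>-module; on the elements of \<^const>\<open>uea\<close>, the result does not depend
  on the representative.
\<close>

definition uea_act :: "('g, 'v) rep \<Rightarrow> ('g word \<Rightarrow>\<^sub>0 complex) set \<Rightarrow> 'v \<Rightarrow> 'v" where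
  "uea_act V A v = free_act V (SOME t. t \<in> A) v"


section \<open>Tensor products over a noncommutative ring and induced modules\<close>

text \<open>
  For a right module \<open>M\<close> and a left module \<open>N\<close> over a ring \<open>R\<close>, the tensor product is the free
  abelian group on \<open>M \<times> N\<close> modulo biadditivity and the balancing relation. Here \<open>ract\<close> and \<open>lact\<close>
  are the two actions.
\<close>

definition tensor_kernel ::
  "('r, 'x) ring_scheme \<Rightarrow> ('m, 'y) ring_scheme \<Rightarrow> ('m \<Rightarrow> 'r \<Rightarrow> 'm) \<Rightarrow>
   ('n, 'w) ring_scheme \<Rightarrow> ('r \<Rightarrow> 'n \<Rightarrow> 'n) \<Rightarrow> ('m \<times> 'n \<Rightarrow>\<^sub>0 int) set" where
  "tensor_kernel R M ract N lact = generate (free_Abelian_group (carrier M \<times> carrier N))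
     ({frag_of (m \<oplus>\<^bsub>M\<^esub> m', n) - frag_of (m, n) - frag_of (m', n) | m m' n.
         m \<in> carrier M \<and> m' \<in> carrier M \<and> n \<in> carrier N} \<union>
      {frag_of (m, n \<oplus>\<^bsub>N\<^esub> n') - frag_of (m, n) - frag_of (m, n') | m n n'.
         m \<in> carrier M \<and> n \<in> carrier N \<and> n' \<in> carrier N} \<union>
      {frag_of (ract m r, n) - frag_of (m, lact r n) | m r n.
         m \<in> carrier M \<and> r \<in> carrier R \<and> n \<in> carrier N})"

definition tensor_product ::
  "('r, 'x) ring_scheme \<Rightarrow> ('m, 'y) ring_scheme \<Rightarrow> ('m \<Rightarrow> 'r \<Rightarrow> 'm) \<Rightarrow>
   ('n, 'w) ring_scheme \<Rightarrow> ('r \<Rightarrow> 'n \<Rightarrow> 'n) \<Rightarrow> ('m \<times> 'n \<Rightarrow>\<^sub>0 int) set monoid" where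
  "tensor_product R M ract N lact =
     free_Abelian_group (carrier M \<times> carrier N) Mod tensor_kernel R M ract N lact"

text \<open>
  The \<open>L\<close>-module \<open>U(L) \<otimes> W\<close> over \<open>U(B)\<close>, for a subalgebra \<open>B\<close> of \<open>L\<close> and a \<open>B\<close>-module \<open>W\<close>. Both
  scalars and elements of \<open>L\<close> act through multiplication in \<open>U(L)\<close> from the left,
  \<open>a \<cdot> (u \<otimes> w) = a u \<otimes> w\<close>.
\<close>

definition induced_rep :: "'g lie \<Rightarrow> 'g lie \<Rightarrow> ('g, 'w) rep \<Rightarrow>
    ('g, (('g word \<Rightarrow>\<^sub>0 complex) set \<times> 'w \<Rightarrow>\<^sub>0 int) set) rep" where
  "induced_rep L B W =
     (let ract = (\<lambda>u r. u \<otimes>\<^bsub>uea L\<^esub> uea_inclusion L r);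
          F = free_Abelian_group (carrier (uea L) \<times> carrier W);
          K = tensor_kernel (uea B) (uea L) ract W (uea_act W);
          T = tensor_product (uea B) (uea L) ract W (uea_act W);
          lmult = (\<lambda>a A. \<Union>f\<in>A. K #>\<^bsub>F\<^esub> frag_extend (\<lambda>(u, w). frag_of (a \<otimes>\<^bsub>uea L\<^esub> u, w)) f)
      in \<lparr>carrier = carrier T, monoid.mult = undefined, one = undefined,
          zero = \<one>\<^bsub>T\<^esub>, add = monoid.mult T,
          module.smult = (\<lambda>c. lmult (uea_class L (scalar c))),
          act = (\<lambda>x. lmult (uea_class L (gen x)))\<rparr>)"


section \<open>The Virasoro algebra\<close>

datatype vir_index = Dk int | Zc

type_synonym vir = "vir_index \<Rightarrow>\<^sub>0 complex"

abbreviation vir_d :: "int \<Rightarrow> vir" where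
  "vir_d k \<equiv> Poly_Mapping.single (Dk k) 1"

abbreviation vir_z :: vir where
  "vir_z \<equiv> Poly_Mapping.single Zc 1"

definition vir_smult :: "complex \<Rightarrow> vir \<Rightarrow> vir" where
  "vir_smult c x = Poly_Mapping.map ((*) c) x"

fun vir_basis_bracket :: "vir_index \<Rightarrow> vir_index \<Rightarrow> vir" where
  "vir_basis_bracket (Dk k) (Dk j) =
     vir_smult (of_int (k - j)) (vir_d (k + j)) +
     (if j = - k then vir_smult (of_int (k ^ 3 - k) / 12) vir_z else 0)"
| "vir_basis_bracket Zc _ = 0"
| "vir_basis_bracket _ Zc = 0"

definition vir_bracket :: "vir \<Rightarrow> vir \<Rightarrow> vir" where
  "vir_bracket x y = (\<Sum>a\<in>Poly_Mapping.keys x. \<Sum>b\<in>Poly_Mapping.keys y.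
     vir_smult (Poly_Mapping.lookup x a * Poly_Mapping.lookup y b) (vir_basis_bracket a b))"

definition virasoro :: "vir lie" where
  "virasoro = \<lparr>carrier = UNIV, monoid.mult = undefined, one = undefined, zero = 0, add = (+),
     module.smult = vir_smult, lbracket = vir_bracket\<rparr>"

definition vir_n_plus :: "vir set" where
  "vir_n_plus = lin_span virasoro (vir_d ` {0<..})"

definition vir_h :: "vir set" where
  "vir_h = lin_span virasoro {vir_d 0, vir_z}"

definition vir_borel :: "vir lie" where
  "vir_borel = virasoro\<lparr>carrier := vir_h <+>\<^bsub>virasoro\<^esub> vir_n_plus\<rparr>"

text \<open>
  The one-dimensional module \<open>\<complex>\<^bsub>(\<xi>, h)\<^esub>\<close> of \<^const>\<open>vir_borel\<close>; outside the carrier of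
  \<^const>\<open>vir_borel\<close>, the value of \<^const>\<open>act\<close> is irrelevant.
\<close>

definition weight_rep :: "complex \<Rightarrow> complex \<Rightarrow> (vir, complex) rep" where
  "weight_rep \<xi> h = \<lparr>carrier = UNIV, monoid.mult = undefined, one = undefined, zero = 0, add = (+),
     module.smult = (*),
     act = (\<lambda>x v. (Poly_Mapping.lookup x Zc * \<xi> + Poly_Mapping.lookup x (Dk 0) * h) * v)\<rparr>"

type_synonym verma_carrier = "((vir word \<Rightarrow>\<^sub>0 complex) set \<times> complex \<Rightarrow>\<^sub>0 int) set"

definition verma :: "complex \<Rightarrow> complex \<Rightarrow> (vir, verma_carrier) rep" where
  "verma \<xi> h = induced_rep virasoro vir_borel (weight_rep \<xi> h)"

definition verma_simple_quotient :: "complex \<Rightarrow> complex \<Rightarrow> (vir, verma_carrier set) rep" where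
  "verma_simple_quotient \<xi> h = quotient_rep (verma \<xi> h)
     (THE N. lie_submodule virasoro (verma \<xi> h) N \<and>
        simple_lie_module virasoro (quotient_rep (verma \<xi> h) N))"


section \<open>The categories \<open>W\<close> and \<open>W(0)\<close>\<close>

definition n_plus_locally_finite :: "(vir, 'v) rep \<Rightarrow> bool" where
  "n_plus_locally_finite V \<longleftrightarrow>
     (\<forall>v\<in>carrier V. \<exists>S. finite S \<and> S \<subseteq> carrier V \<and> v \<in> lin_span V S \<and>
        (\<forall>x\<in>vir_n_plus. \<forall>u\<in>lin_span V S. act V x u \<in> lin_span V S))"

definition cat_W :: "(vir, 'v) rep \<Rightarrow> bool" where
  "cat_W V \<longleftrightarrow> lie_module virasoro V \<and> n_plus_locally_finite V"

definition cat_W0 :: "(vir, 'v) rep \<Rightarrow> bool" where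
  "cat_W0 V \<longleftrightarrow> cat_W V \<and>
     (\<forall>v\<in>carrier V. \<forall>x\<in>vir_n_plus. \<exists>m. \<forall>k\<ge>m. (act V x ^^ k) v = \<zero>\<^bsub>V\<^esub>)"

definition simple_object_W0 :: "(vir, 'v) rep \<Rightarrow> bool" where
  "simple_object_W0 V \<longleftrightarrow> cat_W0 V \<and> carrier V \<noteq> {\<zero>\<^bsub>V\<^esub>} \<and>
     (\<forall>N. lie_submodule virasoro V N \<and> cat_W0 (V\<lparr>carrier := N\<rparr>) \<longrightarrow>
        N = {\<zero>\<^bsub>V\<^esub>} \<or> N = carrier V)"

section \<open>Well-formedness of the Virasoro data\<close>

lemma lookup_vir_smult [simp]: "Poly_Mapping.lookup (vir_smult c x) a = c * Poly_Mapping.lookup x a"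
  by (simp add: vir_smult_def Poly_Mapping.map.rep_eq when_def)

lemma complex_ring_simps [simp]:
  "carrier complex_ring = UNIV" "x \<otimes>\<^bsub>complex_ring\<^esub> y = x * y"
  "x \<oplus>\<^bsub>complex_ring\<^esub> y = x + y" "\<one>\<^bsub>complex_ring\<^esub> = 1" "\<zero>\<^bsub>complex_ring\<^esub> = 0"
  by (simp_all add: ring_of_type_algebra_def)

lemma virasoro_simps [simp]:
  "carrier virasoro = UNIV" "x \<oplus>\<^bsub>virasoro\<^esub> y = x + y" "\<zero>\<^bsub>virasoro\<^esub> = 0"
  "c \<odot>\<^bsub>virasoro\<^esub> x = vir_smult c x" "lbracket virasoro x y = vir_bracket x y"
  by (simp_all add: virasoro_def)

lemma vir_smult_add_right: "vir_smult c (x + y) = vir_smult c x + vir_smult c y"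
  by (rule poly_mapping_eqI) (simp add: lookup_add algebra_simps)

lemma vir_smult_add_left: "vir_smult (c + d) x = vir_smult c x + vir_smult d x"
  by (rule poly_mapping_eqI) (simp add: lookup_add algebra_simps)

lemma vir_smult_assoc: "vir_smult c (vir_smult d x) = vir_smult (c * d) x"
  by (rule poly_mapping_eqI) (simp add: algebra_simps)

lemma vir_smult_0 [simp]: "vir_smult 0 x = 0" "vir_smult c 0 = 0" "vir_smult 1 x = x"
  by (auto intro: poly_mapping_eqI)

lemma vir_smult_sum: "vir_smult c (sum f A) = (\<Sum>a\<in>A. vir_smult c (f a))"
  by (induction A rule: infinite_finite_induct) (auto simp: vir_smult_add_right)

lemma vir_bracket_expand:
  assumes "finite A" "Poly_Mapping.keys x \<subseteq> A" "finite B" "Poly_Mapping.keys y \<subseteq> B"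
  shows "vir_bracket x y = (\<Sum>a\<in>A. \<Sum>b\<in>B.
     vir_smult (Poly_Mapping.lookup x a * Poly_Mapping.lookup y b) (vir_basis_bracket a b))"
proof -
  have "vir_bracket x y = (\<Sum>a\<in>Poly_Mapping.keys x. \<Sum>b\<in>B.
     vir_smult (Poly_Mapping.lookup x a * Poly_Mapping.lookup y b) (vir_basis_bracket a b))"
    unfolding vir_bracket_def
    by (intro sum.cong refl sum.mono_neutral_left) (use assms in \<open>auto simp: in_keys_iff\<close>)
  also have "\<dots> = (\<Sum>a\<in>A. \<Sum>b\<in>B.
     vir_smult (Poly_Mapping.lookup x a * Poly_Mapping.lookup y b) (vir_basis_bracket a b))"
    by (intro sum.mono_neutral_left) (use assms in \<open>auto simp: in_keys_iff\<close>)
  finally show ?thesis .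
qed

lemma vir_bracket_add_left: "vir_bracket (x + y) w = vir_bracket x w + vir_bracket y w"
proof -
  let ?A = "Poly_Mapping.keys x \<union> Poly_Mapping.keys y"
  have "Poly_Mapping.keys (x + y) \<subseteq> ?A" by (rule Poly_Mapping.keys_add)
  then show ?thesis
    by (simp add: vir_bracket_expand[of ?A _ "Poly_Mapping.keys w"] lookup_add distrib_right
        vir_smult_add_left sum.distrib)
qed

lemma vir_bracket_add_right: "vir_bracket w (x + y) = vir_bracket w x + vir_bracket w y"
proof -
  let ?A = "Poly_Mapping.keys x \<union> Poly_Mapping.keys y"
  have "Poly_Mapping.keys (x + y) \<subseteq> ?A" by (rule Poly_Mapping.keys_add)
  then show ?thesis
    by (simp add: vir_bracket_expand[of "Poly_Mapping.keys w" _ ?A] lookup_add distrib_left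
        vir_smult_add_left sum.distrib)
qed

lemma vir_bracket_smult_left: "vir_bracket (vir_smult c x) y = vir_smult c (vir_bracket x y)"
proof -
  have "Poly_Mapping.keys (vir_smult c x) \<subseteq> Poly_Mapping.keys x" by (auto simp: in_keys_iff)
  then show ?thesis
    by (simp add: vir_bracket_expand[of "Poly_Mapping.keys x" _ "Poly_Mapping.keys y"] vir_smult_sum vir_smult_assoc
        mult.assoc)
qed

lemma vir_bracket_smult_right: "vir_bracket x (vir_smult c y) = vir_smult c (vir_bracket x y)"
proof -
  have "Poly_Mapping.keys (vir_smult c y) \<subseteq> Poly_Mapping.keys y" by (auto simp: in_keys_iff)
  then show ?thesis
    by (simp add: vir_bracket_expand[of "Poly_Mapping.keys x" _ "Poly_Mapping.keys y"] vir_smult_sum vir_smult_assoc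
        mult_ac)
qed

lemma vir_bracket_basis [simp]:
  "vir_bracket (Poly_Mapping.single a 1) (Poly_Mapping.single b 1) = vir_basis_bracket a b"
  by (simp add: vir_bracket_def)

lemma vir_bracket_zero [simp]: "vir_bracket 0 x = 0" "vir_bracket x 0 = 0"
  by (simp_all add: vir_bracket_def)

lemma vir_expansion:
  "x = (\<Sum>a\<in>Poly_Mapping.keys x. vir_smult (Poly_Mapping.lookup x a) (Poly_Mapping.single a 1))"
  by (rule poly_mapping_eqI)
     (auto simp: lookup_sum lookup_single when_def in_keys_iff sum.delta' if_distrib cong: if_cong)

lemma vir_induct [case_names zero add smult basis]:
  assumes "P 0" "\<And>x y. P x \<Longrightarrow> P y \<Longrightarrow> P (x + y)" "\<And>c x. P x \<Longrightarrow> P (vir_smult c x)"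
    and "\<And>a. P (Poly_Mapping.single a 1)"
  shows "P x"
proof -
  have "P (\<Sum>a\<in>A. vir_smult (Poly_Mapping.lookup x a) (Poly_Mapping.single a 1))" for A
    by (induction A rule: infinite_finite_induct) (auto intro: assms)
  then show ?thesis
    by (metis vir_expansion)
qed

lemma vir_basis_bracket_anti: "vir_basis_bracket a b = - vir_basis_bracket b a"
  by (cases a; cases b)
     (auto intro!: poly_mapping_eqI simp: lookup_add lookup_single when_def add.commute
       power3_eq_cube field_simps)

lemma vir_smult_minus: "vir_smult c (- x) = - vir_smult c x"
  by (rule poly_mapping_eqI) simp

lemma vir_bracket_anti: "vir_bracket x y = - vir_bracket y x"
proof -
  have "vir_bracket x y = (\<Sum>b\<in>Poly_Mapping.keys y. \<Sum>a\<in>Poly_Mapping.keys x.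
      vir_smult (Poly_Mapping.lookup x a * Poly_Mapping.lookup y b) (vir_basis_bracket a b))"
    unfolding vir_bracket_def by (rule sum.swap)
  also have "\<dots> = (\<Sum>b\<in>Poly_Mapping.keys y. \<Sum>a\<in>Poly_Mapping.keys x.
      - vir_smult (Poly_Mapping.lookup y b * Poly_Mapping.lookup x a) (vir_basis_bracket b a))"
    by (intro sum.cong refl) (metis vir_basis_bracket_anti vir_smult_minus mult.commute)
  finally show ?thesis
    by (simp add: vir_bracket_def sum_negf)
qed

lemma vir_bracket_self: "vir_bracket x x = 0"
proof -
  have "Poly_Mapping.lookup (vir_bracket x x) a = - Poly_Mapping.lookup (vir_bracket x x) a" for a
    using vir_bracket_anti[of x x] by (metis lookup_uminus)
  then show ?thesis
    by (intro poly_mapping_eqI) simp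
qed

lemma vir_bracket_basis_bracket:
  "vir_bracket (vir_d i) (vir_basis_bracket (Dk j) (Dk k)) =
     vir_smult (of_int ((j - k) * (i - j - k))) (vir_d (i + j + k)) +
     (if i + j + k = 0 then vir_smult (of_int ((j - k) * (i ^ 3 - i)) / 12) vir_z else 0)"
proof -
  have "vir_bracket (vir_d i) (vir_basis_bracket (Dk j) (Dk k)) =
      vir_smult (of_int (j - k)) (vir_basis_bracket (Dk i) (Dk (j + k)))"
    by (auto simp: vir_bracket_add_right vir_bracket_smult_right)
  moreover have "j + k = - i \<longleftrightarrow> i + j + k = 0"
    by presburger
  ultimately show ?thesis
    by (simp add: vir_smult_add_right vir_smult_assoc add.assoc diff_diff_eq)
qed

lemma vir_jacobi:
  "vir_bracket x (vir_bracket y w) + vir_bracket y (vir_bracket w x)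
     + vir_bracket w (vir_bracket x y) = 0" (is "?J x y w = 0")
proof -
  have zero: "?J 0 y w = 0"
    and add: "?J (x + x') y w = ?J x y w + ?J x' y w"
    and smult: "?J (vir_smult c x) y w = vir_smult c (?J x y w)" for x x' y w c
    by (simp_all add: vir_bracket_add_left vir_bracket_add_right vir_bracket_smult_left
        vir_bracket_smult_right vir_smult_add_right)
  have rot: "?J x y w = ?J y w x" for x y w
    by (simp add: add_ac)
  let ?b = "\<lambda>a. Poly_Mapping.single a (1::complex)"
  have d: "?J (vir_d i) (vir_d j) (vir_d k) = 0" for i j k
  proof -
    have perm: "j + k + i = i + j + k" "k + i + j = i + j + k"
      by simp_all
    have "complex_of_int ((j - k) * (i - j - k)) + of_int ((k - i) * (j - k - i))
        + of_int ((i - j) * (k - i - j)) = 0"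
      unfolding of_int_add[symmetric] by (simp add: algebra_simps)
    moreover have "complex_of_int ((j - k) * (i ^ 3 - i)) / 12 + of_int ((k - i) * (j ^ 3 - j)) / 12
        + of_int ((i - j) * (k ^ 3 - k)) / 12 = 0" if "i + j + k = 0"
    proof -
      have k: "k = - i - j" using that by simp
      have "(j - k) * (i ^ 3 - i) + (k - i) * (j ^ 3 - j) + (i - j) * (k ^ 3 - k) = 0"
        unfolding k by (simp add: algebra_simps power3_eq_cube)
      then show ?thesis
        by (metis add_divide_distrib div_0 of_int_0 of_int_add)
    qed
    ultimately show ?thesis
      unfolding vir_bracket_basis vir_bracket_basis_bracket perm
      by (auto intro!: poly_mapping_eqI simp: lookup_add lookup_single when_def)
  qed
  have z: "?J vir_z (?b a) (?b b) = 0" for a b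
  proof -
    have "vir_bracket vir_z y = 0" "vir_bracket y vir_z = 0" for y
    proof -
      show "vir_bracket vir_z y = 0"
        by (induction y rule: vir_induct)
          (auto simp: vir_bracket_add_right vir_bracket_smult_right)
      then show "vir_bracket y vir_z = 0"
        using vir_bracket_anti[of y vir_z] by simp
    qed
    then show ?thesis by simp
  qed
  have b: "?J (?b a) (?b b) (?b e) = 0" for a b e
    using d z rot by (cases a; cases b; cases e) metis+
  have 1: "?J x (?b b) (?b e) = 0" for x b e
    by (induction x rule: vir_induct) (simp_all only: zero add smult b vir_smult_0 add_0)
  have 2: "?J x y (?b e) = 0" for x y e
  proof -
    have "?J y (?b e) x = 0"
      by (induction y rule: vir_induct)
        (simp_all only: zero add smult vir_smult_0 add_0 1 rot[of "?b _" "?b e" x] rot[of "?b e" x])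
    then show ?thesis using rot by metis
  qed
  have "?J w x y = 0"
    by (induction w rule: vir_induct)
      (simp_all only: zero add smult vir_smult_0 add_0 2 rot[of "?b _" x y])
  then show ?thesis using rot by metis
qed

lemma module_virasoro: "module complex_ring virasoro"
proof (rule moduleI)
  show "abelian_group virasoro"
  proof (rule abelian_groupI)
    show "\<exists>y\<in>carrier virasoro. y \<oplus>\<^bsub>virasoro\<^esub> x = \<zero>\<^bsub>virasoro\<^esub>" for x
      by (intro bexI[of _ "- x"]) auto
  qed (auto simp: add_ac)
qed (auto simp: vir_smult_add_left vir_smult_add_right vir_smult_assoc)

lemma lie_algebra_virasoro: "lie_algebra virasoro"
  by (intro lie_algebra.intro lie_algebra_axioms.intro module_virasoro)
     (simp_all add: vir_bracket_add_left vir_bracket_add_right vir_bracket_smult_left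
        vir_bracket_smult_right vir_bracket_self vir_jacobi)

lemma submodule_virasoroI:
  assumes "0 \<in> H" "\<And>x y. x \<in> H \<Longrightarrow> y \<in> H \<Longrightarrow> x + y \<in> H" "\<And>c x. x \<in> H \<Longrightarrow> vir_smult c x \<in> H"
  shows "submodule H complex_ring virasoro"
proof -
  interpret module complex_ring virasoro by (rule module_virasoro)
  have "vir_smult (- 1) x + x = 0" for x
    using vir_smult_add_left[of "- 1" 1 x] by simp
  then have "\<ominus>\<^bsub>virasoro\<^esub> x = vir_smult (- 1) x" for x
    by (intro M.minus_equality) auto
  then show ?thesis
    using assms by (intro submoduleI) auto
qed

lemma submodule_keys: "submodule {x. Poly_Mapping.keys x \<subseteq> I} complex_ring virasoro"
proof (rule submodule_virasoroI)
  fix x y :: vir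
  assume "x \<in> {x. Poly_Mapping.keys x \<subseteq> I}" "y \<in> {x. Poly_Mapping.keys x \<subseteq> I}"
  then show "x + y \<in> {x. Poly_Mapping.keys x \<subseteq> I}"
    using Poly_Mapping.keys_add[of x y] by blast
next
  fix c and x :: vir
  have "Poly_Mapping.keys (vir_smult c x) \<subseteq> Poly_Mapping.keys x"
    by (auto simp: in_keys_iff)
  then show "vir_smult c x \<in> {x. Poly_Mapping.keys x \<subseteq> I}"
    if "x \<in> {x. Poly_Mapping.keys x \<subseteq> I}"
    using that by blast
qed simp

lemma lin_span_basis:
  "lin_span virasoro ((\<lambda>a. Poly_Mapping.single a 1) ` I) = {x. Poly_Mapping.keys x \<subseteq> I}"
  (is "_ = ?R")
proof
  have "submodule ?R complex_ring virasoro"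
    by (rule submodule_keys)
  then show "lin_span virasoro ((\<lambda>a. Poly_Mapping.single a 1) ` I) \<subseteq> ?R"
    by (auto simp: lin_span_def)
next
  interpret module complex_ring virasoro by (rule module_virasoro)
  show "?R \<subseteq> lin_span virasoro ((\<lambda>a. Poly_Mapping.single a 1) ` I)"
  proof (clarsimp simp: lin_span_def)
    fix x :: vir and H assume x: "Poly_Mapping.keys x \<subseteq> I" and H: "submodule H complex_ring virasoro"
      and S: "(\<lambda>a. Poly_Mapping.single a 1) ` I \<subseteq> H"
    have "0 \<in> H" using submodule.axioms(1)[OF H] subgroup.one_closed by force
    moreover have "u + v \<in> H" "vir_smult c u \<in> H" if "u \<in> H" "v \<in> H" for u v c
      using submoduleE(4,5)[OF H] that by auto
    ultimately have "(\<Sum>a\<in>A. vir_smult (Poly_Mapping.lookup x a) (Poly_Mapping.single a 1)) \<in> H"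
      if "A \<subseteq> I" for A
      using that S by (induction A rule: infinite_finite_induct) auto
    moreover have "x = (\<Sum>a\<in>Poly_Mapping.keys x.
        vir_smult (Poly_Mapping.lookup x a) (Poly_Mapping.single a 1))"
      by (rule vir_expansion)
    ultimately show "x \<in> H" using x by metis
  qed
qed

lemma carrier_vir_borel:
  "carrier vir_borel = {x. Poly_Mapping.keys x \<subseteq> insert Zc (Dk ` {0..})}"
proof -
  have n: "vir_n_plus = {x. Poly_Mapping.keys x \<subseteq> Dk ` {0<..}}"
    using lin_span_basis[of "Dk ` {0<..}"] by (simp add: vir_n_plus_def image_image)
  have h: "vir_h = {x. Poly_Mapping.keys x \<subseteq> {Dk 0, Zc}}"
    using lin_span_basis[of "{Dk 0, Zc}"] by (simp add: vir_h_def)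
  have "{0::int..} = insert 0 {0<..}"
    by auto
  then have I: "insert Zc (Dk ` {0..}) = {Dk 0, Zc} \<union> Dk ` {0<..}"
    by auto
  have sum: "x \<in> carrier vir_borel \<longleftrightarrow> (\<exists>u v. x = u + v \<and> Poly_Mapping.keys u \<subseteq> {Dk 0, Zc} \<and>
      Poly_Mapping.keys v \<subseteq> Dk ` {0<..})" for x
    unfolding vir_borel_def by (simp add: set_add_def' n h) blast
  show ?thesis
  proof (intro equalityI subsetI)
    fix x assume "x \<in> carrier vir_borel"
    then obtain u v where uv: "x = u + v" "Poly_Mapping.keys u \<subseteq> {Dk 0, Zc}"
      "Poly_Mapping.keys v \<subseteq> Dk ` {0<..}"
      unfolding sum by blast
    have "Poly_Mapping.keys x \<subseteq> {Dk 0, Zc} \<union> Dk ` {0<..}"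
      unfolding uv(1) by (rule order_trans[OF Poly_Mapping.keys_add Un_mono[OF uv(2,3)]])
    then show "x \<in> {x. Poly_Mapping.keys x \<subseteq> insert Zc (Dk ` {0..})}"
      unfolding I by (rule CollectI)
  next
    fix x :: vir assume x: "x \<in> {x. Poly_Mapping.keys x \<subseteq> insert Zc (Dk ` {0..})}"
    define u where "u = vir_smult (Poly_Mapping.lookup x (Dk 0)) (vir_d 0)
      + vir_smult (Poly_Mapping.lookup x Zc) vir_z"
    have lu: "Poly_Mapping.lookup u a = (if a \<in> {Dk 0, Zc} then Poly_Mapping.lookup x a else 0)" for a
      by (auto simp: u_def lookup_add lookup_single when_def)
    have "Poly_Mapping.keys u \<subseteq> {Dk 0, Zc}"
      by (rule subsetI) (simp add: in_keys_iff lu split: if_splits)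
    moreover have "Poly_Mapping.keys (x - u) \<subseteq> Dk ` {0<..}"
    proof
      fix a assume "a \<in> Poly_Mapping.keys (x - u)"
      then have "a \<in> Poly_Mapping.keys x" "a \<notin> {Dk 0, Zc}"
        by (simp_all add: in_keys_iff lu lookup_minus split: if_splits)
      then show "a \<in> Dk ` {0<..}" using x unfolding I by blast
    qed
    ultimately show "x \<in> carrier vir_borel"
      unfolding sum by (intro exI[of _ u] exI[of _ "x - u"]) simp
  qed
qed

lemma vir_borel_simps [simp]:
  "x \<oplus>\<^bsub>vir_borel\<^esub> y = x + y" "\<zero>\<^bsub>vir_borel\<^esub> = 0" "c \<odot>\<^bsub>vir_borel\<^esub> x = vir_smult c x"
  "lbracket vir_borel x y = vir_bracket x y"
  by (simp_all add: vir_borel_def virasoro_def)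

lemma vir_borel_bracket:
  assumes "x \<in> carrier vir_borel" "y \<in> carrier vir_borel"
  shows "vir_bracket x y \<in> carrier vir_borel"
    and "Poly_Mapping.lookup (vir_bracket x y) (Dk 0) = 0"
    and "Poly_Mapping.lookup (vir_bracket x y) Zc = 0"
proof -
  have *: "Poly_Mapping.lookup (vir_basis_bracket a b) e = 0"
    if "a \<in> insert Zc (Dk ` {0..})" "b \<in> insert Zc (Dk ` {0..})" "e \<notin> Dk ` {0<..}" for a b e
  proof (cases "\<exists>k j. a = Dk k \<and> b = Dk j")
    case True
    then obtain k j where kj: "a = Dk k" "b = Dk j"
      by blast
    moreover have "k \<ge> 0" "j \<ge> 0"
      using that kj by auto
    ultimately consider "a = Dk 0" "b = Dk 0" | "k + j > 0" "a = Dk k" "b = Dk j"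
      by fastforce
    then show ?thesis
      using that(3)
      by cases (auto simp: lookup_add lookup_single when_def image_iff)
  next
    case False
    then show ?thesis
      by (cases a; cases b) auto
  qed
  have "Poly_Mapping.lookup (vir_bracket x y) e = 0" if "e \<notin> Dk ` {0<..}" for e
    using assms that unfolding vir_bracket_def carrier_vir_borel lookup_sum lookup_vir_smult
    by (intro sum.neutral ballI mult_eq_0_iff[THEN iffD2] disjI2 *) auto
  then have "Poly_Mapping.keys (vir_bracket x y) \<subseteq> Dk ` {0<..}"
    and "Poly_Mapping.lookup (vir_bracket x y) (Dk 0) = 0"
    and "Poly_Mapping.lookup (vir_bracket x y) Zc = 0"
    by (auto simp: in_keys_iff)
  moreover have "Dk ` {0<..} \<subseteq> insert Zc (Dk ` {0..})"
    by auto
  ultimately show "vir_bracket x y \<in> carrier vir_borel"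
      "Poly_Mapping.lookup (vir_bracket x y) (Dk 0) = 0"
      "Poly_Mapping.lookup (vir_bracket x y) Zc = 0"
    by (auto simp: carrier_vir_borel)
qed

lemma lie_algebra_vir_borel: "lie_algebra vir_borel"
proof -
  have "submodule (carrier vir_borel) complex_ring virasoro"
    unfolding carrier_vir_borel
    by (rule submodule_keys)
  then have "module complex_ring (virasoro\<lparr>carrier := carrier vir_borel\<rparr>)"
    by (rule submodule.submodule_is_module) (rule module_virasoro)
  then have "module complex_ring vir_borel"
    by (simp add: vir_borel_def)
  then show ?thesis
    by (intro lie_algebra.intro lie_algebra_axioms.intro)
       (simp_all add: vir_bracket_add_left vir_bracket_add_right vir_bracket_smult_left
          vir_bracket_smult_right vir_bracket_self vir_jacobi vir_borel_bracket)
qed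

lemma lie_module_weight_rep: "lie_module vir_borel (weight_rep \<xi> h)"
proof -
  have "abelian_group (weight_rep \<xi> h)"
  proof (rule abelian_groupI)
    show "\<exists>y\<in>carrier (weight_rep \<xi> h). y \<oplus>\<^bsub>weight_rep \<xi> h\<^esub> x = \<zero>\<^bsub>weight_rep \<xi> h\<^esub>" for x
      by (intro bexI[of _ "- x"]) (auto simp: weight_rep_def)
  qed (auto simp: weight_rep_def add_ac)
  then have m: "module complex_ring (weight_rep \<xi> h)"
    by (intro moduleI cring_from_type_algebra) (auto simp: weight_rep_def algebra_simps)
  then interpret module complex_ring "weight_rep \<xi> h" .
  have minus: "u \<ominus>\<^bsub>weight_rep \<xi> h\<^esub> u = 0" for u
    using M.r_neg[of u] by (simp add: a_minus_def) (simp add: weight_rep_def)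
  show ?thesis
  proof (intro lie_module.intro lie_module_axioms.intro lie_algebra_vir_borel m)
    fix x y v assume "x \<in> carrier vir_borel" "y \<in> carrier vir_borel"
    moreover have "act (weight_rep \<xi> h) x (act (weight_rep \<xi> h) y v)
        = act (weight_rep \<xi> h) y (act (weight_rep \<xi> h) x v)"
      by (simp add: weight_rep_def algebra_simps)
    ultimately show "act (weight_rep \<xi> h) (lbracket vir_borel x y) v =
        act (weight_rep \<xi> h) x (act (weight_rep \<xi> h) y v)
          \<ominus>\<^bsub>weight_rep \<xi> h\<^esub> act (weight_rep \<xi> h) y (act (weight_rep \<xi> h) x v)"
      by (simp add: minus vir_borel_bracket) (simp add: weight_rep_def vir_borel_bracket)
  qed (auto simp: weight_rep_def lookup_add algebra_simps)
qed

end

theory Submission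
  imports Defs "HOL-Computational_Algebra.Fundamental_Theorem_Algebra"
    "HOL-Analysis.Continuum_Not_Denumerable"
begin

text \<open>
  Let \<open>V\<close> be a simple object of \<open>W(0)\<close>. Submodules of \<open>V\<close> again belong to \<open>W(0)\<close>, so \<open>V\<close> is a simple
  module, and \<open>V = U(\<gg>) / I\<close> for the annihilator \<open>I\<close> of any nonzero vector, a maximal left ideal. The
  claim thus becomes one about left ideals of \<open>U(\<gg>)\<close>: some vector has an annihilator that contains the
  left ideal of a Verma module, and above that ideal there is only one maximal left ideal.

  A nonzero vector killed by \<open>n\<^sup>+\<close> exists by an argument in the style of Engel's theorem
  (\<open>obtain_singular_vector\<close>). On a finite-dimensional subspace stable under \<open>n\<^sup>+\<close>, the nilpotency of
  \<open>d\<^sub>1\<close> forces \<open>d\<^sub>k = 0\<close> for large \<open>k\<close>, since the higher \<open>d\<^sub>k\<close> are iterated commutators with \<open>d\<^sub>1\<close>; the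
  remaining finitely many \<open>d\<^sub>k\<close> are treated one after the other.

  The central element acts by a scalar \<open>\<xi>\<close> (\<open>central_element_scalar\<close>), by Schur's lemma for modules of
  countable dimension over the uncountable field \<open>\<complex>\<close>. The element \<open>d\<^sub>0\<close> is not central, and finding an
  eigenvector for it among the vectors killed by \<open>n\<^sup>+\<close> is the heart of the proof
  (\<open>exists_highest_weight_vector\<close>). If a vector \<open>w\<close> killed by \<open>n\<^sup>+\<close> generates a module \<open>\<complex>[d\<^sub>0] w\<close> that is
  not free, it contains an eigenvector. If it is free, then \<open>V\<close> is the Verma module over the ring
  \<open>\<complex>[d\<^sub>0]\<close>, that is, with the variable \<open>d\<^sub>0\<close> as its highest weight: the ordered monomials in the
  \<open>d\<^sub>k\<close> with \<open>k < 0\<close>, applied to \<open>w\<close>, are linearly independent over \<open>\<complex>[d\<^sub>0]\<close>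
  (\<open>ordered_monomials_independent\<close>). The reason is that the Shapovalov pairing of such monomials is
  nondegenerate for a generic highest weight, because its terms of highest order in \<open>d\<^sub>0\<close> come only
  from pairing a monomial with its own transpose (\<open>pairing_leading_term\<close>). But then \<open>w\<close> does not lie in the
  submodule generated by \<open>d\<^sub>0 w\<close>, which contradicts simplicity.

  With a highest weight vector \<open>w\<close> of weight \<open>(\<xi>, h)\<close> at hand, the universal property of the induced
  module (\<open>verma_kernel_annihilates\<close>) shows that \<open>V\<close> is a quotient of the Verma module. The maximal
  submodule of the latter is unique, since every proper submodule avoids the highest weight space
  (\<open>maximal_left_ideal_unique\<close>), and so \<open>V\<close> is its simple quotient.
\<close>

section \<open>Enveloping algebras and their modules\<close>

lemma free_algebra_carrier:
  "t \<in> carrier (free_algebra S) \<longleftrightarrow> (\<forall>w\<in>Poly_Mapping.keys t. set (letters w) \<subseteq> S)"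
  by (simp add: free_algebra_def)

lemma free_algebra_simps [simp]:
  "a \<otimes>\<^bsub>free_algebra S\<^esub> b = a * b" "a \<oplus>\<^bsub>free_algebra S\<^esub> b = a + b"
  "\<one>\<^bsub>free_algebra S\<^esub> = 1" "\<zero>\<^bsub>free_algebra S\<^esub> = 0"
  by (simp_all add: free_algebra_def)

lemma free_algebra_closed:
  "a \<in> carrier (free_algebra S) \<Longrightarrow> b \<in> carrier (free_algebra S) \<Longrightarrow> a + b \<in> carrier (free_algebra S)"
  "a \<in> carrier (free_algebra S) \<Longrightarrow> b \<in> carrier (free_algebra S) \<Longrightarrow> a * b \<in> carrier (free_algebra S)"
  "a \<in> carrier (free_algebra S) \<Longrightarrow> - a \<in> carrier (free_algebra S)"
  "a \<in> carrier (free_algebra S) \<Longrightarrow> b \<in> carrier (free_algebra S) \<Longrightarrow> a - b \<in> carrier (free_algebra S)"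
  using Poly_Mapping.keys_add[of a b] keys_diff[of a b] keys_mult[of a b]
  unfolding free_algebra_carrier by (blast, fastforce simp: plus_word_def, simp add: keys_minus, blast)

lemma free_algebra_ring: "ring (free_algebra S)"
proof (rule ringI)
  show "abelian_group (free_algebra S)"
  proof (rule abelian_groupI)
    fix a assume "a \<in> carrier (free_algebra S)"
    then show "\<exists>b\<in>carrier (free_algebra S). b \<oplus>\<^bsub>free_algebra S\<^esub> a = \<zero>\<^bsub>free_algebra S\<^esub>"
      using free_algebra_closed(3) by (intro bexI[of _ "- a"]) auto
  qed (auto simp: add_ac free_algebra_closed free_algebra_carrier[of 0])
  show "monoid (free_algebra S)"
    by unfold_locales
      (auto simp: mult.assoc free_algebra_closed free_algebra_carrier[of 1] in_keys_iff lookup_one when_def zero_word_def split: if_splits)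
qed (auto simp: algebra_simps)

lemma free_algebra_minus:
  assumes "a \<in> carrier (free_algebra S)"
  shows "\<ominus>\<^bsub>free_algebra S\<^esub> a = - a"
proof -
  interpret ring "free_algebra S" by (rule free_algebra_ring)
  show ?thesis
    using assms free_algebra_closed(3) by (intro minus_equality) auto
qed

lemma gen_carrier: "gen x \<in> carrier (free_algebra S) \<longleftrightarrow> x \<in> S"
  and scalar_carrier: "scalar c \<in> carrier (free_algebra S)"
  by (auto simp: free_algebra_carrier in_keys_iff lookup_single when_def zero_word_def split: if_splits)

definition uea_relations :: "'g lie \<Rightarrow> ('g word \<Rightarrow>\<^sub>0 complex) set" where
  "uea_relations L =
     {gen (x \<oplus>\<^bsub>L\<^esub> y) - gen x - gen y | x y. x \<in> carrier L \<and> y \<in> carrier L} \<union>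
      {gen (c \<odot>\<^bsub>L\<^esub> x) - scalar c * gen x | c x. x \<in> carrier L} \<union>
      {gen x * gen y - gen y * gen x - gen (lbracket L x y) | x y.
         x \<in> carrier L \<and> y \<in> carrier L}"

lemma uea_ideal_relations: "uea_ideal L = Idl\<^bsub>free_algebra (carrier L)\<^esub> (uea_relations L)"
  by (simp add: uea_ideal_def uea_relations_def)

context lie_algebra
begin

abbreviation FA where "FA \<equiv> free_algebra (carrier L)"

lemma uea_relations_carrier: "uea_relations L \<subseteq> carrier FA"
  unfolding uea_relations_def
  by (intro Un_least subsetI; clarify; intro free_algebra_closed; simp add: gen_carrier scalar_carrier lbracket_closed)

lemma ideal_uea: "ideal (uea_ideal L) FA"
  unfolding uea_ideal_relations
  by (rule ring.genideal_ideal[OF free_algebra_ring uea_relations_carrier])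

lemma uea_relations_in_ideal: "uea_relations L \<subseteq> uea_ideal L"
  unfolding uea_ideal_relations
  by (rule ring.genideal_self[OF free_algebra_ring uea_relations_carrier])

lemma uea_ideal_minimal: "ideal I FA \<Longrightarrow> uea_relations L \<subseteq> I \<Longrightarrow> uea_ideal L \<subseteq> I"
  unfolding uea_ideal_relations
  by (rule ring.genideal_minimal[OF free_algebra_ring])

lemma uea_ideal_carrier: "t \<in> uea_ideal L \<Longrightarrow> t \<in> carrier FA"
  by (rule additive_subgroup.a_Hcarr[OF ideal.axioms(1)[OF ideal_uea]])

lemma uea_ideal_closed:
  shows "0 \<in> uea_ideal L"
    and "a \<in> uea_ideal L \<Longrightarrow> b \<in> uea_ideal L \<Longrightarrow> a + b \<in> uea_ideal L"
    and "a \<in> uea_ideal L \<Longrightarrow> - a \<in> uea_ideal L"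
    and "a \<in> uea_ideal L \<Longrightarrow> b \<in> uea_ideal L \<Longrightarrow> a - b \<in> uea_ideal L"
    and "a \<in> uea_ideal L \<Longrightarrow> t \<in> carrier FA \<Longrightarrow> t * a \<in> uea_ideal L"
    and "a \<in> uea_ideal L \<Longrightarrow> t \<in> carrier FA \<Longrightarrow> a * t \<in> uea_ideal L"
proof -
  interpret I: ideal "uea_ideal L" FA by (rule ideal_uea)
  show "0 \<in> uea_ideal L" using additive_subgroup.zero_closed[OF I.additive_subgroup_axioms] by simp
  show add: "a \<in> uea_ideal L \<Longrightarrow> b \<in> uea_ideal L \<Longrightarrow> a + b \<in> uea_ideal L" for a b
    using additive_subgroup.a_closed[OF I.additive_subgroup_axioms, of a b] by simp
  show minus: "a \<in> uea_ideal L \<Longrightarrow> - a \<in> uea_ideal L" for a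
    using additive_subgroup.a_inv_closed[OF I.additive_subgroup_axioms, of a] free_algebra_minus uea_ideal_carrier by metis
  show "a \<in> uea_ideal L \<Longrightarrow> b \<in> uea_ideal L \<Longrightarrow> a - b \<in> uea_ideal L"
    using add[of a "- b"] minus[of b] by simp
  show "a \<in> uea_ideal L \<Longrightarrow> t \<in> carrier FA \<Longrightarrow> t * a \<in> uea_ideal L"
    using I.I_l_closed[of a t] by (simp)
  show "a \<in> uea_ideal L \<Longrightarrow> t \<in> carrier FA \<Longrightarrow> a * t \<in> uea_ideal L"
    using I.I_r_closed[of a t] by (simp)
qed

lemma mem_uea_class: "s \<in> uea_class L t \<longleftrightarrow> s - t \<in> uea_ideal L"
proof -
  have "s = (s - t) + t" by simp
  then show ?thesis
    unfolding uea_class_def a_r_coset_def' by (auto simp: set_eq_iff intro!: bexI[of _ "s - t"])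
qed

lemma uea_class_eq_iff: "uea_class L s = uea_class L t \<longleftrightarrow> s - t \<in> uea_ideal L"
proof
  assume "uea_class L s = uea_class L t"
  then show "s - t \<in> uea_ideal L"
    using mem_uea_class[of s s] mem_uea_class[of s t] uea_ideal_closed(1) by simp
next
  assume st: "s - t \<in> uea_ideal L"
  have "u - s \<in> uea_ideal L \<longleftrightarrow> u - t \<in> uea_ideal L" for u
    using uea_ideal_closed(2)[of "u - s" "s - t"] uea_ideal_closed(4)[of "u - t" "s - t"] st by auto
  then show "uea_class L s = uea_class L t"
    by (auto simp: mem_uea_class)
qed

lemma carrier_uea: "carrier (uea L) = uea_class L ` carrier FA"
  by (auto simp: uea_def FactRing_def A_RCOSETS_defs uea_class_def a_r_coset_def)

lemma uea_class_mult:
  assumes "s \<in> carrier FA" "t \<in> carrier FA"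
  shows "uea_class L s \<otimes>\<^bsub>uea L\<^esub> uea_class L t = uea_class L (s * t)"
  using ideal.rcoset_mult_add[OF ideal_uea assms]
  by (simp add: uea_def FactRing_def uea_class_def)

lemma uea_class_add:
  assumes "s \<in> carrier FA" "t \<in> carrier FA"
  shows "uea_class L s \<oplus>\<^bsub>uea L\<^esub> uea_class L t = uea_class L (s + t)"
  using abelian_subgroup.a_rcos_sum[OF abelian_subgroupI3[OF ideal.axioms(1)[OF ideal_uea]
      ring.is_abelian_group[OF free_algebra_ring]] assms]
  by (simp add: uea_def FactRing_def uea_class_def)

end

lemma poly_mapping_expansion:
  "t = (\<Sum>w\<in>Poly_Mapping.keys t. Poly_Mapping.single w (Poly_Mapping.lookup t w))"
  by (rule poly_mapping_eqI) (simp add: lookup_sum lookup_single when_def in_keys_iff)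

lemma free_algebra_induct [consumes 1, case_names single add]:
  assumes "t \<in> carrier (free_algebra S)"
    and single: "\<And>w c. set (letters w) \<subseteq> S \<Longrightarrow> P (Poly_Mapping.single w c)"
    and add: "\<And>a b. a \<in> carrier (free_algebra S) \<Longrightarrow> b \<in> carrier (free_algebra S) \<Longrightarrow>
      P a \<Longrightarrow> P b \<Longrightarrow> P (a + b)"
  shows "P t"
proof -
  have sc: "Poly_Mapping.single w c \<in> carrier (free_algebra S)" if "set (letters w) \<subseteq> S"
    for w and c :: complex
    using that by (auto simp: free_algebra_carrier)
  have "P (\<Sum>w\<in>A. Poly_Mapping.single w (Poly_Mapping.lookup t w)) \<and>
      (\<Sum>w\<in>A. Poly_Mapping.single w (Poly_Mapping.lookup t w)) \<in> carrier (free_algebra S)"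
    if "finite A" "A \<subseteq> Poly_Mapping.keys t" for A
    using that
  proof (induction A rule: finite_induct)
    case empty
    then show ?case
      using single[of 0 0] free_algebra_carrier[of 0 S] by (simp add: zero_word_def)
  next
    case (insert w A)
    then have "set (letters w) \<subseteq> S"
      using assms(1) by (simp add: free_algebra_carrier)
    then show ?case
      using insert by (simp add: add single sc free_algebra_closed)
  qed
  from this[OF finite_keys order_refl] show ?thesis
    by (simp add: poly_mapping_expansion[symmetric])
qed

context lie_module
begin

lemma word_act_closed:
  "set (letters w) \<subseteq> carrier L \<Longrightarrow> v \<in> carrier V \<Longrightarrow> word_act V w v \<in> carrier V"
proof -
  have "set xs \<subseteq> carrier L \<Longrightarrow> v \<in> carrier V \<Longrightarrow> foldr (act V) xs v \<in> carrier V" for xs v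
    by (induction xs) (auto intro: act_closed)
  then show "set (letters w) \<subseteq> carrier L \<Longrightarrow> v \<in> carrier V \<Longrightarrow> word_act V w v \<in> carrier V"
    by (simp add: word_act_def)
qed

lemma word_act_add:
  assumes "set (letters w) \<subseteq> carrier L" "u \<in> carrier V" "v \<in> carrier V"
  shows "word_act V w (u \<oplus>\<^bsub>V\<^esub> v) = word_act V w u \<oplus>\<^bsub>V\<^esub> word_act V w v"
proof -
  have "set xs \<subseteq> carrier L \<Longrightarrow>
      foldr (act V) xs (u \<oplus>\<^bsub>V\<^esub> v) = foldr (act V) xs u \<oplus>\<^bsub>V\<^esub> foldr (act V) xs v" for xs
  proof (induction xs)
    case (Cons x xs)
    then show ?case
      using word_act_closed[of "Word xs"] assms(2,3) by (simp add: word_act_def act_add_right)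
  qed simp
  then show ?thesis using assms by (simp add: word_act_def)
qed

lemma word_act_smult:
  assumes "set (letters w) \<subseteq> carrier L" "v \<in> carrier V"
  shows "word_act V w (c \<odot>\<^bsub>V\<^esub> v) = c \<odot>\<^bsub>V\<^esub> word_act V w v"
proof -
  have "set xs \<subseteq> carrier L \<Longrightarrow> foldr (act V) xs (c \<odot>\<^bsub>V\<^esub> v) = c \<odot>\<^bsub>V\<^esub> foldr (act V) xs v" for xs
  proof (induction xs)
    case (Cons x xs)
    then show ?case
      using word_act_closed[of "Word xs"] assms(2) by (simp add: word_act_def act_smult_right)
  qed simp
  then show ?thesis using assms by (simp add: word_act_def)
qed

lemma free_act_superset:
  assumes "finite A" "Poly_Mapping.keys t \<subseteq> A" "\<And>w. w \<in> A \<Longrightarrow> set (letters w) \<subseteq> carrier L"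
    "v \<in> carrier V"
  shows "free_act V t v = (\<Oplus>\<^bsub>V\<^esub>w\<in>A. Poly_Mapping.lookup t w \<odot>\<^bsub>V\<^esub> word_act V w v)"
  unfolding free_act_def
proof (rule M.add.finprod_mono_neutral_cong_left[OF assms(1,2)])
  show "Poly_Mapping.lookup t w \<odot>\<^bsub>V\<^esub> word_act V w v = \<zero>\<^bsub>V\<^esub>" if "w \<in> A - Poly_Mapping.keys t" for w
    using that assms(3,4) smult_l_null[OF word_act_closed, of w v] by (simp add: in_keys_iff)
qed (use assms(3,4) word_act_closed in auto)

lemma free_act_single:
  assumes "set (letters w) \<subseteq> carrier L" "v \<in> carrier V"
  shows "free_act V (Poly_Mapping.single w c) v = c \<odot>\<^bsub>V\<^esub> word_act V w v"
  using free_act_superset[of "{w}" "Poly_Mapping.single w c" v] word_act_closed[OF assms] assms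
  by simp

lemma free_act_closed:
  assumes "t \<in> carrier (free_algebra (carrier L))" "v \<in> carrier V"
  shows "free_act V t v \<in> carrier V"
  unfolding free_act_def using assms
  by (intro M.finsum_closed) (auto simp: free_algebra_carrier word_act_closed)

lemma free_act_add_left:
  assumes "s \<in> carrier (free_algebra (carrier L))" "t \<in> carrier (free_algebra (carrier L))"
    "v \<in> carrier V"
  shows "free_act V (s + t) v = free_act V s v \<oplus>\<^bsub>V\<^esub> free_act V t v"
proof -
  let ?A = "Poly_Mapping.keys s \<union> Poly_Mapping.keys t"
  have A: "set (letters w) \<subseteq> carrier L" if "w \<in> ?A" for w
    using that assms by (auto simp: free_algebra_carrier)
  have "free_act V (s + t) v = (\<Oplus>\<^bsub>V\<^esub>w\<in>?A. Poly_Mapping.lookup (s + t) w \<odot>\<^bsub>V\<^esub> word_act V w v)"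
    by (rule free_act_superset) (use A assms Poly_Mapping.keys_add[of s t] in auto)
  also have "\<dots> = (\<Oplus>\<^bsub>V\<^esub>w\<in>?A. Poly_Mapping.lookup s w \<odot>\<^bsub>V\<^esub> word_act V w v \<oplus>\<^bsub>V\<^esub>
      Poly_Mapping.lookup t w \<odot>\<^bsub>V\<^esub> word_act V w v)"
    using word_act_closed[OF A assms(3)] smult_l_distr
    by (intro M.finsum_cong') (auto simp: lookup_add)
  also have "\<dots> = (\<Oplus>\<^bsub>V\<^esub>w\<in>?A. Poly_Mapping.lookup s w \<odot>\<^bsub>V\<^esub> word_act V w v) \<oplus>\<^bsub>V\<^esub>
      (\<Oplus>\<^bsub>V\<^esub>w\<in>?A. Poly_Mapping.lookup t w \<odot>\<^bsub>V\<^esub> word_act V w v)"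
    using word_act_closed[OF A assms(3)] by (intro M.finsum_addf) auto
  also have "\<dots> = free_act V s v \<oplus>\<^bsub>V\<^esub> free_act V t v"
    using free_act_superset[of ?A s v] free_act_superset[of ?A t v] A assms by simp
  finally show ?thesis .
qed

lemma free_act_add_right:
  assumes "t \<in> carrier (free_algebra (carrier L))" "u \<in> carrier V" "v \<in> carrier V"
  shows "free_act V t (u \<oplus>\<^bsub>V\<^esub> v) = free_act V t u \<oplus>\<^bsub>V\<^esub> free_act V t v"
  using assms(1)
proof (induction t rule: free_algebra_induct)
  case (single w c)
  then show ?case
    using assms(2,3) by (simp add: free_act_single word_act_add word_act_closed smult_r_distr)
next
  case (add a b)
  then show ?case
    using assms(2,3) by (simp add: free_act_add_left free_act_closed M.a_ac)
qed

lemma free_act_smult_right: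
  assumes "t \<in> carrier (free_algebra (carrier L))" "v \<in> carrier V"
  shows "free_act V t (c \<odot>\<^bsub>V\<^esub> v) = c \<odot>\<^bsub>V\<^esub> free_act V t v"
  using assms(1)
proof (induction t rule: free_algebra_induct)
  case (single w d)
  then show ?case
    using assms(2) smult_assoc1[of c d] smult_assoc1[of d c]
    by (simp add: free_act_single word_act_smult word_act_closed mult.commute)
next
  case (add a b)
  then show ?case
    using assms(2) by (simp add: free_act_add_left free_act_closed smult_r_distr)
qed

lemma free_act_mult:
  assumes "s \<in> carrier (free_algebra (carrier L))" "t \<in> carrier (free_algebra (carrier L))"
    "v \<in> carrier V"
  shows "free_act V (s * t) v = free_act V s (free_act V t v)"
  using assms(1)
proof (induction s rule: free_algebra_induct)
  case (single w c)
  show ?case using assms(2)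
  proof (induction t rule: free_algebra_induct)
    case (single w' c')
    have "word_act V (w + w') v = word_act V w (word_act V w' v)"
      by (simp add: word_act_def plus_word_def)
    then show ?case
      using \<open>set (letters w) \<subseteq> carrier L\<close> single assms(3) smult_assoc1[of c c']
      by (simp add: mult_single free_act_single word_act_closed word_act_smult plus_word_def)
  next
    case (add a b)
    have "Poly_Mapping.single w c \<in> carrier (free_algebra (carrier L))"
      using \<open>set (letters w) \<subseteq> carrier L\<close> by (auto simp: free_algebra_carrier)
    then show ?case
      using add assms(3)
      by (simp add: distrib_left free_act_add_left free_act_add_right free_act_closed free_algebra_closed)
  qed
next
  case (add a b)
  then show ?case
    using assms(2,3) by (simp add: distrib_right free_act_add_left free_act_closed free_algebra_closed)
qed

lemma free_act_gen:
  assumes "x \<in> carrier L" "v \<in> carrier V"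
  shows "free_act V (gen x) v = act V x v"
  using assms smult_one[OF act_closed[OF assms]] by (simp add: free_act_single word_act_def)

lemma free_act_scalar: "v \<in> carrier V \<Longrightarrow> free_act V (scalar c) v = c \<odot>\<^bsub>V\<^esub> v"
  by (simp add: free_act_single word_act_def zero_word_def)

lemma free_act_zero: "free_act V 0 v = \<zero>\<^bsub>V\<^esub>"
  by (simp add: free_act_def)

lemma free_act_minus:
  assumes "t \<in> carrier (free_algebra (carrier L))" "v \<in> carrier V"
  shows "free_act V (- t) v = \<ominus>\<^bsub>V\<^esub> free_act V t v"
proof -
  have "free_act V (- t) v \<oplus>\<^bsub>V\<^esub> free_act V t v = free_act V (- t + t) v"
    using assms free_algebra_closed(3)[OF assms(1)] by (intro free_act_add_left[symmetric])
  then show ?thesis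
    using assms free_algebra_closed(3)[OF assms(1)]
    by (intro M.minus_equality[symmetric]) (auto simp: free_act_zero free_act_closed)
qed

lemma free_act_diff:
  assumes "s \<in> carrier (free_algebra (carrier L))" "t \<in> carrier (free_algebra (carrier L))"
    "v \<in> carrier V"
  shows "free_act V (s - t) v = free_act V s v \<ominus>\<^bsub>V\<^esub> free_act V t v"
  using free_act_add_left[OF assms(1) free_algebra_closed(3)[OF assms(2)] assms(3)]
    free_act_minus[OF assms(2,3)] by (simp add: a_minus_def)

text \<open>
  The elements of the free algebra that act by zero on all of \<open>V\<close> form a two-sided ideal, and the
  module axioms say exactly that this ideal contains the relations.
\<close>

lemma free_act_uea_ideal:
  assumes "t \<in> uea_ideal L" "v \<in> carrier V"
  shows "free_act V t v = \<zero>\<^bsub>V\<^esub>"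
proof -
  let ?I = "{t \<in> carrier (free_algebra (carrier L)). \<forall>v\<in>carrier V. free_act V t v = \<zero>\<^bsub>V\<^esub>}"
  have null: "free_act V s \<zero>\<^bsub>V\<^esub> = \<zero>\<^bsub>V\<^esub>" if "s \<in> carrier (free_algebra (carrier L))" for s
    using free_act_smult_right[OF that M.zero_closed, of 0] free_act_closed[OF that M.zero_closed]
      smult_l_null by simp
  have "ideal ?I (free_algebra (carrier L))"
  proof (rule idealI[OF free_algebra_ring])
    interpret F: ring "free_algebra (carrier L)" by (rule free_algebra_ring)
    show "subgroup ?I (add_monoid (free_algebra (carrier L)))"
    proof (rule group.subgroupI[OF F.add.group_axioms])
      show "?I \<noteq> {}"
        using free_act_zero F.zero_closed by auto
      fix a assume a: "a \<in> ?I"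
      have "inv\<^bsub>add_monoid (free_algebra (carrier L))\<^esub> a = - a"
        using a free_algebra_minus[of a] by (simp add: a_inv_def)
      then show "inv\<^bsub>add_monoid (free_algebra (carrier L))\<^esub> a \<in> ?I"
        using a by (simp add: free_algebra_closed free_act_minus)
    qed (auto simp: free_algebra_closed free_act_add_left)
  qed (auto simp: free_act_mult free_algebra_closed null free_act_closed)
  moreover have "uea_relations L \<subseteq> ?I"
  proof -
    have r1: "free_act V (gen (x \<oplus>\<^bsub>L\<^esub> y) - gen x - gen y) v = \<zero>\<^bsub>V\<^esub>"
      if "x \<in> carrier L" "y \<in> carrier L" "v \<in> carrier V" for x y v
    proof -
      have r1: "free_act V (gen (x \<oplus>\<^bsub>L\<^esub> y) - (gen x + gen y)) v = \<zero>\<^bsub>V\<^esub>"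
        using that by (simp add: free_act_diff gen_carrier free_algebra_closed free_act_gen act_add_left
            free_act_add_left act_closed a_minus_def M.r_neg)
      then show ?thesis by (simp add: diff_diff_eq)
    qed
    have r2: "free_act V (gen (c \<odot>\<^bsub>L\<^esub> x) - scalar c * gen x) v = \<zero>\<^bsub>V\<^esub>"
      if "x \<in> carrier L" "v \<in> carrier V" for c x v
      using that by (simp add: free_act_diff gen_carrier scalar_carrier free_algebra_closed free_act_gen
          free_act_mult free_act_scalar act_smult_left act_closed a_minus_def M.r_neg)
    have r3: "free_act V (gen x * gen y - gen y * gen x - gen (lbracket L x y)) v = \<zero>\<^bsub>V\<^esub>"
      if "x \<in> carrier L" "y \<in> carrier L" "v \<in> carrier V" for x y v
      using that by (simp add: free_act_diff gen_carrier free_algebra_closed free_act_gen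
          free_act_mult act_lbracket lie.lbracket_closed act_closed a_minus_def M.r_neg)
    have "free_act V t v = \<zero>\<^bsub>V\<^esub>" if t: "t \<in> uea_relations L" and v: "v \<in> carrier V" for t v
    proof -
      consider x y where "t = gen (x \<oplus>\<^bsub>L\<^esub> y) - gen x - gen y" "x \<in> carrier L" "y \<in> carrier L"
        | c x where "t = gen (c \<odot>\<^bsub>L\<^esub> x) - scalar c * gen x" "x \<in> carrier L"
        | x y where "t = gen x * gen y - gen y * gen x - gen (lbracket L x y)"
            "x \<in> carrier L" "y \<in> carrier L"
        using t unfolding uea_relations_def by blast
      then show ?thesis
        using r1 r2 r3 v by cases (simp_all only:)
    qed
    then show ?thesis
      using lie.uea_relations_carrier by auto
  qed
  ultimately have "uea_ideal L \<subseteq> ?I"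
    by (rule lie.uea_ideal_minimal)
  then show ?thesis using assms by auto
qed

lemma uea_act_class:
  assumes "t \<in> carrier (free_algebra (carrier L))" "v \<in> carrier V"
  shows "uea_act V (uea_class L t) v = free_act V t v"
proof -
  define s where "s = (SOME s. s \<in> uea_class L t)"
  have "t \<in> uea_class L t"
    by (simp add: lie.mem_uea_class lie.uea_ideal_closed(1))
  then have "s \<in> uea_class L t"
    unfolding s_def by (rule someI)
  then have st: "s - t \<in> uea_ideal L"
    by (simp add: lie.mem_uea_class)
  have "free_act V ((s - t) + t) v = free_act V t v"
    using lie.uea_ideal_carrier[OF st] assms free_act_uea_ideal[OF st]
    by (subst free_act_add_left) (auto simp: free_act_closed)
  then show ?thesis by (simp add: uea_act_def s_def)
qed

end

section \<open>The enveloping algebra of the Virasoro algebra\<close>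

global_interpretation vir: lie_algebra virasoro by (rule lie_algebra_virasoro)

lemma free_algebra_UNIV [simp]: "t \<in> carrier (free_algebra UNIV)"
  by (simp add: free_algebra_carrier)

text \<open>
  The unit acts by the identity on the one-dimensional trivial module, so the enveloping algebra is
  not the zero ring; this is what makes it an instance of \<^class>\<open>ring_1\<close> below.
\<close>

lemma one_notin_uea_ideal: "1 \<notin> uea_ideal virasoro"
proof
  assume one: "1 \<in> uea_ideal virasoro"
  define V where "V = weight_rep 0 0"
  interpret B: lie_module vir_borel V
    unfolding V_def by (rule lie_module_weight_rep)
  have act: "act V x v = \<zero>\<^bsub>V\<^esub>" "v \<in> carrier V" for x v
    by (simp_all add: V_def weight_rep_def)
  interpret lie_module virasoro V
    by unfold_locales (auto simp: act B.M.r_neg a_minus_def)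
  have "free_act V 1 1 = (1::complex)"
    using free_act_scalar[OF act(2), of 1 1] by (simp add: V_def weight_rep_def)
  then show False
    using free_act_uea_ideal[OF one act(2), of 1] by (simp add: V_def weight_rep_def)
qed

text \<open>
  As a type, \<open>U(\<gg>)\<close> carries the ring classes, and a computation in it is a chain of equations
  instead of congruences modulo \<^const>\<open>uea_ideal\<close>.
\<close>

definition uea_eq :: "(vir word \<Rightarrow>\<^sub>0 complex) \<Rightarrow> (vir word \<Rightarrow>\<^sub>0 complex) \<Rightarrow> bool" where
  "uea_eq a b \<longleftrightarrow> a - b \<in> uea_ideal virasoro"

quotient_type vir_uea = "vir word \<Rightarrow>\<^sub>0 complex" / uea_eq
  morphisms rep_vir_uea uea_of
proof (rule equivpI)
  show "reflp uea_eq"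
    by (rule reflpI) (simp add: uea_eq_def vir.uea_ideal_closed)
  show "symp uea_eq"
    by (rule sympI) (metis uea_eq_def vir.uea_ideal_closed(3) minus_diff_eq)
  show "transp uea_eq"
    by (rule transpI) (metis (no_types, lifting) uea_eq_def vir.uea_ideal_closed(2) diff_add_cancel add_diff_eq)
qed

instantiation vir_uea :: ring_1
begin

lift_definition zero_vir_uea :: vir_uea is 0 .
lift_definition one_vir_uea :: vir_uea is 1 .
lift_definition plus_vir_uea :: "vir_uea \<Rightarrow> vir_uea \<Rightarrow> vir_uea" is "(+)"
  unfolding uea_eq_def by (metis add_diff_add vir.uea_ideal_closed(2))
lift_definition uminus_vir_uea :: "vir_uea \<Rightarrow> vir_uea" is uminus
  unfolding uea_eq_def by (metis minus_diff_minus vir.uea_ideal_closed(3))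
lift_definition minus_vir_uea :: "vir_uea \<Rightarrow> vir_uea \<Rightarrow> vir_uea" is "(-)"
  unfolding uea_eq_def
proof -
  fix a a' b b' :: "vir word \<Rightarrow>\<^sub>0 complex"
  assume "a - a' \<in> uea_ideal virasoro" "b - b' \<in> uea_ideal virasoro"
  then have "(a - a') - (b - b') \<in> uea_ideal virasoro"
    by (rule vir.uea_ideal_closed(4))
  then show "a - b - (a' - b') \<in> uea_ideal virasoro"
    by (simp add: algebra_simps)
qed
lift_definition times_vir_uea :: "vir_uea \<Rightarrow> vir_uea \<Rightarrow> vir_uea" is "(*)"
  unfolding uea_eq_def
proof -
  fix a a' b b'
  assume "a - a' \<in> uea_ideal virasoro" "b - b' \<in> uea_ideal virasoro"
  then have "(a - a') * b + a' * (b - b') \<in> uea_ideal virasoro"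
    using vir.uea_ideal_closed(2,5,6) by simp
  then show "a * b - a' * b' \<in> uea_ideal virasoro"
    by (simp add: algebra_simps)
qed

instance
proof
  have refl: "uea_eq a a" for a
    by (simp add: uea_eq_def vir.uea_ideal_closed)
  fix a b c :: vir_uea
  show "a + b + c = a + (b + c)" "a + b = b + a" "0 + a = a" "- a + a = 0" "a - b = a + - b"
    "a * b * c = a * (b * c)" "1 * a = a" "a * 1 = a" "(a + b) * c = a * c + b * c"
    "a * (b + c) = a * b + a * c"
    by (transfer; simp add: refl algebra_simps)+
  show "(0::vir_uea) \<noteq> 1"
    using one_notin_uea_ideal vir.uea_ideal_closed(3)[of "- 1"] by transfer (auto simp: uea_eq_def)
qed

end

definition uscal :: "complex \<Rightarrow> vir_uea" where "uscal c = uea_of (scalar c)"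
definition ugen :: "vir \<Rightarrow> vir_uea" where "ugen x = uea_of (gen x)"

lemmas uea_of_simps = zero_vir_uea.abs_eq one_vir_uea.abs_eq plus_vir_uea.abs_eq
  minus_vir_uea.abs_eq uminus_vir_uea.abs_eq times_vir_uea.abs_eq

lemma uea_of_eq_iff: "uea_of a = uea_of b \<longleftrightarrow> a - b \<in> uea_ideal virasoro"
  by (simp add: vir_uea.abs_eq_iff uea_eq_def)

lemma uscal_simps [simp]: "uscal 0 = 0" "uscal 1 = 1"
  and uscal_add: "uscal (c + d) = uscal c + uscal d"
  and uscal_mult: "uscal (c * d) = uscal c * uscal d"
  and uscal_minus: "uscal (- c) = - uscal c"
  and uscal_diff: "uscal (c - d) = uscal c - uscal d"
  by (simp_all add: uscal_def uea_of_simps single_add mult_single single_uminus single_diff)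

lemma uscal_sum: "uscal (sum f A) = (\<Sum>a\<in>A. uscal (f a))"
  by (induction A rule: infinite_finite_induct) (simp_all add: uscal_add)

lemma uscal_of_int: "uscal (of_int n) = of_int n"
proof -
  have nat: "uscal (of_nat n) = of_nat n" for n
    by (induction n) (simp_all add: uscal_add)
  show ?thesis
    by (cases n) (simp_all add: nat uscal_minus uscal_diff uscal_add)
qed

lemma ugen_add: "ugen (x + y) = ugen x + ugen y"
  and ugen_smult: "ugen (vir_smult c x) = uscal c * ugen x"
  and ugen_bracket: "ugen (vir_bracket x y) = ugen x * ugen y - ugen y * ugen x"
proof -
  have "gen (x + y) - gen x - gen y \<in> uea_relations virasoro"
    "gen (vir_smult c x) - scalar c * gen x \<in> uea_relations virasoro"
    "gen x * gen y - gen y * gen x - gen (vir_bracket x y) \<in> uea_relations virasoro"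
    unfolding uea_relations_def by fastforce+
  then have "gen (x + y) - gen x - gen y \<in> uea_ideal virasoro"
    "gen (vir_smult c x) - scalar c * gen x \<in> uea_ideal virasoro"
    "gen x * gen y - gen y * gen x - gen (vir_bracket x y) \<in> uea_ideal virasoro"
    using vir.uea_relations_in_ideal by blast+
  then have "uea_of (gen (x + y)) = uea_of (gen x + gen y)"
    "uea_of (gen (vir_smult c x)) = uea_of (scalar c * gen x)"
    "uea_of (gen x * gen y - gen y * gen x) = uea_of (gen (vir_bracket x y))"
    by (simp_all add: uea_of_eq_iff diff_diff_eq)
  then show "ugen (x + y) = ugen x + ugen y" "ugen (vir_smult c x) = uscal c * ugen x"
    "ugen (vir_bracket x y) = ugen x * ugen y - ugen y * ugen x"
    by (simp_all add: ugen_def uscal_def plus_vir_uea.abs_eq times_vir_uea.abs_eq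
        minus_vir_uea.abs_eq)
qed

lemma ugen_zero [simp]: "ugen 0 = 0"
  using ugen_smult[of 0 0] by simp

lemma uscal_central: "u * uscal c = uscal c * u"
proof -
  obtain t where u: "u = uea_of t"
    using vir_uea.abs_induct[of "\<lambda>u. \<exists>t. u = uea_of t" u] by blast
  have "t * scalar c = scalar c * t"
    using free_algebra_UNIV[of t]
    by (induction t rule: free_algebra_induct) (simp_all add: mult_single algebra_simps)
  then show ?thesis
    by (simp add: u uscal_def uea_of_simps)
qed

lemma uscal_left_commute: "u * (uscal c * v) = uscal c * (u * v)"
  by (metis mult.assoc uscal_central)

text \<open>
  \<open>U(\<gg>)\<close> is spanned by products of basis elements, and such a product is built up from the right by
  left multiplications. This is the form of induction needed for left ideals.
\<close>

lemma vir_uea_induct [case_names one add smult mult]: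
  assumes one: "P 1" and add: "\<And>u v. P u \<Longrightarrow> P v \<Longrightarrow> P (u + v)"
    and smult: "\<And>c u. P u \<Longrightarrow> P (uscal c * u)"
    and mult: "\<And>a u. P u \<Longrightarrow> P (ugen (Poly_Mapping.single a 1) * u)"
  shows "P u"
proof -
  have zero: "P 0" using smult[OF one, of 0] by simp
  have gen: "P (ugen x * v)" if "P v" for x v
    by (induction x rule: vir_induct)
      (use zero that in \<open>auto simp: ugen_add ugen_smult distrib_right mult.assoc intro: add smult mult\<close>)
  have "P (uea_of t)" for t
    using free_algebra_UNIV[of t]
  proof (induction t rule: free_algebra_induct)
    case (single w c)
    have "P (uea_of (Poly_Mapping.single (Word xs) c))" for xs
    proof (induction xs)
      case Nil
      have "uea_of (Poly_Mapping.single (Word []) c) = uscal c * 1"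
        by (simp add: uscal_def zero_word_def)
      then show ?case using smult[OF one] by simp
    next
      case (Cons x xs)
      have "uea_of (Poly_Mapping.single (Word (x # xs)) c) = ugen x * uea_of (Poly_Mapping.single (Word xs) c)"
        by (simp add: ugen_def times_vir_uea.abs_eq mult_single plus_word_def)
      then show ?case using gen[OF Cons] by simp
    qed
    then show ?case by (cases w) simp
  next
    case (add a b)
    then show ?case using assms(2) by (simp add: plus_vir_uea.abs_eq[symmetric])
  qed
  then show ?thesis by (metis vir_uea.abs_induct)
qed

abbreviation ud :: "int \<Rightarrow> vir_uea" where "ud k \<equiv> ugen (vir_d k)"
abbreviation uz :: vir_uea where "uz \<equiv> ugen vir_z"

lemma ud_commute:
  "ud k * ud j = ud j * ud k + of_int (k - j) * ud (k + j) +
     (if j = - k then uscal (of_int (k ^ 3 - k) / 12) * uz else 0)"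
proof -
  have "ud k * ud j - ud j * ud k = ugen (vir_basis_bracket (Dk k) (Dk j))"
    by (simp flip: ugen_bracket)
  also have "\<dots> = of_int (k - j) * ud (k + j) +
     (if j = - k then uscal (of_int (k ^ 3 - k) / 12) * uz else 0)"
    by (simp add: ugen_add ugen_smult del: of_int_diff flip: uscal_of_int)
  finally show ?thesis by (simp add: algebra_simps)
qed

lemma uz_central: "uz * u = u * uz"
proof (induction u rule: vir_uea_induct)
  case (mult a u)
  have "vir_bracket vir_z (Poly_Mapping.single a 1) = 0"
    by simp
  then have "uz * ugen (Poly_Mapping.single a 1) = ugen (Poly_Mapping.single a 1) * uz"
    using ugen_bracket[of vir_z "Poly_Mapping.single a 1"] by (simp del: vir_bracket_basis)
  then show ?case using mult by (metis mult.assoc)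
qed (simp_all add: distrib_left distrib_right uscal_left_commute mult.assoc)

section \<open>Cyclic modules and left ideals\<close>

definition left_ideal :: "vir_uea set \<Rightarrow> bool" where
  "left_ideal I \<longleftrightarrow> 0 \<in> I \<and> (\<forall>a\<in>I. \<forall>b\<in>I. a + b \<in> I) \<and> (\<forall>u. \<forall>a\<in>I. u * a \<in> I)"

lemma left_idealD:
  assumes "left_ideal I"
  shows left_ideal_zero: "0 \<in> I" and left_ideal_add: "a \<in> I \<Longrightarrow> b \<in> I \<Longrightarrow> a + b \<in> I"
    and left_ideal_mult: "a \<in> I \<Longrightarrow> u * a \<in> I" and left_ideal_minus: "a \<in> I \<Longrightarrow> - a \<in> I"
    and left_ideal_diff: "a \<in> I \<Longrightarrow> b \<in> I \<Longrightarrow> a - b \<in> I"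
proof -
  show 1: "0 \<in> I" "a \<in> I \<Longrightarrow> b \<in> I \<Longrightarrow> a + b \<in> I" "a \<in> I \<Longrightarrow> u * a \<in> I" for a b u
    using assms by (auto simp: left_ideal_def)
  show 2: "a \<in> I \<Longrightarrow> - a \<in> I" for a
    using 1(3)[of a "- 1"] by simp
  show "a \<in> I \<Longrightarrow> b \<in> I \<Longrightarrow> a - b \<in> I"
    using 1(2)[of a "- b"] 2 by simp
qed

lemma left_ideal_diff_iff: "left_ideal I \<Longrightarrow> a - b \<in> I \<Longrightarrow> a \<in> I \<longleftrightarrow> b \<in> I"
  using left_ideal_add[of I "a - b" b] left_ideal_diff[of I a "a - b"] by auto

lemma left_ideal_sum: "left_ideal I \<Longrightarrow> (\<And>x. x \<in> A \<Longrightarrow> f x \<in> I) \<Longrightarrow> sum f A \<in> I"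
  by (induction A rule: infinite_finite_induct) (auto simp: left_idealD)

text \<open>
  Since \<open>\<gg>\<close> and the scalars generate \<open>U(\<gg>)\<close>, only their action has to be checked.
\<close>

lemma left_idealI:
  assumes zero: "0 \<in> I" and add: "\<And>a b. a \<in> I \<Longrightarrow> b \<in> I \<Longrightarrow> a + b \<in> I"
    and smult: "\<And>c a. a \<in> I \<Longrightarrow> uscal c * a \<in> I"
    and act: "\<And>x a. a \<in> I \<Longrightarrow> ugen x * a \<in> I"
  shows "left_ideal I"
proof -
  have "\<forall>a\<in>I. u * a \<in> I" for u
    by (induction u rule: vir_uea_induct) (auto simp: add smult act mult.assoc distrib_right)
  then show ?thesis using zero add by (simp add: left_ideal_def)
qed

lemma left_ideal_eq_UNIV: "left_ideal I \<Longrightarrow> 1 \<in> I \<Longrightarrow> I = UNIV"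
  using left_ideal_mult[of I 1] by auto

definition maximal_left_ideal :: "vir_uea set \<Rightarrow> bool" where
  "maximal_left_ideal I \<longleftrightarrow> left_ideal I \<and> 1 \<notin> I \<and>
     (\<forall>J. left_ideal J \<and> I \<subseteq> J \<longrightarrow> J = I \<or> 1 \<in> J)"

lemma left_ideal_principal: "left_ideal (range (\<lambda>u. u * x))"
  unfolding left_ideal_def
proof (intro conjI ballI allI)
  show "0 \<in> range (\<lambda>u. u * x)"
    by (rule range_eqI[of _ _ 0]) simp
  show "a + b \<in> range (\<lambda>u. u * x)" if "a \<in> range (\<lambda>u. u * x)" "b \<in> range (\<lambda>u. u * x)" for a b
    using that by (auto simp flip: distrib_right)
  show "v * a \<in> range (\<lambda>u. u * x)" if "a \<in> range (\<lambda>u. u * x)" for v a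
    using that by (auto simp flip: mult.assoc)
qed

text \<open>
  The left ideal \<open>I + J\<close> is larger than \<open>I\<close>.
\<close>

lemma maximal_left_ideal_coprime:
  assumes max: "maximal_left_ideal I" and J: "left_ideal J" "\<not> J \<subseteq> I"
  obtains a b where "a \<in> I" "b \<in> J" "a + b = 1"
proof -
  have I: "left_ideal I"
    using max by (simp add: maximal_left_ideal_def)
  let ?S = "{a + b | a b. a \<in> I \<and> b \<in> J}"
  have "left_ideal ?S"
    unfolding left_ideal_def
  proof (intro conjI ballI allI)
    show "0 \<in> ?S"
      using left_ideal_zero[OF I] left_ideal_zero[OF J(1)] by force
    show "x + y \<in> ?S" if x: "x \<in> ?S" and y: "y \<in> ?S" for x y
    proof -
      obtain a b a' b' where ab: "x = a + b" "y = a' + b'" "a \<in> I" "b \<in> J" "a' \<in> I" "b' \<in> J"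
        using x y by blast
      have "x + y = (a + a') + (b + b')" by (simp add: ab(1,2))
      then show ?thesis
        using left_ideal_add[OF I ab(3,5)] left_ideal_add[OF J(1) ab(4,6)] by blast
    qed
    show "w * x \<in> ?S" if x: "x \<in> ?S" for x w
    proof -
      obtain a b where ab: "x = a + b" "a \<in> I" "b \<in> J" using x by blast
      have "w * x = w * a + w * b" by (simp add: ab(1) distrib_left)
      then show ?thesis
        using left_ideal_mult[OF I ab(2)] left_ideal_mult[OF J(1) ab(3)] by blast
    qed
  qed
  moreover have "I \<subseteq> ?S"
  proof
    fix a assume "a \<in> I"
    moreover have "a = a + 0" by simp
    ultimately show "a \<in> ?S"
      using left_ideal_zero[OF J(1)] by blast
  qed
  moreover have "J \<subseteq> ?S"
  proof
    fix b assume "b \<in> J"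
    moreover have "b = 0 + b" by simp
    ultimately show "b \<in> ?S"
      using left_ideal_zero[OF I] by blast
  qed
  ultimately have "1 \<in> ?S"
    using max J(2) unfolding maximal_left_ideal_def by blast
  then show ?thesis
    using that by auto
qed

text \<open>
  A surjective \<open>U(\<gg>)\<close>-linear map from \<open>U(\<gg>)\<close> to \<open>V\<close>. The record \<open>V\<close> inherits the axioms of a Lie module
  from \<open>U(\<gg>)\<close>, so that exhibiting such a map, as for the Verma module and for quotients, proves at once
  that the record is a module.
\<close>

locale cyclic_presentation =
  fixes V :: "(vir, 'v) rep" and f :: "vir_uea \<Rightarrow> 'v"
  assumes range: "range f = carrier V" and zero: "f 0 = \<zero>\<^bsub>V\<^esub>"
    and add: "f (a + b) = f a \<oplus>\<^bsub>V\<^esub> f b"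
    and smult: "f (uscal c * a) = c \<odot>\<^bsub>V\<^esub> f a"
    and act: "f (ugen x * a) = act V x (f a)"
begin

lemma closed: "f a \<in> carrier V"
  using range by auto

lemma obtain_preimage:
  assumes "v \<in> carrier V" obtains a where "v = f a"
  using assms range by (metis imageE)

lemma abelian_group: "abelian_group V"
proof (rule abelian_groupI)
  fix u assume "u \<in> carrier V"
  then obtain a where "u = f a" by (rule obtain_preimage)
  then show "\<exists>v\<in>carrier V. v \<oplus>\<^bsub>V\<^esub> u = \<zero>\<^bsub>V\<^esub>"
    by (intro bexI[of _ "f (- a)"]) (simp_all add: closed flip: add zero)
qed (auto elim!: obtain_preimage simp: closed add_ac simp flip: add zero)

lemma uminus: "f (- a) = \<ominus>\<^bsub>V\<^esub> f a"
proof -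
  interpret abelian_group V by (rule abelian_group)
  have "f (- a) \<oplus>\<^bsub>V\<^esub> f a = \<zero>\<^bsub>V\<^esub>" by (simp flip: add zero)
  then show ?thesis by (intro minus_equality[symmetric]) (auto simp: closed)
qed

lemma diff: "f (a - b) = f a \<ominus>\<^bsub>V\<^esub> f b"
  using add[of a "- b"] uminus[of b] by (simp add: a_minus_def)

lemma module: "module complex_ring V"
  by (rule moduleI)
    (auto elim!: obtain_preimage simp: abelian_group cring_from_type_algebra closed uscal_add uscal_mult
      mult.assoc distrib_right distrib_left simp flip: add smult)

lemma lie_module: "lie_module virasoro V"
proof -
  have diff': "act V x u \<ominus>\<^bsub>V\<^esub> act V y v = f (ugen x * a - ugen y * b)"
    if "u = f a" "v = f b" for x y u v a b
    using that by (simp add: diff act)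
  show ?thesis
    by (intro lie_module.intro lie_module_axioms.intro module lie_algebra_virasoro)
      (auto elim!: obtain_preimage simp: closed ugen_add ugen_smult ugen_bracket
        mult.assoc distrib_right distrib_left uscal_left_commute left_diff_distrib diff
        simp flip: add smult act)
qed

lemma eq_iff: "f a = f b \<longleftrightarrow> f (a - b) = \<zero>\<^bsub>V\<^esub>"
proof
  assume "f a = f b"
  then have "f (a + - b) = f (b + - b)"
    unfolding add by simp
  then show "f (a - b) = \<zero>\<^bsub>V\<^esub>"
    by (simp add: zero)
next
  assume "f (a - b) = \<zero>\<^bsub>V\<^esub>"
  then have "f (a - b + b) = f (0 + b)"
    unfolding add by (simp add: zero)
  then show "f a = f b" by simp
qed

definition kernel :: "vir_uea set" where "kernel = {a. f a = \<zero>\<^bsub>V\<^esub>}"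

lemma left_ideal_kernel: "left_ideal kernel"
proof -
  interpret lie_module virasoro V by (rule lie_module)
  have "ugen x * 0 = 0" for x by simp
  then have "act V x \<zero>\<^bsub>V\<^esub> = \<zero>\<^bsub>V\<^esub>" for x
    by (metis act zero)
  then show ?thesis
    by (intro left_idealI) (auto simp: kernel_def zero add smult act)
qed

lemma left_ideal_vimage:
  assumes "lie_submodule virasoro V N"
  shows "left_ideal (f -` N)" and "kernel \<subseteq> f -` N"
proof -
  interpret lie_module virasoro V by (rule lie_module)
  have sub: "submodule N complex_ring V"
    using assms by (simp add: lie_submodule_def)
  then have zN: "\<zero>\<^bsub>V\<^esub> \<in> N"
    using subgroup.one_closed[OF submodule.axioms(1)[OF sub]] by simp
  then show "kernel \<subseteq> f -` N"
    by (auto simp: kernel_def)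
  show "left_ideal (f -` N)"
    using assms submoduleE(4,5)[OF sub] zN
    by (intro left_idealI) (auto simp: zero add smult act lie_submodule_def)
qed

lemma lie_submodule_image:
  assumes "left_ideal I"
  shows "lie_submodule virasoro V (f ` I)"
proof -
  interpret lie_module virasoro V by (rule lie_module)
  have "submodule (f ` I) complex_ring V"
    by (rule submoduleI)
      (use assms in \<open>auto simp: closed left_idealD zero[symmetric] simp flip: add smult uminus\<close>)
  then show ?thesis
    using assms by (auto simp: lie_submodule_def left_idealD simp flip: act)
qed

lemma vimage_image:
  assumes "left_ideal I" "kernel \<subseteq> I"
  shows "f -` f ` I = I"
proof
  show "f -` f ` I \<subseteq> I"
  proof
    fix a assume "a \<in> f -` f ` I"
    then obtain b where b: "b \<in> I" "f a = f b" by auto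
    then have "a - b \<in> I"
      using assms(2) eq_iff[of a b] by (auto simp: kernel_def)
    then show "a \<in> I"
      using left_ideal_diff_iff[OF assms(1)] b by blast
  qed
qed auto

lemma image_vimage: "N \<subseteq> carrier V \<Longrightarrow> f ` (f -` N) = N"
  using range by auto

lemma lie_submodule_subset: "lie_submodule virasoro V N \<Longrightarrow> N \<subseteq> carrier V"
  unfolding lie_submodule_def
  using subgroup.subset[OF submodule.axioms(1)] by force

text \<open>
  Submodules of \<open>V\<close> correspond, by taking preimages, to the left ideals above the kernel.
\<close>

lemma simple_iff: "simple_lie_module virasoro V \<longleftrightarrow> maximal_left_ideal kernel"
proof
  assume V: "simple_lie_module virasoro V"
  have "1 \<notin> kernel"
  proof
    assume "1 \<in> kernel"
    then have "kernel = UNIV"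
      by (rule left_ideal_eq_UNIV[OF left_ideal_kernel])
    then have "f a = \<zero>\<^bsub>V\<^esub>" for a
      by (auto simp: kernel_def)
    then have "range f = {\<zero>\<^bsub>V\<^esub>}" by auto
    then show False
      using V range by (simp add: simple_lie_module_def)
  qed
  moreover have "J = kernel \<or> 1 \<in> J" if J: "left_ideal J" "kernel \<subseteq> J" for J
  proof -
    have "f ` J = {\<zero>\<^bsub>V\<^esub>} \<or> f ` J = carrier V"
      using V lie_submodule_image[OF J(1)] by (simp add: simple_lie_module_def)
    then have "f -` f ` J = kernel \<or> f -` f ` J = UNIV"
      using closed by (elim disjE) (simp_all add: kernel_def vimage_def)
    then show ?thesis
      using vimage_image[OF J] by auto
  qed
  ultimately show "maximal_left_ideal kernel"
    using left_ideal_kernel by (auto simp: maximal_left_ideal_def)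
next
  assume max: "maximal_left_ideal kernel"
  have "carrier V \<noteq> {\<zero>\<^bsub>V\<^esub>}"
    using max closed[of 1] by (auto simp: maximal_left_ideal_def kernel_def)
  moreover have "N = {\<zero>\<^bsub>V\<^esub>} \<or> N = carrier V" if N: "lie_submodule virasoro V N" for N
  proof -
    have "f -` N = kernel \<or> f -` N = UNIV"
      using max left_ideal_vimage[OF N] left_ideal_eq_UNIV unfolding maximal_left_ideal_def by blast
    moreover have "f ` kernel = {\<zero>\<^bsub>V\<^esub>}"
      using zero by (auto simp: kernel_def)
    ultimately show ?thesis
      using image_vimage[OF lie_submodule_subset[OF N]] range by metis
  qed
  ultimately show "simple_lie_module virasoro V"
    using lie_module by (simp add: simple_lie_module_def)
qed

text \<open>
  A presentation of \<open>V\<close> followed by the projection to \<open>V / N\<close> presents \<open>V / N\<close>. The actions on cosets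
  are unions over all representatives, and they collapse to a single coset because the preimage of
  \<open>N\<close> is a left ideal.
\<close>

lemma quotient_presentation:
  assumes N: "lie_submodule virasoro V N"
  shows "cyclic_presentation (quotient_rep V N) (\<lambda>a. N +>\<^bsub>V\<^esub> f a)"
    and "cyclic_presentation.kernel (quotient_rep V N) (\<lambda>a. N +>\<^bsub>V\<^esub> f a) = f -` N"
proof -
  interpret lie_module virasoro V by (rule lie_module)
  note I = left_ideal_vimage(1)[OF N]
  have coset: "N +>\<^bsub>V\<^esub> f a = f ` {b. f (b - a) \<in> N}" for a
  proof -
    show ?thesis
      unfolding a_r_coset_def'
    proof (intro equalityI subsetI)
      fix v assume "v \<in> (\<Union>h\<in>N. {h \<oplus>\<^bsub>V\<^esub> f a})"
      then obtain n where n: "n \<in> N" "v = n \<oplus>\<^bsub>V\<^esub> f a" by auto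
      then obtain c where c: "n = f c"
        using lie_submodule_subset[OF N] obtain_preimage by blast
      then have "v = f (c + a)" "f (c + a - a) \<in> N"
        using n by (simp_all add: add)
      then show "v \<in> f ` {b. f (b - a) \<in> N}" by blast
    next
      fix v assume "v \<in> f ` {b. f (b - a) \<in> N}"
      then obtain b where b: "v = f (b - a + a)" "f (b - a) \<in> N" by auto
      then show "v \<in> (\<Union>h\<in>N. {h \<oplus>\<^bsub>V\<^esub> f a})"
        unfolding add by blast
    qed
  qed
  have coset_eq: "N +>\<^bsub>V\<^esub> f a = N +>\<^bsub>V\<^esub> f b \<longleftrightarrow> f (a - b) \<in> N" for a b
  proof
    assume eq: "N +>\<^bsub>V\<^esub> f a = N +>\<^bsub>V\<^esub> f b"
    have "f a \<in> N +>\<^bsub>V\<^esub> f a"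
      unfolding coset using left_ideal_zero[OF I] by auto
    then obtain c where "f a = f c" "f (c - b) \<in> N"
      unfolding eq unfolding coset by auto
    then show "f (a - b) \<in> N" by (simp add: diff)
  next
    assume ab: "f (a - b) \<in> N"
    have "f (c - a) \<in> N \<longleftrightarrow> f (c - b) \<in> N" for c
      using left_ideal_diff_iff[OF I, of "c - b" "c - a"] ab by simp
    then show "N +>\<^bsub>V\<^esub> f a = N +>\<^bsub>V\<^esub> f b"
      by (simp add: coset)
  qed
  have lift: "(\<Union>v\<in>N +>\<^bsub>V\<^esub> f a. N +>\<^bsub>V\<^esub> g v) = N +>\<^bsub>V\<^esub> f (u * a)"
    if "\<And>b. g (f b) = f (u * b)" for g u a
  proof -
    let ?B = "{b. f (b - a) \<in> N}"
    have same: "N +>\<^bsub>V\<^esub> f (u * b) = N +>\<^bsub>V\<^esub> f (u * a)" if "f (b - a) \<in> N" for b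
      using left_ideal_mult[OF I, of "b - a" u] that
      by (simp add: coset_eq right_diff_distrib)
    have "a \<in> ?B"
      using left_ideal_zero[OF I] by simp
    have "(\<Union>v\<in>N +>\<^bsub>V\<^esub> f a. N +>\<^bsub>V\<^esub> g v) = (\<Union>b\<in>?B. N +>\<^bsub>V\<^esub> f (u * b))"
      unfolding coset[of a] by (simp add: that)
    also have "\<dots> = (\<Union>b\<in>?B. N +>\<^bsub>V\<^esub> f (u * a))"
      by (intro SUP_cong refl same) simp
    also have "\<dots> = N +>\<^bsub>V\<^esub> f (u * a)"
      using \<open>a \<in> ?B\<close> by blast
    finally show ?thesis .
  qed
  have zeroN: "N +>\<^bsub>V\<^esub> f 0 = N"
    unfolding coset using image_vimage[OF lie_submodule_subset[OF N]] by (simp add: vimage_def)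
  interpret Q: cyclic_presentation "quotient_rep V N" "\<lambda>a. N +>\<^bsub>V\<^esub> f a"
  proof
    show "(range (\<lambda>a. N +>\<^bsub>V\<^esub> f a)) = carrier (quotient_rep V N)"
      unfolding quotient_rep_def A_RCOSETS_def' by (auto simp flip: range)
    show "N +>\<^bsub>V\<^esub> f 0 = \<zero>\<^bsub>quotient_rep V N\<^esub>"
      by (simp add: zeroN quotient_rep_def)
    fix a b c x
    show "N +>\<^bsub>V\<^esub> f (a + b) = (N +>\<^bsub>V\<^esub> f a) \<oplus>\<^bsub>quotient_rep V N\<^esub> (N +>\<^bsub>V\<^esub> f b)"
    proof -
      have "(N +>\<^bsub>V\<^esub> f a) <+>\<^bsub>V\<^esub> (N +>\<^bsub>V\<^esub> f b) = N +>\<^bsub>V\<^esub> f (a + b)"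
        unfolding set_add_def' coset
      proof (intro equalityI subsetI)
        fix v assume "v \<in> (\<Union>h\<in>f ` {c. f (c - a) \<in> N}. \<Union>k\<in>f ` {c. f (c - b) \<in> N}. {h \<oplus>\<^bsub>V\<^esub> k})"
        then obtain c d where cd: "f (c - a) \<in> N" "f (d - b) \<in> N" "v = f (c + d)"
          unfolding add by blast
        then have "f (c + d - (a + b)) \<in> N"
          using left_ideal_add[OF I, of "c - a" "d - b"] by (simp add: add_diff_add)
        then show "v \<in> f ` {c. f (c - (a + b)) \<in> N}"
          using cd(3) by blast
      next
        fix v assume "v \<in> f ` {c. f (c - (a + b)) \<in> N}"
        then obtain c where c: "f (c - b - a) \<in> N" "v = f c"
          by (auto simp: diff_diff_eq2 diff_diff_eq add.commute)
        then have "v = f (c - b) \<oplus>\<^bsub>V\<^esub> f b" "f (b - b) \<in> N"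
          using left_ideal_zero[OF I] add[of "c - b" b] by simp_all
        then show "v \<in> (\<Union>h\<in>f ` {c. f (c - a) \<in> N}. \<Union>k\<in>f ` {c. f (c - b) \<in> N}. {h \<oplus>\<^bsub>V\<^esub> k})"
          using c(1) by blast
      qed
      then show ?thesis by (simp add: quotient_rep_def)
    qed
    show "N +>\<^bsub>V\<^esub> f (uscal c * a) = c \<odot>\<^bsub>quotient_rep V N\<^esub> (N +>\<^bsub>V\<^esub> f a)"
      using lift[of "\<lambda>v. c \<odot>\<^bsub>V\<^esub> v" "uscal c" a] by (simp add: quotient_rep_def smult)
    show "N +>\<^bsub>V\<^esub> f (ugen x * a) = rep.act (quotient_rep V N) x (N +>\<^bsub>V\<^esub> f a)"
      using lift[of "\<lambda>v. rep.act V x v" "ugen x" a] by (simp add: quotient_rep_def act)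
  qed
  show "cyclic_presentation (quotient_rep V N) (\<lambda>a. N +>\<^bsub>V\<^esub> f a)"
    by (rule Q.cyclic_presentation_axioms)
  show "Q.kernel = f -` N"
    using coset_eq[of _ 0] zeroN
    unfolding Q.kernel_def by (auto simp: quotient_rep_def)
qed

end

text \<open>
  Both modules are \<open>U(\<gg>)\<close> modulo the kernel.
\<close>

lemma cyclic_presentation_isomorphic:
  assumes "cyclic_presentation V f" "cyclic_presentation W g"
    and ker: "cyclic_presentation.kernel V f = cyclic_presentation.kernel W g"
  shows "lie_module_isomorphic virasoro V W"
proof -
  interpret V: cyclic_presentation V f by fact
  interpret W: cyclic_presentation W g by fact
  have eq: "f a = f b \<longleftrightarrow> g a = g b" for a b
    using ker V.eq_iff W.eq_iff by (auto simp: V.kernel_def W.kernel_def)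
  define \<phi> where "\<phi> v = g (SOME a. f a = v)" for v
  have \<phi>: "\<phi> (f a) = g a" for a
    unfolding \<phi>_def by (subst eq[symmetric]) (rule someI, rule refl)
  have "bij_betw \<phi> (carrier V) (carrier W)"
    unfolding V.range[symmetric] W.range[symmetric]
    by (auto simp: bij_betw_def inj_on_def \<phi> eq image_image)
  moreover have "\<phi> \<in> hom (add_monoid V) (add_monoid W)"
    by (rule homI) (auto elim!: V.obtain_preimage simp: \<phi> W.closed simp flip: V.add W.add)
  ultimately have "\<phi> \<in> iso (add_monoid V) (add_monoid W)"
    by (simp add: iso_def)
  then show ?thesis
    unfolding lie_module_isomorphic_def
    by (intro exI[of _ \<phi>])
      (auto elim!: V.obtain_preimage simp: \<phi> simp flip: V.smult W.smult V.act W.act)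
qed

section \<open>The centre acts by scalars\<close>

text \<open>
  The value of a polynomial at an element of \<open>U(\<gg>)\<close>. It differs from \<^const>\<open>poly\<close> in that the argument
  lies in a noncommutative algebra over the ring of coefficients.
\<close>

definition uea_poly :: "vir_uea \<Rightarrow> complex poly \<Rightarrow> vir_uea" where
  "uea_poly x q = fold_coeffs (\<lambda>a u. uscal a + x * u) q 0"

lemma uea_poly_0 [simp]: "uea_poly x 0 = 0"
  by (simp add: uea_poly_def)

lemma uea_poly_pCons [simp]: "uea_poly x (pCons a q) = uscal a + x * uea_poly x q"
  by (cases "a = 0 \<and> q = 0") (auto simp: uea_poly_def)

lemma uea_poly_1 [simp]: "uea_poly x 1 = 1"
  by (simp add: one_pCons)

lemma uea_poly_add: "uea_poly x (p + q) = uea_poly x p + uea_poly x q"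
  by (induction p q rule: poly_induct2) (simp_all add: uscal_add distrib_left)

lemma uea_poly_smult: "uea_poly x (Polynomial.smult c q) = uscal c * uea_poly x q"
  by (induction q) (simp_all add: uscal_mult distrib_left uscal_left_commute)

lemma uea_poly_minus: "uea_poly x (- q) = - uea_poly x q"
  by (induction q) (simp_all add: uscal_minus)

lemma uea_poly_diff: "uea_poly x (p - q) = uea_poly x p - uea_poly x q"
  using uea_poly_add[of x p "- q"] by (simp add: uea_poly_minus)

lemma uea_poly_mult: "uea_poly x (p * q) = uea_poly x p * uea_poly x q"
  by (induction p) (simp_all add: uea_poly_add uea_poly_smult distrib_right mult.assoc)

lemma uea_poly_sum: "uea_poly x (sum f A) = (\<Sum>a\<in>A. uea_poly x (f a))"
  by (induction A rule: infinite_finite_induct) (simp_all add: uea_poly_add)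

text \<open>
  Used for \<open>d\<^sub>k d\<^sub>0 = (d\<^sub>0 + k) d\<^sub>k\<close>, where it says that moving \<open>d\<^sub>k\<close> across a polynomial in \<open>d\<^sub>0\<close>
  shifts the argument, and for \<open>x = x'\<close>, where it says that polynomials in \<open>x\<close> commute with what
  commutes with \<open>x\<close>.
\<close>

lemma uea_poly_intertwine:
  assumes "y * x = x' * y"
  shows "y * uea_poly x q = uea_poly x' q * y"
proof (induction q)
  case (pCons a q)
  have "y * (x * uea_poly x q) = x' * (y * uea_poly x q)"
    by (metis assms mult.assoc)
  then show ?case
    by (simp add: pCons distrib_left distrib_right uscal_central mult.assoc)
qed simp

lemma vector_space_vir_uea: "vector_space (\<lambda>c u. uscal c * u)"
  by unfold_locales (simp_all add: algebra_simps uscal_add uscal_mult)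

global_interpretation vir_uea: vector_space "\<lambda>c u. uscal c * u"
  by (rule vector_space_vir_uea)

instance vir_index :: countable
  by countable_datatype

definition basis_word :: "vir_index list \<Rightarrow> vir_uea" where
  "basis_word xs = foldr (\<lambda>a u. ugen (Poly_Mapping.single a 1) * u) xs 1"

lemma span_basis_words: "u \<in> vir_uea.span (range basis_word)"
proof (induction u rule: vir_uea_induct)
  case one
  have "1 = basis_word []" by (simp add: basis_word_def)
  then show ?case by (metis rangeI vir_uea.span_base)
next
  case (mult a u)
  show ?case using mult
  proof (induction u rule: vir_uea.span_induct_alt)
    case (step c v w)
    then obtain xs where "v = basis_word xs" by auto
    then have "ugen (Poly_Mapping.single a 1) * v = basis_word (a # xs)"
      by (simp add: basis_word_def)
    then have "ugen (Poly_Mapping.single a 1) * v \<in> vir_uea.span (range basis_word)"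
      by (metis rangeI vir_uea.span_base)
    with step show ?case
      by (simp add: distrib_left uscal_left_commute vir_uea.span_add vir_uea.span_scale)
  qed (simp add: vir_uea.span_zero)
qed (auto intro: vir_uea.span_add vir_uea.span_scale)

text \<open>
  A family of distinct elements indexed by \<open>\<complex>\<close> is dependent, since \<open>U(\<gg>)\<close> has countable dimension:
  there are only countably many finite sets of words, so one of them spans infinitely many members of
  the family.
\<close>

lemma linear_dependence_family:
  fixes a :: "complex \<Rightarrow> vir_uea"
  assumes "inj a"
  obtains \<Lambda> c where "finite \<Lambda>" "\<exists>\<nu>\<in>\<Lambda>. c \<nu> \<noteq> 0" "(\<Sum>\<nu>\<in>\<Lambda>. uscal (c \<nu>) * a \<nu>) = 0"
proof -
  have "\<exists>F. finite F \<and> F \<subseteq> range basis_word \<and> u \<in> vir_uea.span F" for u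
  proof -
    obtain F r where "finite F" "F \<subseteq> range basis_word" "u = (\<Sum>v\<in>F. uscal (r v) * v)"
      using span_basis_words[of u] unfolding vir_uea.span_explicit[of "range basis_word"] by auto
    then show ?thesis
      by (intro exI[of _ F]) (auto intro: vir_uea.span_sum vir_uea.span_scale vir_uea.span_base)
  qed
  then obtain F where F: "\<And>u. finite (F u)" "\<And>u. F u \<subseteq> range basis_word" "\<And>u. u \<in> vir_uea.span (F u)"
    by metis
  define C where "C = {S. finite S \<and> S \<subseteq> range basis_word}"
  have C: "countable C"
    unfolding C_def by (rule countable_Collect_finite_subset) simp
  have "\<exists>S\<in>C. infinite {\<nu>. F (a \<nu>) = S}"
  proof (rule ccontr)
    assume "\<not> ?thesis"
    then have "countable (\<Union>S\<in>C. {\<nu>. F (a \<nu>) = S})"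
      using C by (intro countable_UN) (auto intro: countable_finite)
    moreover have "(\<Union>S\<in>C. {\<nu>. F (a \<nu>) = S}) = UNIV"
      using F by (auto simp: C_def)
    ultimately show False using uncountable_UNIV_complex by simp
  qed
  then obtain S where S: "finite S" "infinite {\<nu>. F (a \<nu>) = S}"
    by (auto simp: C_def)
  obtain \<Lambda> where \<Lambda>: "finite \<Lambda>" "card \<Lambda> = Suc (card S)" "\<Lambda> \<subseteq> {\<nu>. F (a \<nu>) = S}"
    using infinite_arbitrarily_large[OF S(2)] by metis
  have inj: "inj_on a \<Lambda>"
    using assms by (rule inj_on_subset) simp
  have "a ` \<Lambda> \<subseteq> vir_uea.span S"
    using \<Lambda>(3) F(3) by auto
  moreover have "\<not> card (a ` \<Lambda>) \<le> card S"
    using \<Lambda>(2) inj by (simp add: card_image)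
  ultimately have "vir_uea.dependent (a ` \<Lambda>)"
    using vir_uea.independent_span_bound[OF S(1)] by blast
  then obtain c where c: "\<exists>v\<in>a ` \<Lambda>. c v \<noteq> 0" "(\<Sum>v\<in>a ` \<Lambda>. uscal (c v) * v) = 0"
    using vir_uea.dependent_finite[of "a ` \<Lambda>"] \<Lambda>(1) by auto
  then have "(\<Sum>\<nu>\<in>\<Lambda>. uscal (c (a \<nu>)) * a \<nu>) = 0"
    using sum.reindex[OF inj, of "\<lambda>v. uscal (c v) * v"] by simp
  then show ?thesis
    using that[of \<Lambda> "\<lambda>\<nu>. c (a \<nu>)"] \<Lambda>(1) c(1) by auto
qed

lemma uea_poly_uz_central: "uea_poly uz q * u = u * uea_poly uz q"
  using uea_poly_intertwine[of u uz uz q] uz_central[of u] by simp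

text \<open>
  Schur's lemma for a simple module of countable dimension, in Dixmier's form. If no \<open>z - \<xi>\<close> kills
  \<open>U(\<gg>) / I\<close>, then every \<open>z - \<xi>\<close> acts bijectively, because it is central and \<open>I\<close> is maximal. The
  elements \<open>a\<^sub>\<xi> = 1 / (z - \<xi>)\<close> are pairwise different, so some of them are linearly dependent; clearing
  denominators gives a nonzero polynomial in \<open>z\<close> that kills the module, and its linear factors cannot
  all be injective.
\<close>

lemma central_element_scalar:
  assumes max: "maximal_left_ideal I"
  shows "\<exists>\<xi>. uz - uscal \<xi> \<in> I"
proof (rule ccontr)
  assume "\<not> ?thesis"
  then have notin: "uz - uscal \<xi> \<notin> I" for \<xi> by auto
  have I: "left_ideal I" "1 \<notin> I"
    using max by (auto simp: maximal_left_ideal_def)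
  have maxD: "J = I \<or> 1 \<in> J" if "left_ideal J" "I \<subseteq> J" for J
    using max that by (auto simp: maximal_left_ideal_def)
  \<comment> \<open>The elements taken into \<open>I\<close> by \<open>z - \<xi>\<close> form a left ideal, since \<open>z\<close> is central.\<close>
  have cancel: "u \<in> I" if "(uz - uscal \<xi>) * u \<in> I" for \<xi> u
  proof -
    let ?J = "{u. (uz - uscal \<xi>) * u \<in> I}"
    have comm: "(uz - uscal \<xi>) * (v * u) = v * ((uz - uscal \<xi>) * u)" for u v
      by (metis (no_types, lifting) mult.assoc left_diff_distrib right_diff_distrib uz_central uscal_central)
    have "left_ideal ?J"
      unfolding left_ideal_def by (auto simp: left_idealD[OF I(1)] distrib_left comm)
    moreover have "I \<subseteq> ?J"
      by (auto intro: left_idealD[OF I(1)])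
    ultimately have "?J = I"
      using maxD[of ?J] notin[of \<xi>] by simp
    then show ?thesis using that by auto
  qed
  \<comment> \<open>Split off linear factors one at a time.\<close>
  have cancel_poly: "u \<in> I" if "uea_poly uz q * u \<in> I" "q \<noteq> 0" for q u
    using that
  proof (induction "Polynomial.degree q" arbitrary: q u)
    case 0
    then obtain c where "q = [:c:]" "c \<noteq> 0"
      by (metis degree_eq_zeroE pCons_0_0)
    then show ?case
      using 0 left_ideal_mult[OF I(1), of "uscal c * u" "uscal (inverse c)"]
      by (simp flip: uscal_mult mult.assoc)
  next
    case (Suc n)
    have "\<not> constant (poly q)"
      using Suc.hyps(2) by (simp add: constant_degree)
    then obtain \<xi> where "poly q \<xi> = 0"
      using fundamental_theorem_of_algebra by blast
    then obtain r where r: "q = [:- \<xi>, 1:] * r"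
      by (auto simp: poly_eq_0_iff_dvd)
    then have "r \<noteq> 0" using Suc.prems(2) by auto
    then have "Polynomial.degree q = Suc (Polynomial.degree r)"
      unfolding r by (subst degree_mult_eq) auto
    moreover have "uea_poly uz r * u \<in> I"
    proof (rule cancel)
      have "uea_poly uz q = (uz - uscal \<xi>) * uea_poly uz r"
        unfolding r uea_poly_mult by (simp add: uscal_minus)
      then show "(uz - uscal \<xi>) * (uea_poly uz r * u) \<in> I"
        using Suc.prems(1) by (simp add: mult.assoc)
    qed
    ultimately show ?case
      using Suc.hyps \<open>r \<noteq> 0\<close> by simp
  qed
  have "\<exists>a. a * (uz - uscal \<xi>) - 1 \<in> I" for \<xi>
  proof -
    have "uz - uscal \<xi> \<in> range (\<lambda>u. u * (uz - uscal \<xi>))"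
      by (rule range_eqI[of _ _ 1]) simp
    then have "\<not> range (\<lambda>u. u * (uz - uscal \<xi>)) \<subseteq> I"
      using notin[of \<xi>] by blast
    then obtain i b where ib: "i \<in> I" "b \<in> range (\<lambda>u. u * (uz - uscal \<xi>))" "i + b = 1"
      using maximal_left_ideal_coprime[OF max left_ideal_principal] by metis
    then obtain u where "b = u * (uz - uscal \<xi>)" by blast
    then have "u * (uz - uscal \<xi>) - 1 = - i"
      using ib(3) by (simp add: eq_diff_eq flip: ib(3))
    then show ?thesis
      using left_ideal_minus[OF I(1) ib(1)] by metis
  qed
  then obtain a where a: "\<And>\<xi>. a \<xi> * (uz - uscal \<xi>) - 1 \<in> I" by metis
  have "inj a"
  proof (rule injI, rule ccontr)
    fix \<nu> \<mu> assume eq: "a \<nu> = a \<mu>" and ne: "\<nu> \<noteq> \<mu>"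
    have "(a \<nu> * (uz - uscal \<nu>) - 1) - (a \<mu> * (uz - uscal \<mu>) - 1) = uscal (\<mu> - \<nu>) * a \<mu>"
      unfolding eq by (simp add: algebra_simps uscal_diff uscal_central)
    then have "uscal (\<mu> - \<nu>) * a \<mu> \<in> I"
      using left_ideal_diff[OF I(1) a a] by metis
    then have "uscal (inverse (\<mu> - \<nu>)) * (uscal (\<mu> - \<nu>) * a \<mu>) \<in> I"
      by (rule left_ideal_mult[OF I(1)])
    then have "a \<mu> \<in> I"
      using ne by (simp flip: uscal_mult mult.assoc)
    then have "(uz - uscal \<mu>) * a \<mu> \<in> I"
      by (rule left_ideal_mult[OF I(1)])
    then have "a \<mu> * (uz - uscal \<mu>) \<in> I"
      by (simp add: algebra_simps uz_central uscal_central)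
    then show False
      using left_ideal_diff[OF I(1) _ a, of "a \<mu> * (uz - uscal \<mu>)" \<mu>] I(2) by simp
  qed
  then obtain \<Lambda> c where \<Lambda>: "finite \<Lambda>" "\<exists>\<nu>\<in>\<Lambda>. c \<nu> \<noteq> 0" "(\<Sum>\<nu>\<in>\<Lambda>. uscal (c \<nu>) * a \<nu>) = 0"
    by (rule linear_dependence_family)
  \<comment> \<open>\<open>P \<nu>\<close> is what remains of the common denominator after multiplication by \<open>a \<nu>\<close>; it is the
     only one of these products that does not vanish at \<open>\<nu>\<close>.\<close>
  define P where "P \<nu> = (\<Prod>\<mu>\<in>\<Lambda> - {\<nu>}. [:- \<mu>, 1:])" for \<nu>
  define q where "q = (\<Sum>\<nu>\<in>\<Lambda>. Polynomial.smult (c \<nu>) (P \<nu>))"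
  have "uscal (c \<nu>) * uea_poly uz (P \<nu>) - uscal (c \<nu>) * a \<nu> * uea_poly uz (\<Prod>\<mu>\<in>\<Lambda>. [:- \<mu>, 1:]) \<in> I"
    if "\<nu> \<in> \<Lambda>" for \<nu>
  proof -
    have "(\<Prod>\<mu>\<in>\<Lambda>. [:- \<mu>, 1:]) = [:- \<nu>, 1:] * P \<nu>"
      unfolding P_def using \<Lambda>(1) that by (rule prod.remove)
    then have e: "uea_poly uz (\<Prod>\<mu>\<in>\<Lambda>. [:- \<mu>, 1:]) = (uz - uscal \<nu>) * uea_poly uz (P \<nu>)"
      by (simp only: uea_poly_mult) (simp add: uscal_minus)
    have "uscal (c \<nu>) * uea_poly uz (P \<nu>) - uscal (c \<nu>) * a \<nu> * uea_poly uz (\<Prod>\<mu>\<in>\<Lambda>. [:- \<mu>, 1:])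
        = - uscal (c \<nu>) * ((a \<nu> * (uz - uscal \<nu>) - 1) * uea_poly uz (P \<nu>))"
      unfolding e by (simp add: algebra_simps)
    also have "\<dots> = (- uscal (c \<nu>) * uea_poly uz (P \<nu>)) * (a \<nu> * (uz - uscal \<nu>) - 1)"
      by (metis uea_poly_uz_central mult.assoc)
    finally show ?thesis
      using left_ideal_mult[OF I(1) a] by metis
  qed
  then have "(\<Sum>\<nu>\<in>\<Lambda>. uscal (c \<nu>) * uea_poly uz (P \<nu>) -
      uscal (c \<nu>) * a \<nu> * uea_poly uz (\<Prod>\<mu>\<in>\<Lambda>. [:- \<mu>, 1:])) \<in> I"
    by (rule left_ideal_sum[OF I(1)])
  then have "uea_poly uz q \<in> I"
    by (simp add: sum_subtractf \<Lambda>(3) q_def uea_poly_sum uea_poly_smult flip: sum_distrib_right)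
  moreover have "q \<noteq> 0"
  proof -
    obtain \<nu> where \<nu>: "\<nu> \<in> \<Lambda>" "c \<nu> \<noteq> 0" using \<Lambda>(2) by auto
    have "poly (P \<mu>) \<nu> = 0" if "\<mu> \<in> \<Lambda> - {\<nu>}" for \<mu>
      unfolding P_def poly_prod using \<Lambda>(1) \<nu>(1) that by (intro prod_zero) auto
    then have "poly q \<nu> = c \<nu> * poly (P \<nu>) \<nu>"
      using \<Lambda>(1) \<nu>(1) by (simp add: q_def poly_sum sum.remove)
    moreover have "poly (P \<nu>) \<nu> \<noteq> 0"
      unfolding P_def poly_prod using \<Lambda>(1) by simp
    ultimately have "poly q \<nu> \<noteq> 0"
      using \<nu>(2) by simp
    then show ?thesis by auto
  qed
  ultimately show False
    using cancel_poly[of q 1] I(2) by simp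
qed

section \<open>The leading term of the Shapovalov pairing\<close>

text \<open>
  A list of positive numbers stands for a word in the lowering operators \<open>d\<^sub>-\<^sub>b\<close>, or in the raising
  operators \<open>d\<^sub>k\<close>. The two orders are opposite: the head of the list is the outermost factor of
  \<open>lower_word\<close> and the innermost one of \<open>raise_word\<close>, so that it is the first raising operator to meet
  a word to its right.
\<close>

primrec lower_word :: "nat list \<Rightarrow> vir_uea" where
  "lower_word [] = 1"
| "lower_word (b # \<mu>) = ud (- int b) * lower_word \<mu>"

primrec raise_word :: "nat list \<Rightarrow> vir_uea" where
  "raise_word [] = 1"
| "raise_word (k # \<mu>) = raise_word \<mu> * ud (int k)"

abbreviation all_pos :: "nat list \<Rightarrow> bool" where "all_pos \<mu> \<equiv> \<forall>b\<in>set \<mu>. 0 < b"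

lemma lower_word_append: "lower_word (\<mu> @ \<nu>) = lower_word \<mu> * lower_word \<nu>"
  by (induction \<mu>) (simp_all add: mult.assoc)

lemma ud_0_ud: "ud 0 * ud j = ud j * (ud 0 - of_int j)"
  by (simp add: ud_commute[of 0 j] right_diff_distrib uscal_minus flip: uscal_of_int uscal_central)

lemma ud_0_lower_word: "ud 0 * lower_word \<mu> = lower_word \<mu> * (ud 0 + of_nat (sum_list \<mu>))"
proof (induction \<mu>)
  case (Cons b \<mu>)
  have "ud 0 * lower_word (b # \<mu>) = (ud 0 * ud (- int b)) * lower_word \<mu>"
    by (simp add: mult.assoc)
  also have "\<dots> = ud (- int b) * (ud 0 * lower_word \<mu> + of_nat b * lower_word \<mu>)"
    by (simp add: ud_0_ud algebra_simps)
  also have "of_nat b * lower_word \<mu> = lower_word \<mu> * of_nat b"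
    by (metis uscal_central uscal_of_int of_int_of_nat_eq)
  finally show ?case
    by (simp add: Cons algebra_simps)
qed simp

lemma uscal_of_nat: "uscal (of_nat n) = of_nat n"
  using uscal_of_int[of "int n"] by simp

text \<open>
  The left ideals to which the leading term computation applies: modulo \<open>J\<close> the unit is killed by
  \<open>n\<^sup>+\<close>, and \<open>z\<close> is a number, while \<open>d\<^sub>0\<close> may remain a variable. Because \<open>J\<close> is stable under right
  multiplication by \<open>d\<^sub>0\<close>, the quotient \<open>U(\<gg>) / J\<close> has a right action of \<open>\<complex>[d\<^sub>0]\<close>, which commutes with the
  left action. Polynomials in \<open>d\<^sub>0\<close> are therefore kept on the right, where they are coefficients.
\<close>

locale singular_ideal =
  fixes J :: "vir_uea set" and \<xi> :: complex
  assumes left_ideal_J: "left_ideal J"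
    and right_closed: "u \<in> J \<Longrightarrow> u * ud 0 \<in> J"
    and positive: "k > 0 \<Longrightarrow> ud k \<in> J"
    and central: "uz - uscal \<xi> \<in> J"
begin

abbreviation ev :: "complex poly \<Rightarrow> vir_uea" where "ev \<equiv> uea_poly (ud 0)"

lemmas J_closed = left_idealD[OF left_ideal_J]

lemma J_right_ev: "u \<in> J \<Longrightarrow> u * ev q \<in> J"
proof (induction q arbitrary: u)
  case (pCons a q)
  then show ?case
    using right_closed J_closed by (simp add: distrib_left uscal_central flip: mult.assoc)
qed (simp add: J_closed)

text \<open>
  Modulo \<open>J\<close>, the set \<open>\<Phi> n s\<close> is spanned by the words of weight \<open>n\<close> whose coefficients have small
  degree: a lowering operator counts once and \<open>d\<^sub>0\<close> counts twice. With these weights a raising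
  operator can increase \<open>s\<close> only by cancelling a lowering operator against it, through
  \<open>[d\<^sub>k, d\<^sub>-\<^sub>k] = 2 k d\<^sub>0 + \<dots>\<close>; the other terms produced by the commutation relations leave \<open>s\<close>
  unchanged or decrease it. Both indices are integers so that truncated subtraction does not interfere.
\<close>

inductive_set \<Phi> :: "int \<Rightarrow> int \<Rightarrow> vir_uea set" for n s where
  ideal: "u \<in> J \<Longrightarrow> u \<in> \<Phi> n s"
| add: "u \<in> \<Phi> n s \<Longrightarrow> v \<in> \<Phi> n s \<Longrightarrow> u + v \<in> \<Phi> n s"
| monomial: "all_pos \<mu> \<Longrightarrow> int (sum_list \<mu>) = n \<Longrightarrow>
    2 * int (Polynomial.degree g) + int (length \<mu>) \<le> s \<Longrightarrow> lower_word \<mu> * ev g \<in> \<Phi> n s"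

lemma \<Phi>_zero: "0 \<in> \<Phi> n s"
  by (intro \<Phi>.ideal J_closed)

lemma \<Phi>_mono: "u \<in> \<Phi> n s \<Longrightarrow> s \<le> s' \<Longrightarrow> u \<in> \<Phi> n s'"
  by (induction rule: \<Phi>.induct) (auto intro: \<Phi>.intros)

lemma \<Phi>_ev: "u \<in> \<Phi> n s \<Longrightarrow> u * ev q \<in> \<Phi> n (s + 2 * int (Polynomial.degree q))"
proof (induction rule: \<Phi>.induct)
  case (monomial \<mu> g)
  have "int (Polynomial.degree (g * q)) \<le> int (Polynomial.degree g) + int (Polynomial.degree q)"
    using Polynomial.degree_mult_le[of g q] by linarith
  then have "lower_word \<mu> * ev (g * q) \<in> \<Phi> n (s + 2 * int (Polynomial.degree q))"
    using monomial by (intro \<Phi>.monomial) auto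
  then show ?case by (simp add: uea_poly_mult mult.assoc)
qed (auto intro: \<Phi>.intros simp: J_right_ev distrib_right)

lemma \<Phi>_uscal: "u \<in> \<Phi> n s \<Longrightarrow> uscal c * u \<in> \<Phi> n s"
  using \<Phi>_ev[of u n s "[:c:]"] by (simp add: uscal_central)

lemma \<Phi>_negative: "u \<in> \<Phi> n s \<Longrightarrow> n < 0 \<Longrightarrow> u \<in> J"
  by (induction rule: \<Phi>.induct) (auto intro: J_closed)

lemma \<Phi>_lower: "u \<in> \<Phi> n s \<Longrightarrow> 0 < b \<Longrightarrow> ud (- int b) * u \<in> \<Phi> (n + int b) (s + 1)"
proof (induction rule: \<Phi>.induct)
  case (monomial \<mu> g)
  then have "lower_word (b # \<mu>) * ev g \<in> \<Phi> (n + int b) (s + 1)"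
    by (intro \<Phi>.monomial) auto
  then show ?case by (simp add: mult.assoc)
qed (auto intro: \<Phi>.intros J_closed simp: distrib_left)

lemma \<Phi>_weight_zero:
  assumes "u \<in> \<Phi> 0 s"
  obtains g where "u - ev g \<in> J" "g = 0 \<or> 2 * int (Polynomial.degree g) \<le> s"
proof -
  have "\<exists>g. u - ev g \<in> J \<and> (g = 0 \<or> 2 * int (Polynomial.degree g) \<le> s)"
    using assms
  proof (induction rule: \<Phi>.induct)
    case (ideal u)
    then show ?case by (intro exI[of _ 0]) simp
  next
    case (add u v)
    then obtain g h where gh: "u - ev g \<in> J" "g = 0 \<or> 2 * int (Polynomial.degree g) \<le> s"
      "v - ev h \<in> J" "h = 0 \<or> 2 * int (Polynomial.degree h) \<le> s" by blast
    have "u + v - ev (g + h) \<in> J"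
      using J_closed(2)[OF gh(1,3)] by (simp add: uea_poly_add algebra_simps)
    moreover have "g + h = 0 \<or> 2 * int (Polynomial.degree (g + h)) \<le> s"
      using gh(2,4) degree_add_le_max[of g h] by (cases "g = 0"; cases "h = 0") auto
    ultimately show ?case by blast
  next
    case (monomial \<mu> g)
    then have "\<mu> = []" by (cases \<mu>) auto
    then show ?case
      using monomial by (intro exI[of _ g]) (auto simp: J_closed)
  qed
  then show ?thesis using that by blast
qed

text \<open>
  The part of highest order of the product of \<open>d\<^sub>k\<close> with a word: the sum over all occurrences of
  \<open>d\<^sub>-\<^sub>k\<close> in the word, each replaced by \<open>2 k d\<^sub>0\<close> and the \<open>d\<^sub>0\<close> moved to the right.
\<close>

primrec contraction :: "nat \<Rightarrow> nat list \<Rightarrow> vir_uea" where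
  "contraction k [] = 0"
| "contraction k (b # \<mu>) = (if b = k then lower_word \<mu> * ev [:0, of_nat (2 * k):] else 0) + ud (- int b) * contraction k \<mu>"

lemma contraction_in_\<Phi>: "all_pos \<mu> \<Longrightarrow> contraction k \<mu> \<in> \<Phi> (int (sum_list \<mu>) - int k) (int (length \<mu>) + 1)"
proof (induction \<mu>)
  case (Cons b \<mu>)
  let ?n = "int (sum_list (b # \<mu>)) - int k" and ?s = "int (length (b # \<mu>)) + 1"
  have "ud (- int b) * contraction k \<mu> \<in> \<Phi> ?n ?s"
    using \<Phi>_lower[OF Cons.IH, of b] Cons.prems by (simp add: algebra_simps)
  moreover have "(if b = k then lower_word \<mu> * ev [:0, of_nat (2 * k):] else 0) \<in> \<Phi> ?n ?s"
  proof (cases "b = k")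
    case True
    have "lower_word \<mu> * ev [:0, of_nat (2 * k):] \<in> \<Phi> ?n ?s"
      using Cons.prems True by (intro \<Phi>.monomial) auto
    with True show ?thesis by simp
  qed (simp add: \<Phi>_zero)
  ultimately show ?case
    by (auto intro: \<Phi>.add)
qed (simp add: \<Phi>_zero)

text \<open>
  Moving \<open>d\<^sub>k\<close> across \<open>d\<^sub>-\<^sub>b\<close> leaves a multiple of \<open>d\<close> with index \<open>k - b\<close>. For \<open>b < k\<close> this is a
  raising operator in front of a word shorter by one, for \<open>b > k\<close> a lowering operator that replaces \<open>d\<^sub>-\<^sub>b\<close>, and for \<open>b = k\<close> it
  contributes to the contraction, up to the shift of \<open>d\<^sub>0\<close> by the weight of the remaining word and a
  central term.
\<close>

lemma raise_lower_word:
  assumes "all_pos \<mu>" "0 < k"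
  shows "ud (int k) * lower_word \<mu> - contraction k \<mu> \<in> \<Phi> (int (sum_list \<mu>) - int k) (int (length \<mu>))"
  using assms
proof (induction \<mu> arbitrary: k)
  case Nil
  then show ?case using positive by (simp add: \<Phi>.ideal)
next
  case (Cons b \<mu>)
  let ?n = "int (sum_list (b # \<mu>)) - int k" and ?s = "int (length (b # \<mu>))"
  define c where "c = complex_of_int (int k ^ 3 - int k) / 12"
  \<comment> \<open>\<open>T1\<close>, \<open>T2\<close> and \<open>T3\<close> collect the term in which \<open>d\<^sub>k\<close> has passed \<open>d\<^sub>-\<^sub>b\<close>, the commutator and the
     central term, the first two reduced by their shares of the contraction.\<close>
  define T1 where "T1 = ud (- int b) * (ud (int k) * lower_word \<mu> - contraction k \<mu>)"
  define T2 where "T2 = of_int (int k + int b) * (ud (int k - int b) * lower_word \<mu>)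
    - (if b = k then lower_word \<mu> * ev [:0, of_nat (2 * k):] else 0)"
  define T3 where "T3 = (if b = k then uscal c * (uz * lower_word \<mu>) else 0)"
  have "ud (int k) * lower_word (b # \<mu>) - contraction k (b # \<mu>) = T1 + T2 + T3"
  proof -
    have "ud (int k) * lower_word (b # \<mu>) = (ud (int k) * ud (- int b)) * lower_word \<mu>"
      by (simp add: mult.assoc)
    also have "ud (int k) * ud (- int b) = ud (- int b) * ud (int k)
        + of_int (int k + int b) * ud (int k - int b) + (if b = k then uscal c * uz else 0)"
      unfolding ud_commute[of "int k" "- int b"] c_def by simp
    finally show ?thesis
      by (simp add: T1_def T2_def T3_def algebra_simps)
  qed
  moreover have "T1 \<in> \<Phi> ?n ?s"
    using \<Phi>_lower[OF Cons.IH, of k b] Cons.prems by (simp add: T1_def algebra_simps)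
  moreover have "T3 \<in> \<Phi> ?n ?s"
  proof (cases "b = k")
    case True
    have "uz * lower_word \<mu> = lower_word \<mu> * (uz - uscal \<xi>) + lower_word \<mu> * ev [:\<xi>:]"
      by (simp add: algebra_simps uz_central)
    moreover have "lower_word \<mu> * (uz - uscal \<xi>) \<in> \<Phi> ?n ?s"
      by (intro \<Phi>.ideal J_closed(3) central)
    moreover have "lower_word \<mu> * ev [:\<xi>:] \<in> \<Phi> ?n ?s"
      using Cons.prems True by (intro \<Phi>.monomial) auto
    ultimately have "uz * lower_word \<mu> \<in> \<Phi> ?n ?s"
      by (simp only: \<Phi>.add)
    then have "uscal c * (uz * lower_word \<mu>) \<in> \<Phi> ?n ?s"
      by (rule \<Phi>_uscal)
    with True show ?thesis by (simp add: T3_def)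
  qed (simp add: T3_def \<Phi>_zero)
  moreover have "T2 \<in> \<Phi> ?n ?s"
  proof (cases b k rule: linorder_cases)
    case less
    have "ud (int (k - b)) * lower_word \<mu> - contraction (k - b) \<mu> \<in> \<Phi> (int (sum_list \<mu>) - int (k - b)) (int (length \<mu>))"
      by (rule Cons.IH) (use Cons.prems less in auto)
    then have "ud (int (k - b)) * lower_word \<mu> - contraction (k - b) \<mu> \<in> \<Phi> ?n ?s"
      using less by (auto elim!: \<Phi>_mono simp: of_nat_diff algebra_simps)
    moreover have "contraction (k - b) \<mu> \<in> \<Phi> ?n ?s"
      using contraction_in_\<Phi>[of \<mu> "k - b"] Cons.prems less by (simp add: of_nat_diff algebra_simps)
    ultimately have "ud (int k - int b) * lower_word \<mu> \<in> \<Phi> ?n ?s"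
      using \<Phi>.add less by (fastforce simp: of_nat_diff)
    then have "uscal (of_int (int k + int b)) * (ud (int k - int b) * lower_word \<mu>) \<in> \<Phi> ?n ?s"
      by (rule \<Phi>_uscal)
    then show ?thesis
      using less by (simp add: T2_def uscal_of_int del: of_int_add)
  next
    case greater
    have "lower_word ((b - k) # \<mu>) * ev 1 \<in> \<Phi> ?n ?s"
      using Cons.prems greater by (intro \<Phi>.monomial) (auto simp: of_nat_diff)
    then have "uscal (of_int (int k + int b)) * (ud (int k - int b) * lower_word \<mu>) \<in> \<Phi> ?n ?s"
      using greater by (intro \<Phi>_uscal) (simp add: of_nat_diff)
    then show ?thesis
      using greater by (simp add: T2_def uscal_of_int del: of_int_add)
  next
    case equal
    have "of_int (int k + int b) * (ud 0 * lower_word \<mu>) = lower_word \<mu> * ev [:0, of_nat (2 * k):]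
        + lower_word \<mu> * ev [:of_nat (2 * k * sum_list \<mu>):]"
    proof -
      have scal: "uscal a * (y * (x + uscal n)) = y * ev [:0, a:] + y * ev [:a * n:]"
        if "x = ud 0" for a n x y
      proof -
        have "uscal a * (y * (x + uscal n)) = y * ((x + uscal n) * uscal a)"
          by (metis uscal_central uscal_left_commute)
        also have "\<dots> = y * (x * uscal a + uscal (a * n))"
          using uscal_mult[of n a] by (simp add: distrib_right mult.commute)
        finally show ?thesis
          by (simp add: that distrib_left)
      qed
      have "of_int (int k + int b) * (ud 0 * lower_word \<mu>)
          = uscal (of_nat (2 * k)) * (lower_word \<mu> * (ud 0 + uscal (of_nat (sum_list \<mu>))))"
        using equal unfolding ud_0_lower_word uscal_of_nat by simp
      then show ?thesis
        unfolding scal[OF refl] by simp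
    qed
    then have "T2 = lower_word \<mu> * ev [:of_nat (2 * k * sum_list \<mu>):]"
      using equal by (simp add: T2_def)
    then show ?thesis
      using Cons.prems equal by (simp only:) (intro \<Phi>.monomial, auto)
  qed
  ultimately show ?case
    by (simp only: \<Phi>.add)
qed

lemma \<Phi>_raise:
  assumes "u \<in> \<Phi> n s" "0 < k"
  shows "ud (int k) * u \<in> \<Phi> (n - int k) (s + 1)"
  using assms(1)
proof (induction rule: \<Phi>.induct)
  case (monomial \<mu> g)
  let ?n = "int (sum_list \<mu>) - int k" and ?s = "int (length \<mu>) + 1"
  have "ud (int k) * lower_word \<mu> - contraction k \<mu> \<in> \<Phi> ?n ?s" "contraction k \<mu> \<in> \<Phi> ?n ?s"
    using \<Phi>_mono[OF raise_lower_word[OF monomial(1) assms(2)], of ?s] contraction_in_\<Phi>[OF monomial(1)] by auto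
  then have "(ud (int k) * lower_word \<mu> - contraction k \<mu>) + contraction k \<mu> \<in> \<Phi> ?n ?s"
    by (rule \<Phi>.add)
  then have "ud (int k) * lower_word \<mu> * ev g \<in> \<Phi> ?n (?s + 2 * int (Polynomial.degree g))"
    using \<Phi>_ev by simp
  then show ?case
    using monomial by (auto elim!: \<Phi>_mono simp: mult.assoc)
qed (auto intro: \<Phi>.intros J_closed simp: distrib_left)

lemma \<Phi>_raise_word: "all_pos \<mu> \<Longrightarrow> u \<in> \<Phi> n s \<Longrightarrow>
    raise_word \<mu> * u \<in> \<Phi> (n - int (sum_list \<mu>)) (s + int (length \<mu>))"
proof (induction \<mu> arbitrary: u n s)
  case (Cons k \<mu>)
  have "raise_word \<mu> * (ud (int k) * u) \<in> \<Phi> (n - int k - int (sum_list \<mu>)) (s + 1 + int (length \<mu>))"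
    using Cons.prems by (intro Cons.IH \<Phi>_raise) auto
  then show ?case by (simp add: mult.assoc algebra_simps)
qed simp

text \<open>
  The Shapovalov pairing of two words of equal weight is a polynomial in \<open>d\<^sub>0\<close>. The only term of the
  highest possible order arises by contracting every raising operator with a lowering operator of
  opposite index, which requires that both words use the same indices with the same multiplicities;
  its coefficient is then a product of positive integers, hence positive.
\<close>

lemma pairing_leading_term:
  assumes "all_pos \<alpha>"
  shows "\<exists>m>0. \<forall>\<mu>. all_pos \<mu> \<and> sum_list \<mu> = sum_list \<alpha> \<longrightarrow>
    raise_word \<alpha> * lower_word \<mu> - (if mset \<mu> = mset \<alpha> then ev (monom (of_nat m) (length \<alpha>)) else 0)
      \<in> \<Phi> 0 (int (length \<alpha>) + int (length \<mu>) - 1)"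
  using assms
proof (induction \<alpha>)
  case Nil
  show ?case
  proof (intro exI[of _ 1] conjI allI impI)
    fix \<mu> :: "nat list" assume "all_pos \<mu> \<and> sum_list \<mu> = sum_list []"
    then have "\<mu> = []" by (cases \<mu>) auto
    then show "raise_word [] * lower_word \<mu> - (if mset \<mu> = mset [] then ev (monom (of_nat 1) (length [])) else 0)
        \<in> \<Phi> 0 (int (length []) + int (length \<mu>) - 1)"
      by (simp add: \<Phi>_zero)
  qed simp
next
  case (Cons k \<kappa>)
  then have k: "0 < k" "all_pos \<kappa>" by auto
  obtain m where m: "0 < m" and IH: "\<And>\<mu>. all_pos \<mu> \<Longrightarrow> sum_list \<mu> = sum_list \<kappa> \<Longrightarrow>
    raise_word \<kappa> * lower_word \<mu> - (if mset \<mu> = mset \<kappa> then ev (monom (of_nat m) (length \<kappa>)) else 0)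
      \<in> \<Phi> 0 (int (length \<kappa>) + int (length \<mu>) - 1)"
    using Cons.IH[OF k(2)] by blast
  define E where "E j = ev (monom (of_nat (m * (2 * k) * j)) (Suc (length \<kappa>)))" for j
  have E_add: "E (i + j) = E i + E j" for i j
    by (simp add: E_def add_monom[symmetric] uea_poly_add distrib_left)
  \<comment> \<open>The contraction is a sum over positions; \<open>\<rho>\<close> holds the letters already passed, and each
     occurrence of \<open>k\<close> in \<open>\<nu>\<close> contributes the leading term of a pairing of shorter words.\<close>
  have inner: "raise_word \<kappa> * (lower_word \<rho> * contraction k \<nu>) - (if mset (\<rho> @ \<nu>) = mset (k # \<kappa>) then E (count (mset \<nu>) k) else 0)
      \<in> \<Phi> 0 (int (length \<kappa>) + int (length \<rho>) + int (length \<nu>))"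
    if "all_pos \<rho>" "all_pos \<nu>" "sum_list (\<rho> @ \<nu>) = sum_list (k # \<kappa>)" for \<rho> \<nu>
    using that
  proof (induction \<nu> arbitrary: \<rho>)
    case Nil
    then show ?case by (simp add: E_def \<Phi>_zero)
  next
    case (Cons b \<nu>)
    let ?s = "int (length \<kappa>) + int (length \<rho>) + int (length (b # \<nu>))"
    let ?c = "mset (\<rho> @ b # \<nu>) = mset (k # \<kappa>)"
    have A: "raise_word \<kappa> * (lower_word (\<rho> @ [b]) * contraction k \<nu>) - (if ?c then E (count (mset \<nu>) k) else 0) \<in> \<Phi> 0 ?s"
      using Cons.IH[of "\<rho> @ [b]"] Cons.prems by (simp add: algebra_simps)
    show ?case
    proof (cases "b = k")
      case False
      then show ?thesis
        using A by (simp add: lower_word_append mult.assoc split del: if_split cong: if_cong)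
    next
      case True
      have "raise_word \<kappa> * lower_word (\<rho> @ \<nu>) - (if mset (\<rho> @ \<nu>) = mset \<kappa> then ev (monom (of_nat m) (length \<kappa>)) else 0)
          \<in> \<Phi> 0 (int (length \<kappa>) + int (length (\<rho> @ \<nu>)) - 1)"
        using Cons.prems True by (intro IH) auto
      then have "(raise_word \<kappa> * lower_word (\<rho> @ \<nu>) - (if mset (\<rho> @ \<nu>) = mset \<kappa> then ev (monom (of_nat m) (length \<kappa>)) else 0))
          * ev [:0, of_nat (2 * k):] \<in> \<Phi> 0 (int (length \<kappa>) + int (length (\<rho> @ \<nu>)) - 1 + 2 * int (Polynomial.degree [:0, of_nat (2 * k) :: complex:]))"
        by (rule \<Phi>_ev)
      moreover have "ev (monom (of_nat m) (length \<kappa>)) * ev [:0, of_nat (2 * k):] = E 1"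
        unfolding E_def uea_poly_mult[symmetric] by (simp add: monom_Suc smult_monom mult_ac)
      moreover have "mset (\<rho> @ \<nu>) = mset \<kappa> \<longleftrightarrow> ?c"
        using True by simp
      ultimately have "raise_word \<kappa> * (lower_word (\<rho> @ \<nu>) * ev [:0, of_nat (2 * k):]) - (if ?c then E 1 else 0)
          \<in> \<Phi> 0 (int (length \<kappa>) + int (length (\<rho> @ \<nu>)) - 1 + 2 * int (Polynomial.degree [:0, of_nat (2 * k) :: complex:]))"
        by (cases ?c) (simp_all add: left_diff_distrib mult.assoc)
      then have B: "raise_word \<kappa> * (lower_word (\<rho> @ \<nu>) * ev [:0, of_nat (2 * k):]) - (if ?c then E 1 else 0) \<in> \<Phi> 0 ?s"
        by (rule \<Phi>_mono) (use k(1) in simp)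
      have "raise_word \<kappa> * (lower_word \<rho> * contraction k (b # \<nu>)) - (if ?c then E (count (mset (b # \<nu>)) k) else 0)
        = (raise_word \<kappa> * (lower_word (\<rho> @ \<nu>) * ev [:0, of_nat (2 * k):]) - (if ?c then E 1 else 0))
          + (raise_word \<kappa> * (lower_word (\<rho> @ [b]) * contraction k \<nu>) - (if ?c then E (count (mset \<nu>) k) else 0))"
        using True E_add[of 1 "count (mset \<nu>) k"]
        by (simp add: lower_word_append mult.assoc distrib_left)
      then show ?thesis
        using \<Phi>.add[OF B A] by (simp only:)
    qed
  qed
  define m' where "m' = m * (2 * k) * count (mset (k # \<kappa>)) k"
  have "raise_word (k # \<kappa>) * lower_word \<mu> - (if mset \<mu> = mset (k # \<kappa>) then ev (monom (of_nat m') (length (k # \<kappa>))) else 0)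
      \<in> \<Phi> 0 (int (length (k # \<kappa>)) + int (length \<mu>) - 1)"
    if \<mu>: "all_pos \<mu>" "sum_list \<mu> = sum_list (k # \<kappa>)" for \<mu>
  proof -
    let ?s = "int (length (k # \<kappa>)) + int (length \<mu>) - 1"
    have "raise_word \<kappa> * (ud (int k) * lower_word \<mu> - contraction k \<mu>) \<in>
        \<Phi> (int (sum_list \<mu>) - int k - int (sum_list \<kappa>)) (int (length \<mu>) + int (length \<kappa>))"
      using k \<mu>(1) by (intro \<Phi>_raise_word raise_lower_word)
    then have A: "raise_word \<kappa> * (ud (int k) * lower_word \<mu> - contraction k \<mu>) \<in> \<Phi> 0 ?s"
      using \<mu>(2) by (simp add: algebra_simps)
    have B: "raise_word \<kappa> * contraction k \<mu> - (if mset \<mu> = mset (k # \<kappa>) then E (count (mset \<mu>) k) else 0) \<in> \<Phi> 0 ?s"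
      using inner[of "[]" \<mu>] \<mu> by (simp add: algebra_simps)
    have "raise_word (k # \<kappa>) * lower_word \<mu> - (if mset \<mu> = mset (k # \<kappa>) then ev (monom (of_nat m') (length (k # \<kappa>))) else 0)
      = raise_word \<kappa> * (ud (int k) * lower_word \<mu> - contraction k \<mu>)
        + (raise_word \<kappa> * contraction k \<mu> - (if mset \<mu> = mset (k # \<kappa>) then E (count (mset \<mu>) k) else 0))"
      by (simp add: m'_def E_def algebra_simps)
    then show ?thesis
      using \<Phi>.add[OF A B] by (simp only:)
  qed
  moreover have "0 < m'"
    using m k(1) by (simp add: m'_def)
  ultimately show ?case by blast
qed

section \<open>Ordered monomials\<close>

text \<open>
  Among the words with nonzero coefficient in a relation, consider those of maximal weight, and among
  these one, \<open>\<alpha>\<close>, for which twice the degree of the coefficient plus the length is maximal. Applying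
  \<open>raise_word \<alpha>\<close> kills all words of smaller weight and maps the others to polynomials in \<open>d\<^sub>0\<close>. By
  \<open>pairing_leading_term\<close>, the word \<open>\<alpha>\<close> contributes a term of degree \<open>K\<close> and every other word only terms
  of lower degree. Ordered words are determined by their multiset, so \<open>\<alpha>\<close> itself is the only word that
  matches.
\<close>

lemma ordered_monomials_independent:
  assumes I: "left_ideal I" "J \<subseteq> I" and free: "\<And>q. ev q \<in> I \<Longrightarrow> q = 0"
    and F: "finite F" "\<And>\<mu>. \<mu> \<in> F \<Longrightarrow> all_pos \<mu> \<and> sorted \<mu>"
    and sum: "(\<Sum>\<mu>\<in>F. lower_word \<mu> * ev (q \<mu>)) \<in> I" and \<mu>: "\<mu> \<in> F"
  shows "q \<mu> = 0"
proof (rule ccontr)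
  assume "q \<mu> \<noteq> 0"
  define G where "G = {\<mu> \<in> F. q \<mu> \<noteq> 0}"
  have G: "finite G" "G \<noteq> {}" "\<And>\<mu>. \<mu> \<in> G \<Longrightarrow> all_pos \<mu> \<and> sorted \<mu> \<and> q \<mu> \<noteq> 0"
    using F \<mu> \<open>q \<mu> \<noteq> 0\<close> by (auto simp: G_def)
  have sumG: "(\<Sum>\<mu>\<in>G. lower_word \<mu> * ev (q \<mu>)) \<in> I"
  proof -
    have "(\<Sum>\<mu>\<in>F. lower_word \<mu> * ev (q \<mu>)) = (\<Sum>\<mu>\<in>G. lower_word \<mu> * ev (q \<mu>))"
      by (rule sum.mono_neutral_right) (auto simp: F(1) G_def)
    then show ?thesis using sum by simp
  qed
  define N where "N = Max (sum_list ` G)"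
  have N: "sum_list \<mu> \<le> N" if "\<mu> \<in> G" for \<mu>
    unfolding N_def using that G(1) by simp
  define H where "H = {\<mu> \<in> G. sum_list \<mu> = N}"
  have "N \<in> sum_list ` G"
    unfolding N_def using G(1,2) by (intro Max_in) auto
  then have H: "finite H" "H \<noteq> {}"
    using G(1) by (auto simp: H_def)
  \<comment> \<open>The order of \<open>lower_word \<mu> * ev (q \<mu>)\<close> in the filtration \<open>\<Phi>\<close>.\<close>
  define w where "w \<mu> = 2 * Polynomial.degree (q \<mu>) + length \<mu>" for \<mu>
  have "Max (w ` H) \<in> w ` H"
    using H by (intro Max_in) auto
  then obtain \<alpha> where \<alpha>: "\<alpha> \<in> H" "w \<alpha> = Max (w ` H)" by auto
  have max: "w \<mu> \<le> w \<alpha>" if "\<mu> \<in> H" for \<mu>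
    unfolding \<alpha>(2) using that H(1) by simp
  have \<alpha>G: "\<alpha> \<in> G" "sum_list \<alpha> = N"
    using \<alpha>(1) by (auto simp: H_def)
  obtain m where m: "0 < m" and lead: "\<And>\<mu>. all_pos \<mu> \<Longrightarrow> sum_list \<mu> = sum_list \<alpha> \<Longrightarrow>
    raise_word \<alpha> * lower_word \<mu> - (if mset \<mu> = mset \<alpha> then ev (monom (of_nat m) (length \<alpha>)) else 0)
      \<in> \<Phi> 0 (int (length \<alpha>) + int (length \<mu>) - 1)"
    using pairing_leading_term[of \<alpha>] G(3)[OF \<alpha>G(1)] by blast
  define K where "K = length \<alpha> + Polynomial.degree (q \<alpha>)"
  have "\<exists>P. raise_word \<alpha> * (lower_word \<mu> * ev (q \<mu>)) - ev P \<in> J \<and>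
      Polynomial.coeff P K = (if \<mu> = \<alpha> then of_nat m * lead_coeff (q \<alpha>) else 0)"
    if \<mu>: "\<mu> \<in> G" for \<mu>
  proof (cases "\<mu> \<in> H")
    case False
    then have less: "sum_list \<mu> < N"
      using \<mu> N[of \<mu>] by (auto simp: H_def)
    have "lower_word \<mu> * ev 1 \<in> \<Phi> (int (sum_list \<mu>)) (int (length \<mu>))"
      using G(3)[OF \<mu>] by (intro \<Phi>.monomial) auto
    then have "raise_word \<alpha> * (lower_word \<mu> * ev 1) \<in> \<Phi> (int (sum_list \<mu>) - int N) (int (length \<mu>) + int (length \<alpha>))"
      using \<Phi>_raise_word G(3)[OF \<alpha>G(1)] \<alpha>G(2) by blast
    then have "raise_word \<alpha> * lower_word \<mu> \<in> J"
      using less by (auto dest: \<Phi>_negative)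
    then have "raise_word \<alpha> * lower_word \<mu> * ev (q \<mu>) \<in> J"
      by (rule J_right_ev)
    moreover have "\<mu> \<noteq> \<alpha>" using False \<alpha>(1) by auto
    ultimately show ?thesis
      by (intro exI[of _ 0]) (simp add: mult.assoc)
  next
    case True
    define M where "M = (if \<mu> = \<alpha> then monom (of_nat m) (length \<alpha>) else 0 :: complex poly)"
    have "mset \<mu> = mset \<alpha> \<longleftrightarrow> \<mu> = \<alpha>"
      using G(3)[OF \<mu>] G(3)[OF \<alpha>G(1)] properties_for_sort by metis
    then have "raise_word \<alpha> * lower_word \<mu> - ev M \<in> \<Phi> 0 (int (length \<alpha>) + int (length \<mu>) - 1)"
      using lead[of \<mu>] G(3)[OF \<mu>] True \<alpha>G(2) by (auto simp: M_def H_def)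
    then obtain g where g: "raise_word \<alpha> * lower_word \<mu> - ev M - ev g \<in> J"
      and deg: "g = 0 \<or> 2 * int (Polynomial.degree g) \<le> int (length \<alpha>) + int (length \<mu>) - 1"
      by (rule \<Phi>_weight_zero)
    have "(raise_word \<alpha> * lower_word \<mu> - ev M - ev g) * ev (q \<mu>) \<in> J"
      using g by (rule J_right_ev)
    then have "raise_word \<alpha> * (lower_word \<mu> * ev (q \<mu>)) - ev ((M + g) * q \<mu>) \<in> J"
      by (simp add: uea_poly_mult uea_poly_add algebra_simps)
    moreover have "Polynomial.coeff (g * q \<mu>) K = 0"
    proof (cases "g = 0")
      case False
      have deg': "2 * int (Polynomial.degree g) \<le> int (length \<alpha>) + int (length \<mu>) - 1"
        using deg False by blast
      have "Polynomial.degree (g * q \<mu>) \<le> Polynomial.degree g + Polynomial.degree (q \<mu>)"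
        by (rule Polynomial.degree_mult_le)
      moreover have "2 * (Polynomial.degree g + Polynomial.degree (q \<mu>)) < 2 * K"
        using max[OF True] deg' unfolding w_def K_def by presburger
      then have "Polynomial.degree g + Polynomial.degree (q \<mu>) < K"
        by simp
      ultimately show ?thesis
        by (intro coeff_eq_0) (rule le_less_trans)
    qed simp
    then have "Polynomial.coeff ((M + g) * q \<mu>) K = (if \<mu> = \<alpha> then of_nat m * lead_coeff (q \<alpha>) else 0)"
      by (simp add: M_def distrib_right coeff_monom_mult K_def)
    ultimately show ?thesis by blast
  qed
  then obtain P where P: "\<And>\<mu>. \<mu> \<in> G \<Longrightarrow> raise_word \<alpha> * (lower_word \<mu> * ev (q \<mu>)) - ev (P \<mu>) \<in> J"
    and coeffP: "\<And>\<mu>. \<mu> \<in> G \<Longrightarrow> Polynomial.coeff (P \<mu>) K = (if \<mu> = \<alpha> then of_nat m * lead_coeff (q \<alpha>) else 0)"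
    by metis
  have "raise_word \<alpha> * (\<Sum>\<mu>\<in>G. lower_word \<mu> * ev (q \<mu>)) - ev (\<Sum>\<mu>\<in>G. P \<mu>) \<in> I"
    unfolding uea_poly_sum sum_distrib_left sum_subtractf[symmetric]
    by (intro left_ideal_sum[OF I(1)]) (use P I(2) in auto)
  then have "ev (\<Sum>\<mu>\<in>G. P \<mu>) \<in> I"
    using left_ideal_diff_iff[OF I(1)] left_ideal_mult[OF I(1) sumG] by blast
  then have "(\<Sum>\<mu>\<in>G. P \<mu>) = 0"
    by (rule free)
  then have "Polynomial.coeff (\<Sum>\<mu>\<in>G. P \<mu>) K = 0"
    by simp
  moreover have "Polynomial.coeff (\<Sum>\<mu>\<in>G. P \<mu>) K = of_nat m * lead_coeff (q \<alpha>)"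
    using \<alpha>G(1) G(1) by (simp add: coeff_sum coeffP)
  ultimately show False
    using m G(3)[OF \<alpha>G(1)] by simp
qed

end

text \<open>
  The error terms that appear when the factors of a word of length \<open>r\<close> are permuted.
\<close>

inductive_set shorter :: "nat \<Rightarrow> vir_uea set" for r where
  zero: "0 \<in> shorter r"
| add: "u \<in> shorter r \<Longrightarrow> v \<in> shorter r \<Longrightarrow> u + v \<in> shorter r"
| monomial: "all_pos \<mu> \<Longrightarrow> length \<mu> < r \<Longrightarrow> uscal c * lower_word \<mu> \<in> shorter r"

lemma shorter_lower: "u \<in> shorter r \<Longrightarrow> 0 < b \<Longrightarrow> ud (- int b) * u \<in> shorter (Suc r)"
proof (induction rule: shorter.induct)
  case (monomial \<mu> c)
  then have "uscal c * lower_word (b # \<mu>) \<in> shorter (Suc r)"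
    by (intro shorter.monomial) auto
  then show ?case by (simp add: uscal_left_commute)
qed (auto intro: shorter.intros simp: distrib_left)

lemma lower_word_insort:
  "all_pos \<rho> \<Longrightarrow> 0 < b \<Longrightarrow> lower_word (b # \<rho>) - lower_word (insort b \<rho>) \<in> shorter (Suc (length \<rho>))"
proof (induction \<rho>)
  case (Cons c \<rho>)
  show ?case
  proof (cases "b \<le> c")
    case True
    then show ?thesis by (simp add: shorter.zero)
  next
    case False
    have "ud (- int b) * ud (- int c) = ud (- int c) * ud (- int b)
        + uscal (of_int (int c - int b)) * ud (- int (b + c))"
      using Cons.prems unfolding uscal_of_int
      by (subst ud_commute) (simp add: algebra_simps)
    then have "lower_word (b # c # \<rho>) = ud (- int c) * (ud (- int b) * lower_word \<rho>)
        + uscal (of_int (int c - int b)) * (ud (- int (b + c)) * lower_word \<rho>)"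
      by (simp add: distrib_right flip: mult.assoc)
    then have "lower_word (b # c # \<rho>) - lower_word (insort b (c # \<rho>)) =
      ud (- int c) * (lower_word (b # \<rho>) - lower_word (insort b \<rho>)) + uscal (of_int (int c - int b)) * lower_word ((b + c) # \<rho>)"
      using False by (simp add: right_diff_distrib)
    also have "\<dots> \<in> shorter (Suc (length (c # \<rho>)))"
      using Cons shorter_lower by (intro shorter.add shorter.monomial) auto
    finally show ?thesis .
  qed
qed (simp add: shorter.zero)

lemma lower_word_sort: "all_pos \<mu> \<Longrightarrow> lower_word \<mu> - lower_word (sort \<mu>) \<in> shorter (length \<mu>)"
proof (induction \<mu>)
  case (Cons b \<mu>)
  have "ud (- int b) * (lower_word \<mu> - lower_word (sort \<mu>)) \<in> shorter (Suc (length \<mu>))"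
    using Cons by (intro shorter_lower) auto
  moreover have "lower_word (b # sort \<mu>) - lower_word (insort b (sort \<mu>)) \<in> shorter (Suc (length \<mu>))"
    using lower_word_insort[of "sort \<mu>" b] Cons.prems by simp
  ultimately have "ud (- int b) * (lower_word \<mu> - lower_word (sort \<mu>)) + (lower_word (b # sort \<mu>) - lower_word (insort b (sort \<mu>)))
      \<in> shorter (Suc (length \<mu>))"
    by (rule shorter.add)
  then show ?case by (simp add: algebra_simps)
qed (simp add: shorter.zero)

context singular_ideal
begin

inductive_set ordered_span :: "vir_uea set" where
  ideal: "u \<in> J \<Longrightarrow> u \<in> ordered_span"
| add: "u \<in> ordered_span \<Longrightarrow> v \<in> ordered_span \<Longrightarrow> u + v \<in> ordered_span"
| monomial: "all_pos \<mu> \<Longrightarrow> sorted \<mu> \<Longrightarrow> lower_word \<mu> * ev g \<in> ordered_span"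

lemma unordered_in_ordered_span: "all_pos \<mu> \<Longrightarrow> lower_word \<mu> * ev g \<in> ordered_span"
proof (induction "length \<mu>" arbitrary: \<mu> g rule: less_induct)
  case less
  have short: "u * ev g \<in> ordered_span" if "u \<in> shorter (length \<mu>)" for u
    using that
  proof (induction rule: shorter.induct)
    case (monomial \<nu> c)
    then have "lower_word \<nu> * ev (Polynomial.smult c g) \<in> ordered_span"
      by (intro less.hyps) auto
    then show ?case by (simp add: uea_poly_smult uscal_left_commute mult.assoc)
  qed (auto simp: distrib_right J_closed intro: ordered_span.intros)
  have "(lower_word \<mu> - lower_word (sort \<mu>)) * ev g \<in> ordered_span"
    using less.prems by (intro short lower_word_sort)
  moreover have "lower_word (sort \<mu>) * ev g \<in> ordered_span"
    using less.prems by (intro ordered_span.monomial) auto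
  ultimately have "(lower_word \<mu> - lower_word (sort \<mu>)) * ev g + lower_word (sort \<mu>) * ev g \<in> ordered_span"
    by (rule ordered_span.add)
  then show ?case by (simp add: algebra_simps)
qed

lemma \<Phi>_in_ordered_span: "u \<in> \<Phi> n s \<Longrightarrow> u \<in> ordered_span"
  by (induction rule: \<Phi>.induct) (auto intro: ordered_span.intros unordered_in_ordered_span)

lemma ordered_span_smult: "u \<in> ordered_span \<Longrightarrow> uscal c * u \<in> ordered_span"
proof (induction rule: ordered_span.induct)
  case (monomial \<mu> g)
  then show ?case
    using ordered_span.monomial[of \<mu> "Polynomial.smult c g"] by (simp add: uea_poly_smult uscal_left_commute)
qed (auto intro: ordered_span.intros J_closed simp: distrib_left)

text \<open>
  The spanning half of the Poincare-Birkhoff-Witt theorem, modulo \<open>J\<close>.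
\<close>

lemma ordered_span_UNIV: "u \<in> ordered_span"
proof (induction u rule: vir_uea_induct)
  case one
  show ?case using ordered_span.monomial[of "[]" 1] by simp
next
  case (mult a u)
  show ?case using mult
  proof (induction rule: ordered_span.induct)
    case (monomial \<mu> g)
    have mono: "lower_word \<mu> * ev g \<in> \<Phi> (int (sum_list \<mu>)) (2 * int (Polynomial.degree g) + int (length \<mu>))" for g
      using monomial by (intro \<Phi>.monomial) auto
    show ?case
    proof (cases a)
      case (Dk k)
      consider "0 < k" | "k = 0" | "k < 0" by linarith
      then show ?thesis
      proof cases
        case 1
        then show ?thesis
          using \<Phi>_raise[OF mono, of "nat k" g] Dk by (auto intro: \<Phi>_in_ordered_span)
      next
        case 2
        have "ud 0 * (lower_word \<mu> * ev g) = lower_word \<mu> * ev ([:of_nat (sum_list \<mu>), 1:] * g)"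
          by (simp only: mult.assoc[symmetric] ud_0_lower_word uea_poly_mult)
            (simp add: uscal_of_nat mult.assoc add.commute)
        then show ?thesis
          using ordered_span.monomial[OF monomial] Dk 2 by simp
      next
        case 3
        then show ?thesis
          using \<Phi>_lower[OF mono, of "nat (- k)" g] Dk by (auto intro: \<Phi>_in_ordered_span)
      qed
    next
      case Zc
      have "uz * (lower_word \<mu> * ev g) = (lower_word \<mu> * ev g) * (uz - uscal \<xi>) + uscal \<xi> * (lower_word \<mu> * ev g)"
        by (simp add: right_diff_distrib uz_central uscal_central)
      moreover have "(lower_word \<mu> * ev g) * (uz - uscal \<xi>) \<in> ordered_span"
        by (intro ordered_span.ideal J_closed(3) central)
      moreover have "uscal \<xi> * (lower_word \<mu> * ev g) \<in> ordered_span"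
        using monomial by (intro ordered_span_smult ordered_span.monomial)
      ultimately show ?thesis
        using Zc ordered_span.add by metis
    qed
  qed (auto intro: ordered_span.intros J_closed simp: distrib_left)
qed (auto intro: ordered_span.intros ordered_span_smult)

lemma ordered_expansion:
  obtains F q where "finite F" "\<And>\<mu>. \<mu> \<in> F \<Longrightarrow> all_pos \<mu> \<and> sorted \<mu>"
    "\<And>\<mu>. \<mu> \<notin> F \<Longrightarrow> q \<mu> = 0" "u - (\<Sum>\<mu>\<in>F. lower_word \<mu> * ev (q \<mu>)) \<in> J"
proof -
  have "\<exists>F q. finite F \<and> (\<forall>\<mu>\<in>F. all_pos \<mu> \<and> sorted \<mu>) \<and> (\<forall>\<mu>. \<mu> \<notin> F \<longrightarrow> q \<mu> = 0) \<and>
      u - (\<Sum>\<mu>\<in>F. lower_word \<mu> * ev (q \<mu>)) \<in> J"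
    using ordered_span_UNIV[of u]
  proof (induction rule: ordered_span.induct)
    case (ideal u)
    then show ?case by (intro exI[of _ "{}"] exI[of _ "\<lambda>_. 0"]) simp
  next
    case (add u v)
    obtain F q where F: "finite F" "\<forall>\<mu>\<in>F. all_pos \<mu> \<and> sorted \<mu>" "\<forall>\<mu>. \<mu> \<notin> F \<longrightarrow> q \<mu> = 0"
      "u - (\<Sum>\<mu>\<in>F. lower_word \<mu> * ev (q \<mu>)) \<in> J" using add.IH(1) by blast
    obtain G r where G: "finite G" "\<forall>\<mu>\<in>G. all_pos \<mu> \<and> sorted \<mu>" "\<forall>\<mu>. \<mu> \<notin> G \<longrightarrow> r \<mu> = 0"
      "v - (\<Sum>\<mu>\<in>G. lower_word \<mu> * ev (r \<mu>)) \<in> J" using add.IH(2) by blast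
    have "(\<Sum>\<mu>\<in>F. lower_word \<mu> * ev (q \<mu>)) = (\<Sum>\<mu>\<in>F \<union> G. lower_word \<mu> * ev (q \<mu>))"
      "(\<Sum>\<mu>\<in>G. lower_word \<mu> * ev (r \<mu>)) = (\<Sum>\<mu>\<in>F \<union> G. lower_word \<mu> * ev (r \<mu>))"
      using F(1,3) G(1,3) by (auto intro: sum.mono_neutral_left)
    then have "u + v - (\<Sum>\<mu>\<in>F \<union> G. lower_word \<mu> * ev (q \<mu> + r \<mu>)) \<in> J"
      using J_closed(2)[OF F(4) G(4)] by (simp add: uea_poly_add distrib_left sum.distrib algebra_simps)
    then show ?case
      using F G by (intro exI[of _ "F \<union> G"] exI[of _ "\<lambda>\<mu>. q \<mu> + r \<mu>"]) auto
  next
    case (monomial \<mu> g)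
    then show ?case
      by (intro exI[of _ "{\<mu>}"] exI[of _ "\<lambda>\<nu>. if \<nu> = \<mu> then g else 0"]) (auto simp: J_closed)
  qed
  then show ?thesis using that by blast
qed

end

section \<open>Weight vectors and maximal left ideals\<close>

text \<open>
  The centre acts by a scalar. If some nonzero polynomial in \<open>d\<^sub>0\<close> lies in \<open>I\<close>, then one of minimal
  degree has a root \<open>h\<close>, and dividing out this root leaves an eigenvector of \<open>d\<^sub>0\<close>, still killed by
  \<open>n\<^sup>+\<close>. Otherwise the ordered monomials are independent over \<open>\<complex>[d\<^sub>0]\<close> modulo \<open>I\<close>. But
  \<open>I + U(\<gg>) d\<^sub>0\<close> contains the unit by maximality, and comparing the coefficients of the empty
  word gives a polynomial identity \<open>1 = d\<^sub>0 q\<close>, which is absurd.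
\<close>

lemma exists_highest_weight_vector:
  assumes max: "maximal_left_ideal I" and positive: "\<And>k. k > 0 \<Longrightarrow> ud k \<in> I"
  shows "\<exists>\<xi> h v. v \<notin> I \<and> (uz - uscal \<xi>) * v \<in> I \<and> (ud 0 - uscal h) * v \<in> I \<and>
    (\<forall>k>0. ud k * v \<in> I)"
proof -
  have I: "left_ideal I" "1 \<notin> I"
    using max by (auto simp: maximal_left_ideal_def)
  obtain \<xi> where \<xi>: "uz - uscal \<xi> \<in> I"
    using central_element_scalar[OF max] by blast
  \<comment> \<open>The largest subset of \<open>I\<close> that is stable under right multiplication by \<open>d\<^sub>0\<close>.\<close>
  define J where "J = {u. \<forall>q. u * uea_poly (ud 0) q \<in> I}"
  have raise: "ud k * uea_poly (ud 0) q \<in> I" if "k > 0" for k q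
  proof -
    have "ud k * ud 0 = (ud 0 + of_int k) * ud k"
      using ud_0_ud[of k] uscal_central[of "ud k" "of_int k"]
      by (simp add: algebra_simps uscal_of_int)
    then have "ud k * uea_poly (ud 0) q = uea_poly (ud 0 + of_int k) q * ud k"
      by (rule uea_poly_intertwine)
    then show ?thesis
      using positive[OF that] left_ideal_mult[OF I(1)] by simp
  qed
  have zent: "(uz - uscal \<xi>) * u \<in> I" for u
  proof -
    have "(uz - uscal \<xi>) * u = u * (uz - uscal \<xi>)"
      by (simp add: algebra_simps uz_central uscal_central)
    then show ?thesis using left_ideal_mult[OF I(1) \<xi>] by simp
  qed
  interpret singular_ideal J \<xi>
  proof
    show "left_ideal J"
      unfolding left_ideal_def J_def
      by (auto simp: left_idealD[OF I(1)] distrib_right mult.assoc)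
    fix u assume "u \<in> J"
    then have "u * uea_poly (ud 0) (pCons 0 q) \<in> I" for q
      unfolding J_def by blast
    then show "u * ud 0 \<in> J"
      by (simp add: J_def mult.assoc)
  next
    show "ud k \<in> J" if "k > 0" for k
      using raise[OF that] by (simp add: J_def)
    show "uz - uscal \<xi> \<in> J"
      using zent by (simp add: J_def)
  qed
  have JI: "J \<subseteq> I"
  proof
    fix u assume "u \<in> J"
    then have "u * ev 1 \<in> I" unfolding J_def by blast
    then show "u \<in> I" by simp
  qed
  have "\<exists>q. q \<noteq> 0 \<and> ev q \<in> I"
  proof (rule ccontr)
    assume "\<not> ?thesis"
    then have free: "\<And>q. ev q \<in> I \<Longrightarrow> q = 0" by blast
    have "ud 0 \<in> range (\<lambda>u. u * ud 0)"
      by (rule range_eqI[of _ _ 1]) simp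
    moreover have "ud 0 \<notin> I"
      using free[of "[:0, 1:]"] by auto
    ultimately have "\<not> range (\<lambda>u. u * ud 0) \<subseteq> I" by blast
    then obtain b u where "b \<in> I" "b + u * ud 0 = 1"
      using maximal_left_ideal_coprime[OF max left_ideal_principal] by (metis imageE)
    then have ub: "1 = u * ud 0 + b" "b \<in> I"
      by (simp_all add: add.commute)
    obtain F q where F: "finite F" "\<And>\<mu>. \<mu> \<in> F \<Longrightarrow> all_pos \<mu> \<and> sorted \<mu>" "\<And>\<mu>. \<mu> \<notin> F \<Longrightarrow> q \<mu> = 0"
      and u: "u - (\<Sum>\<mu>\<in>F. lower_word \<mu> * ev (q \<mu>)) \<in> J"
      using ordered_expansion[of u] by blast
    \<comment> \<open>The coefficients of \<open>1 - u d\<^sub>0\<close>, which lies in \<open>I\<close>.\<close>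
    define r where "r \<mu> = (if \<mu> = [] then 1 else 0) - [:0, 1:] * q \<mu>" for \<mu>
    let ?F = "insert [] F"
    have "(\<Sum>\<mu>\<in>?F. lower_word \<mu> * ev (r \<mu>)) = 1 - (\<Sum>\<mu>\<in>F. lower_word \<mu> * ev (q \<mu>)) * ud 0"
    proof -
      have "(\<Sum>\<mu>\<in>?F. lower_word \<mu> * ev (r \<mu>)) = (\<Sum>\<mu>\<in>?F. (if \<mu> = [] then 1 else 0))
          - (\<Sum>\<mu>\<in>?F. lower_word \<mu> * ev (q \<mu>) * ud 0)"
        unfolding sum_subtractf[symmetric]
      proof (rule sum.cong[OF refl])
        fix \<mu>
        have "ev ([:0, 1:] * q \<mu>) = ev (q \<mu>) * ud 0"
          using uea_poly_intertwine[of "ud 0" "ud 0" "ud 0" "q \<mu>"] by (simp add: uea_poly_mult)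
        then show "lower_word \<mu> * ev (r \<mu>) = (if \<mu> = [] then 1 else 0) - lower_word \<mu> * ev (q \<mu>) * ud 0"
          by (auto simp: r_def uea_poly_diff right_diff_distrib mult.assoc)
      qed
      also have "(\<Sum>\<mu>\<in>?F. (if \<mu> = [] then 1 else 0)) = (1 :: vir_uea)"
        using F(1) sum.delta[of ?F "[]" "\<lambda>_. 1 :: vir_uea"] by simp
      also have "(\<Sum>\<mu>\<in>?F. lower_word \<mu> * ev (q \<mu>) * ud 0) = (\<Sum>\<mu>\<in>F. lower_word \<mu> * ev (q \<mu>)) * ud 0"
        using F(1,3) by (cases "[] \<in> F") (auto simp: insert_absorb sum_distrib_right)
      finally show ?thesis .
    qed
    moreover have "1 - (\<Sum>\<mu>\<in>F. lower_word \<mu> * ev (q \<mu>)) * ud 0 = b + (u - (\<Sum>\<mu>\<in>F. lower_word \<mu> * ev (q \<mu>))) * ud 0"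
      by (subst ub(1)) (simp add: algebra_simps)
    moreover have "(u - (\<Sum>\<mu>\<in>F. lower_word \<mu> * ev (q \<mu>))) * ud 0 \<in> I"
      using right_closed[OF u] JI by blast
    ultimately have rel: "(\<Sum>\<mu>\<in>?F. lower_word \<mu> * ev (r \<mu>)) \<in> I"
      using left_ideal_add[OF I(1) ub(2)] by simp
    have "r [] = 0"
      by (rule ordered_monomials_independent[OF I(1) JI free _ _ rel]) (use F(1,2) in auto)
    then have "poly (r []) 0 = 0" by simp
    then show False by (simp add: r_def)
  qed
  then obtain q where q: "q \<noteq> 0" "ev q \<in> I"
    and min: "\<And>r. r \<noteq> 0 \<Longrightarrow> ev r \<in> I \<Longrightarrow> Polynomial.degree q \<le> Polynomial.degree r"
    using ex_has_least_nat[of "\<lambda>q. q \<noteq> 0 \<and> ev q \<in> I" _ Polynomial.degree] by metis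
  have "Polynomial.degree q \<noteq> 0"
  proof
    assume "Polynomial.degree q = 0"
    then obtain c where c: "q = [:c:]" "c \<noteq> 0"
      using q(1) by (metis degree_eq_zeroE pCons_0_0)
    then have "uscal (inverse c) * uscal c \<in> I"
      using q(2) by (intro left_ideal_mult[OF I(1)]) simp
    then show False
      using c(2) I(2) by (simp flip: uscal_mult)
  qed
  then have "\<not> constant (poly q)"
    by (simp add: constant_degree)
  then obtain h where "poly q h = 0"
    using fundamental_theorem_of_algebra by blast
  then obtain r where r: "q = [:- h, 1:] * r"
    by (auto simp: poly_eq_0_iff_dvd)
  then have "r \<noteq> 0" using q(1) by auto
  then have "Polynomial.degree q = Suc (Polynomial.degree r)"
    unfolding r by (subst degree_mult_eq) auto
  then have "ev r \<notin> I"
    using min[of r] \<open>r \<noteq> 0\<close> by auto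
  moreover have "(ud 0 - uscal h) * ev r \<in> I"
    using q(2) unfolding r by (simp add: uea_poly_mult uea_poly_diff uea_poly_add uea_poly_smult uscal_minus algebra_simps)
  ultimately show ?thesis
    using zent raise by blast
qed

text \<open>
  Now \<open>d\<^sub>0\<close> is a number as well: \<open>U(\<gg>) / J\<close> is a quotient of the Verma module.
\<close>

locale highest_weight_ideal = singular_ideal +
  fixes h :: complex
  assumes weight: "ud 0 - uscal h \<in> J"
begin

lemma ev_weight: "ev q - uscal (poly q h) \<in> J"
proof (induction q)
  case (pCons a q)
  have "ev (pCons a q) - uscal (poly (pCons a q) h)
      = ud 0 * (ev q - uscal (poly q h)) + uscal (poly q h) * (ud 0 - uscal h)"
    by (simp add: uscal_add uscal_mult algebra_simps uscal_central[of "ud 0"])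
      (simp add: mult.commute flip: uscal_mult)
  then show ?case using pCons weight J_closed by simp
qed (simp add: J_closed)

text \<open>
  Modulo \<open>J\<close>, sums of vectors whose weights differ from \<open>h\<close>: some polynomial in \<open>d\<^sub>0\<close> that does not
  vanish at \<open>h\<close> kills them.
\<close>

definition lower_part :: "vir_uea set" where
  "lower_part = {u. \<exists>P. poly P h \<noteq> 0 \<and> ev P * u \<in> J}"

lemma lower_part_add:
  assumes "u \<in> lower_part" "v \<in> lower_part"
  shows "u + v \<in> lower_part"
proof -
  obtain P Q where "poly P h \<noteq> 0" "ev P * u \<in> J" "poly Q h \<noteq> 0" "ev Q * v \<in> J"
    using assms by (auto simp: lower_part_def)
  moreover have "ev (P * Q) * (u + v) = ev Q * (ev P * u) + ev P * (ev Q * v)"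
    using uea_poly_mult[of "ud 0" P Q] uea_poly_mult[of "ud 0" Q P]
    by (simp add: distrib_left mult.commute[of Q P] flip: mult.assoc)
  ultimately show ?thesis
    unfolding lower_part_def by (intro CollectI exI[of _ "P * Q"]) (simp add: J_closed)
qed

lemma scalar_plus_lower_part: "\<exists>c. u - uscal c \<in> lower_part"
  using ordered_span_UNIV[of u]
proof (induction rule: ordered_span.induct)
  case (ideal u)
  then show ?case
    unfolding lower_part_def by (intro exI[of _ 0] CollectI exI[of _ 1]) simp
next
  case (add u v)
  then obtain c d where "(u - uscal c) + (v - uscal d) \<in> lower_part"
    using lower_part_add by blast
  then show ?case
    by (intro exI[of _ "c + d"]) (simp add: uscal_add algebra_simps)
next
  case (monomial \<mu> g)
  show ?case
  proof (cases "\<mu> = []")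
    case True
    then show ?thesis
      using ev_weight[of g] unfolding lower_part_def
      by (intro exI[of _ "poly g h"] CollectI exI[of _ 1]) simp
  next
    case False
    define n where "n = sum_list \<mu>"
    have "n \<noteq> 0"
      using monomial(1) False unfolding n_def by (cases \<mu>) auto
    \<comment> \<open>The word has weight \<open>h + n\<close>, and \<open>n \<noteq> 0\<close>.\<close>
    define P where "P = [:- (h + of_nat n), 1:]"
    have "ev P * (lower_word \<mu> * ev g) = lower_word \<mu> * ((ud 0 - uscal h) * ev g)"
    proof -
      have "ev P * lower_word \<mu> = lower_word \<mu> * (ud 0 - uscal h)"
        using ud_0_lower_word[of \<mu>] by (simp add: P_def n_def uscal_diff uscal_minus uscal_add
            uscal_of_nat algebra_simps uscal_central[of "lower_word \<mu>"] mult_of_nat_commute)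
      then show ?thesis by (simp flip: mult.assoc)
    qed
    then have "ev P * (lower_word \<mu> * ev g) \<in> J"
      using J_closed(3) J_right_ev[OF weight] by simp
    moreover have "poly P h \<noteq> 0"
      using \<open>n \<noteq> 0\<close> by (simp add: P_def)
    ultimately show ?thesis
      unfolding lower_part_def by (intro exI[of _ 0]) auto
  qed
qed

text \<open>
  If \<open>u = c + m\<close> lies in \<open>I\<close>, where \<open>m\<close> is in the lower part, then a polynomial in \<open>d\<^sub>0\<close> that removes \<open>m\<close>
  leaves a nonzero multiple of \<open>c\<close> in \<open>I\<close>; hence \<open>c = 0\<close> for proper \<open>I\<close>.
\<close>

lemma proper_subset_lower_part:
  assumes I: "left_ideal I" "J \<subseteq> I" "1 \<notin> I"
  shows "I \<subseteq> lower_part"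
proof
  fix u assume u: "u \<in> I"
  obtain c where c: "u - uscal c \<in> lower_part"
    using scalar_plus_lower_part by blast
  then obtain P where P: "poly P h \<noteq> 0" "ev P * (u - uscal c) \<in> J"
    by (auto simp: lower_part_def)
  have "c = 0"
  proof (rule ccontr)
    assume "c \<noteq> 0"
    have "uscal c * (ev P - uscal (poly P h)) \<in> I"
      using ev_weight I(2) left_ideal_mult[OF I(1)] by blast
    moreover have "ev P * u - ev P * (u - uscal c) \<in> I"
      using P(2) I(2) by (intro left_ideal_diff[OF I(1) left_ideal_mult[OF I(1) u]]) auto
    then have "uscal c * ev P \<in> I"
      by (simp add: right_diff_distrib uscal_central)
    ultimately have "uscal c * ev P - uscal c * (ev P - uscal (poly P h)) \<in> I"
      using left_ideal_diff[OF I(1)] by blast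
    then have "uscal (c * poly P h) \<in> I"
      by (simp add: right_diff_distrib uscal_mult)
    moreover define x where "x = c * poly P h"
    ultimately have "uscal (inverse x) * uscal x \<in> I"
      using left_ideal_mult[OF I(1)] by blast
    moreover have "x \<noteq> 0"
      using P(1) \<open>c \<noteq> 0\<close> by (simp add: x_def)
    ultimately show False
      using I(3) by (simp flip: uscal_mult)
  qed
  then show "u \<in> lower_part" using c by simp
qed

lemma one_notin_lower_part:
  assumes "1 \<notin> J"
  shows "1 \<notin> lower_part"
proof
  assume "1 \<in> lower_part"
  then obtain P where P: "poly P h \<noteq> 0" "ev P \<in> J"
    by (auto simp: lower_part_def)
  have "uscal (poly P h) \<in> J"
    using left_ideal_diff_iff[OF left_ideal_J ev_weight, of P] P(2) by simp
  then have "uscal (inverse (poly P h)) * uscal (poly P h) \<in> J"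
    by (rule J_closed(3))
  then show False
    using assms P(1) by (simp flip: uscal_mult)
qed

text \<open>
  Both ideals lie in the lower part, hence so does their sum. The sum is therefore proper, which by
  maximality is possible only if the ideals coincide.
\<close>

lemma maximal_left_ideal_unique:
  assumes I1: "maximal_left_ideal I1" "J \<subseteq> I1" and I2: "maximal_left_ideal I2" "J \<subseteq> I2"
  shows "I1 = I2"
proof -
  have l1: "left_ideal I1" "1 \<notin> I1" and l2: "left_ideal I2" "1 \<notin> I2"
    using I1 I2 by (auto simp: maximal_left_ideal_def)
  have "I2 \<subseteq> I1"
  proof (rule ccontr)
    assume "\<not> I2 \<subseteq> I1"
    then obtain a b where "a \<in> I1" "b \<in> I2" "a + b = 1"
      using maximal_left_ideal_coprime[OF I1(1) l2(1)] by metis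
    then have "1 \<in> lower_part"
      using proper_subset_lower_part[OF l1(1) I1(2) l1(2)]
        proper_subset_lower_part[OF l2(1) I2(2) l2(2)] lower_part_add by (metis subsetD)
    then show False
      using one_notin_lower_part I1(2) l1(2) by blast
  qed
  then show ?thesis
    using I2(1) l1 unfolding maximal_left_ideal_def by blast
qed

end

section \<open>Submodules and highest weight vectors of objects of \<open>W(0)\<close>\<close>

text \<open>
  The action of the type \<open>U(\<gg>)\<close>; the choice of a representative is immaterial by
  \<open>free_act_uea_ideal\<close>.
\<close>

definition uact :: "(vir, 'v) rep \<Rightarrow> vir_uea \<Rightarrow> 'v \<Rightarrow> 'v" where
  "uact V u v = free_act V (rep_vir_uea u) v"

lemma obtain_uea_of: obtains t where "u = uea_of t"
  using vir_uea.abs_induct[of "\<lambda>u. \<exists>t. u = uea_of t" u] by blast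

locale virasoro_module = lie_module virasoro V for V :: "(vir, 'v) rep"
begin

lemma uact_of:
  assumes "v \<in> carrier V"
  shows "uact V (uea_of t) v = free_act V t v"
proof -
  let ?s = "rep_vir_uea (uea_of t)"
  have "uea_of ?s = uea_of t"
    by (rule Quotient3_abs_rep[OF Quotient3_vir_uea])
  then have ideal: "?s - t \<in> uea_ideal virasoro"
    by (simp add: uea_of_eq_iff)
  have "free_act V (?s - t + t) v = free_act V (?s - t) v \<oplus>\<^bsub>V\<^esub> free_act V t v"
    using assms by (intro free_act_add_left) auto
  then show ?thesis
    using assms free_act_uea_ideal[OF ideal assms] free_act_closed[of t v] by (simp add: uact_def)
qed

lemma uact_closed: "v \<in> carrier V \<Longrightarrow> uact V u v \<in> carrier V"
  by (simp add: uact_def free_act_closed)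

lemma uact_add_left: "v \<in> carrier V \<Longrightarrow> uact V (a + b) v = uact V a v \<oplus>\<^bsub>V\<^esub> uact V b v"
  by (cases a rule: obtain_uea_of; cases b rule: obtain_uea_of)
    (simp add: plus_vir_uea.abs_eq uact_of free_act_add_left)

lemma uact_mult: "v \<in> carrier V \<Longrightarrow> uact V (a * b) v = uact V a (uact V b v)"
  by (cases a rule: obtain_uea_of; cases b rule: obtain_uea_of)
    (simp add: times_vir_uea.abs_eq uact_of free_act_closed free_act_mult)

lemma uact_gen: "v \<in> carrier V \<Longrightarrow> uact V (ugen x) v = act V x v"
  by (simp add: ugen_def uact_of free_act_gen)

lemma uact_scal: "v \<in> carrier V \<Longrightarrow> uact V (uscal c) v = c \<odot>\<^bsub>V\<^esub> v"
  by (simp add: uscal_def uact_of free_act_scalar)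

lemma uact_zero: "v \<in> carrier V \<Longrightarrow> uact V 0 v = \<zero>\<^bsub>V\<^esub>"
  using uact_scal[of v 0] smult_l_null[of v] by simp

lemma uact_one: "v \<in> carrier V \<Longrightarrow> uact V 1 v = v"
  using uact_scal[of v 1] smult_one[of v] by simp

lemma uact_add_right:
  "v \<in> carrier V \<Longrightarrow> w \<in> carrier V \<Longrightarrow> uact V a (v \<oplus>\<^bsub>V\<^esub> w) = uact V a v \<oplus>\<^bsub>V\<^esub> uact V a w"
  by (simp add: uact_def free_act_add_right)

lemma uact_smult_right:
  "v \<in> carrier V \<Longrightarrow> uact V a (c \<odot>\<^bsub>V\<^esub> v) = c \<odot>\<^bsub>V\<^esub> uact V a v"
  by (simp add: uact_def free_act_smult_right)

lemma uact_zero_right: "uact V a \<zero>\<^bsub>V\<^esub> = \<zero>\<^bsub>V\<^esub>"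
  using uact_smult_right[of "\<zero>\<^bsub>V\<^esub>" a 0] smult_l_null uact_closed[of "\<zero>\<^bsub>V\<^esub>" a] by simp

lemma uact_power: "v \<in> carrier V \<Longrightarrow> uact V (ugen x ^ n) v = (act V x ^^ n) v"
proof (induction n)
  case (Suc n)
  then show ?case
    using uact_gen[OF uact_closed[of v "ugen x ^ n"], of x] by (simp add: uact_mult)
qed (simp add: uact_one)

definition annihilator :: "'v \<Rightarrow> vir_uea set" where
  "annihilator v = {u. uact V u v = \<zero>\<^bsub>V\<^esub>}"

lemma left_ideal_annihilator: "v \<in> carrier V \<Longrightarrow> left_ideal (annihilator v)"
  by (simp add: left_ideal_def annihilator_def uact_zero uact_add_left uact_mult uact_zero_right)

lemma submodule_range_uact:
  assumes v: "v \<in> carrier V"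
  shows "lie_submodule virasoro V (range (\<lambda>u. uact V u v))"
proof -
  have "uact V (- u) v \<oplus>\<^bsub>V\<^esub> uact V u v = \<zero>\<^bsub>V\<^esub>" for u
    using v by (simp flip: uact_add_left add: uact_zero)
  then have minus: "\<ominus>\<^bsub>V\<^esub> uact V u v = uact V (- u) v" for u
    using v by (intro M.minus_equality) (auto simp: uact_closed)
  have "submodule (range (\<lambda>u. uact V u v)) complex_ring V"
    by (rule submoduleI)
      (use v in \<open>auto simp: uact_closed minus simp flip: uact_add_left uact_zero uact_mult uact_scal\<close>)
  then show ?thesis
    using v by (auto simp: lie_submodule_def uact_closed simp flip: uact_gen uact_mult)
qed

lemma cyclic_presentation_uact:
  assumes simple: "simple_lie_module virasoro V" and v: "v \<in> carrier V" "v \<noteq> \<zero>\<^bsub>V\<^esub>"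
  shows "cyclic_presentation V (\<lambda>u. uact V u v)"
    and "cyclic_presentation.kernel V (\<lambda>u. uact V u v) = annihilator v"
proof -
  have "uact V 1 v \<noteq> \<zero>\<^bsub>V\<^esub>"
    using v by (simp add: uact_one)
  then have "range (\<lambda>u. uact V u v) \<noteq> {\<zero>\<^bsub>V\<^esub>}"
    by (metis rangeI singletonD)
  then have "range (\<lambda>u. uact V u v) = carrier V"
    using simple submodule_range_uact[OF v(1)] by (auto simp: simple_lie_module_def)
  then interpret P: cyclic_presentation V "\<lambda>u. uact V u v"
    using v by unfold_locales (simp_all add: uact_zero uact_add_left uact_mult uact_scal uact_gen uact_closed)
  show "cyclic_presentation V (\<lambda>u. uact V u v)" by unfold_locales
  show "P.kernel = annihilator v"
    by (simp add: P.kernel_def annihilator_def)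
qed

end

context lie_module
begin

lemma submodule_inter:
  assumes "submodule H complex_ring V" "submodule K complex_ring V"
  shows "submodule (H \<inter> K) complex_ring V"
  using submoduleE[OF assms(1)] submoduleE[OF assms(2)]
    subgroup.one_closed[OF submodule.axioms(1)[OF assms(1)]]
    subgroup.one_closed[OF submodule.axioms(1)[OF assms(2)]]
  by (intro submoduleI) auto

lemma lin_span_superset: "S \<subseteq> lin_span V S"
  by (auto simp: lin_span_def)

lemma lin_span_minimal: "submodule H complex_ring V \<Longrightarrow> S \<subseteq> H \<Longrightarrow> lin_span V S \<subseteq> H"
  by (auto simp: lin_span_def)

lemma submodule_zero: "submodule H complex_ring V \<Longrightarrow> \<zero>\<^bsub>V\<^esub> \<in> H"
  using subgroup.one_closed[OF submodule.axioms(1)] by force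

lemma submodule_lin_span:
  assumes "S \<subseteq> carrier V"
  shows "submodule (lin_span V S) complex_ring V"
proof (rule submoduleI)
  show "lin_span V S \<subseteq> carrier V"
    using lin_span_minimal[OF carrier_is_submodule assms] .
qed (auto simp: lin_span_def submodule_zero submoduleE(3,4,5))

lemma lin_span_insert:
  assumes "s \<in> carrier V" "S \<subseteq> carrier V" "v \<in> lin_span V (insert s S)"
  obtains c u where "v = c \<odot>\<^bsub>V\<^esub> s \<oplus>\<^bsub>V\<^esub> u" "u \<in> lin_span V S"
proof -
  let ?H = "{c \<odot>\<^bsub>V\<^esub> s \<oplus>\<^bsub>V\<^esub> u | c u. u \<in> lin_span V S}"
  note sub = submodule_lin_span[OF assms(2)]
  have carr: "u \<in> carrier V" if "u \<in> lin_span V S" for u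
    using submoduleE(1)[OF sub] that by auto
  have sc: "c \<odot>\<^bsub>V\<^esub> s \<in> carrier V" for c
    using smult_closed[of c s] assms(1) by simp
  have smult: "d \<odot>\<^bsub>V\<^esub> (c \<odot>\<^bsub>V\<^esub> s \<oplus>\<^bsub>V\<^esub> u) = (d * c) \<odot>\<^bsub>V\<^esub> s \<oplus>\<^bsub>V\<^esub> d \<odot>\<^bsub>V\<^esub> u"
    if "u \<in> lin_span V S" for c d u
    using smult_r_distr[of d "c \<odot>\<^bsub>V\<^esub> s" u] smult_assoc1[of d c s] assms(1) carr[OF that] sc by simp
  have closed: "d \<odot>\<^bsub>V\<^esub> x \<in> ?H" if x: "x \<in> ?H" for d x
  proof -
    obtain c u where "x = c \<odot>\<^bsub>V\<^esub> s \<oplus>\<^bsub>V\<^esub> u" "u \<in> lin_span V S" using x by blast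
    then show ?thesis
      using smult submoduleE(4)[OF sub, of d u] by auto
  qed
  have subset: "?H \<subseteq> carrier V"
    using sc carr by auto
  have "submodule ?H complex_ring V"
  proof (rule submoduleI[OF subset])
    show "\<zero>\<^bsub>V\<^esub> \<in> ?H"
      using submodule_zero[OF sub] smult_l_null[OF assms(1)]
      by (auto intro!: exI[of _ "0::complex"] exI[of _ "\<zero>\<^bsub>V\<^esub>"])
    show "\<ominus>\<^bsub>V\<^esub> x \<in> ?H" if "x \<in> ?H" for x
    proof -
      have "x \<in> carrier V" using that subset by blast
      then have "\<ominus>\<^bsub>V\<^esub> x = (- 1) \<odot>\<^bsub>V\<^esub> x"
        using smult_l_distr[of "- 1" 1 x] smult_one[of x] smult_l_null[of x] smult_closed[of "- 1" x]
        by (intro M.minus_equality) auto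
      then show ?thesis using closed[OF that] by simp
    qed
    show "x \<oplus>\<^bsub>V\<^esub> y \<in> ?H" if x: "x \<in> ?H" and y: "y \<in> ?H" for x y
    proof -
      obtain c u d w where "x = c \<odot>\<^bsub>V\<^esub> s \<oplus>\<^bsub>V\<^esub> u" "u \<in> lin_span V S"
        "y = d \<odot>\<^bsub>V\<^esub> s \<oplus>\<^bsub>V\<^esub> w" "w \<in> lin_span V S" using x y by blast
      moreover from this have "x \<oplus>\<^bsub>V\<^esub> y = (c + d) \<odot>\<^bsub>V\<^esub> s \<oplus>\<^bsub>V\<^esub> (u \<oplus>\<^bsub>V\<^esub> w)"
        using smult_l_distr[of c d s] assms(1) carr sc by (simp add: M.a_ac)
      ultimately show ?thesis
        using submoduleE(5)[OF sub] by blast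
    qed
  qed (use closed in blast)
  moreover have "insert s S \<subseteq> ?H"
  proof -
    have "s = 1 \<odot>\<^bsub>V\<^esub> s \<oplus>\<^bsub>V\<^esub> \<zero>\<^bsub>V\<^esub>"
      using smult_one[of s] assms(1) by simp
    moreover have "u = 0 \<odot>\<^bsub>V\<^esub> s \<oplus>\<^bsub>V\<^esub> u" if "u \<in> S" for u
      using smult_l_null[OF assms(1)] assms(2) that by auto
    ultimately show ?thesis
      using submodule_zero[OF sub] lin_span_superset[of S] by blast
  qed
  ultimately have "v \<in> ?H"
    using lin_span_minimal assms(3) by blast
  then show ?thesis using that by blast
qed

text \<open>
  Subspaces of finitely generated spaces are finitely generated: when a generator
  \<open>s\<close> is added to \<open>S\<close>, generators of the intersection of \<open>H\<close> with the smaller span and one vector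
  \<open>w\<close> of \<open>H\<close> with nonzero coefficient at \<open>s\<close>, if there is one, generate \<open>H\<close>.
\<close>

lemma submodule_of_finite_span:
  assumes "finite S" "S \<subseteq> carrier V" "submodule H complex_ring V" "H \<subseteq> lin_span V S"
  shows "\<exists>T. finite T \<and> T \<subseteq> H \<and> lin_span V T = H"
  using assms
proof (induction S arbitrary: H rule: finite_induct)
  case empty
  have "submodule {\<zero>\<^bsub>V\<^esub>} complex_ring V"
    by (rule submoduleI) (auto simp: smult_r_null)
  then have "lin_span V {} \<subseteq> {\<zero>\<^bsub>V\<^esub>}"
    by (rule lin_span_minimal) simp
  then have "lin_span V {} = H"
    using empty lin_span_minimal[OF empty.prems(2), of "{}"] submodule_zero[OF empty.prems(2)]
      submodule_zero[OF submodule_lin_span[of "{}"]] by auto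
  then show ?case by auto
next
  case (insert s S)
  then have s: "s \<in> carrier V" "S \<subseteq> carrier V" by auto
  note sub = submodule_lin_span[OF s(2)]
  have carr: "u \<in> carrier V" if "u \<in> lin_span V S" for u
    using submoduleE(1)[OF sub] that by auto
  obtain T where T: "finite T" "T \<subseteq> H \<inter> lin_span V S" "lin_span V T = H \<inter> lin_span V S"
    using insert.IH[OF s(2) submodule_inter[OF insert.prems(2) sub]] by blast
  show ?case
  proof (cases "H \<subseteq> lin_span V S")
    case True
    then show ?thesis using T by blast
  next
    case False
    then obtain w where w: "w \<in> H" "w \<notin> lin_span V S" by blast
    obtain c u where cu: "w = c \<odot>\<^bsub>V\<^esub> s \<oplus>\<^bsub>V\<^esub> u" "u \<in> lin_span V S"
      using lin_span_insert[OF s] w(1) insert.prems(3) by blast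
    have "c \<noteq> 0"
      using cu w(2) smult_l_null[OF s(1)] carr by auto
    have TH: "insert w T \<subseteq> H" "insert w T \<subseteq> carrier V"
      using T w submoduleE(1)[OF insert.prems(2)] by auto
    note sub' = submodule_lin_span[OF TH(2)]
    have "H \<subseteq> lin_span V (insert w T)"
    proof
      fix x assume x: "x \<in> H"
      obtain d y where dy: "x = d \<odot>\<^bsub>V\<^esub> s \<oplus>\<^bsub>V\<^esub> y" "y \<in> lin_span V S"
        using lin_span_insert[OF s] x insert.prems(3) by blast
      define e where "e = d / c"
      have wc: "w \<in> carrier V" "x \<in> carrier V"
        using TH(2) submoduleE(1)[OF insert.prems(2)] x by auto
      have ew: "e \<odot>\<^bsub>V\<^esub> w = d \<odot>\<^bsub>V\<^esub> s \<oplus>\<^bsub>V\<^esub> e \<odot>\<^bsub>V\<^esub> u"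
        using smult_r_distr[of e "c \<odot>\<^bsub>V\<^esub> s" u] smult_assoc1[of e c s] smult_closed[of c s]
          s(1) carr[OF cu(2)] \<open>c \<noteq> 0\<close> by (simp add: cu(1) e_def)
      \<comment> \<open>Subtracting a multiple of \<open>w\<close> removes the component of \<open>x\<close> along \<open>s\<close>.\<close>
      define r where "r = y \<oplus>\<^bsub>V\<^esub> \<ominus>\<^bsub>V\<^esub> (e \<odot>\<^bsub>V\<^esub> u)"
      have eu: "e \<odot>\<^bsub>V\<^esub> u \<in> lin_span V S" "\<ominus>\<^bsub>V\<^esub> (e \<odot>\<^bsub>V\<^esub> u) \<in> lin_span V S"
        using submoduleE(3,4)[OF sub] cu(2) by auto
      have x_eq: "x = e \<odot>\<^bsub>V\<^esub> w \<oplus>\<^bsub>V\<^esub> r"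
      proof -
        have "e \<odot>\<^bsub>V\<^esub> w \<oplus>\<^bsub>V\<^esub> r = d \<odot>\<^bsub>V\<^esub> s \<oplus>\<^bsub>V\<^esub> y \<oplus>\<^bsub>V\<^esub> (e \<odot>\<^bsub>V\<^esub> u \<oplus>\<^bsub>V\<^esub> \<ominus>\<^bsub>V\<^esub> (e \<odot>\<^bsub>V\<^esub> u))"
          unfolding ew r_def using carr[OF eu(1)] carr[OF eu(2)] carr[OF dy(2)] smult_closed[of d s] s(1)
          by (simp add: M.a_ac)
        then show ?thesis
          using carr[OF eu(1)] carr[OF dy(2)] smult_closed[of d s] s(1)
          by (simp add: M.r_neg dy(1))
      qed
      have "r \<in> lin_span V S"
        unfolding r_def using submoduleE(5)[OF sub dy(2) eu(2)] .
      moreover have "r \<in> H"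
      proof -
        have ewH: "e \<odot>\<^bsub>V\<^esub> w \<in> H"
          using submoduleE(4)[OF insert.prems(2)] w(1) by simp
        have "r = \<ominus>\<^bsub>V\<^esub> (e \<odot>\<^bsub>V\<^esub> w) \<oplus>\<^bsub>V\<^esub> x"
          using x_eq carr[OF \<open>r \<in> lin_span V S\<close>] smult_closed[of e w] wc
          by (simp add: M.r_neg2 M.r_neg1)
        then show ?thesis
          using submoduleE(3,5)[OF insert.prems(2)] ewH x by simp
      qed
      ultimately have "r \<in> lin_span V T" using T(3) by blast
      then have "r \<in> lin_span V (insert w T)"
        using lin_span_minimal[OF sub', of T] lin_span_superset[of "insert w T"] by blast
      moreover have "e \<odot>\<^bsub>V\<^esub> w \<in> lin_span V (insert w T)"
        using submoduleE(4)[OF sub', of e w] lin_span_superset[of "insert w T"] by auto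
      ultimately show "x \<in> lin_span V (insert w T)"
        unfolding x_eq using submoduleE(5)[OF sub'] by blast
    qed
    then show ?thesis
      using T(1) TH(1) lin_span_minimal[OF insert.prems(2) TH(1)]
      by (intro exI[of _ "insert w T"]) auto
  qed
qed

context
  fixes N assumes N: "lie_submodule L V N"
begin

lemma submodule_N: "submodule N complex_ring V"
  using N by (simp add: lie_submodule_def)

lemma module_restrict: "module complex_ring (V\<lparr>carrier := N\<rparr>)"
  by (rule submodule.submodule_is_module[OF submodule_N module_axioms])

lemma restrict_minus:
  assumes "v \<in> N"
  shows "\<ominus>\<^bsub>V\<lparr>carrier := N\<rparr>\<^esub> v = \<ominus>\<^bsub>V\<^esub> v"
proof -
  interpret R: module complex_ring "V\<lparr>carrier := N\<rparr>" by (rule module_restrict)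
  have "v \<in> carrier V" using submoduleE(1)[OF submodule_N] assms by auto
  then show ?thesis
    using submoduleE(3)[OF submodule_N] assms
    by (intro R.M.minus_equality) (auto simp: M.l_neg)
qed

lemma submodule_restrict_iff:
  "submodule H complex_ring (V\<lparr>carrier := N\<rparr>) \<longleftrightarrow> submodule H complex_ring V \<and> H \<subseteq> N"
proof -
  interpret R: module complex_ring "V\<lparr>carrier := N\<rparr>" by (rule module_restrict)
  note sN = submoduleE(1)[OF submodule_N]
  show ?thesis
  proof
    assume H: "submodule H complex_ring (V\<lparr>carrier := N\<rparr>)"
    have HN: "H \<subseteq> N" using R.submoduleE(1)[OF H] by simp
    have "\<zero>\<^bsub>V\<^esub> \<in> H"
      using subgroup.one_closed[OF submodule.axioms(1)[OF H]] by simp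
    moreover have "\<ominus>\<^bsub>V\<^esub> v \<in> H" if "v \<in> H" for v
      using R.submoduleE(3)[OF H that] restrict_minus HN that by auto
    ultimately have "submodule H complex_ring V"
      using HN sN R.submoduleE(4,5)[OF H] by (intro submoduleI) auto
    then show "submodule H complex_ring V \<and> H \<subseteq> N" using HN by simp
  next
    assume H: "submodule H complex_ring V \<and> H \<subseteq> N"
    then have "\<ominus>\<^bsub>V\<lparr>carrier := N\<rparr>\<^esub> v \<in> H" if "v \<in> H" for v
      using submoduleE(3)[of H v] restrict_minus that by auto
    then show "submodule H complex_ring (V\<lparr>carrier := N\<rparr>)"
      using H submodule_zero[of H] submoduleE(4,5)[of H] by (intro R.submoduleI) auto
  qed
qed

lemma lin_span_restrict:
  assumes "T \<subseteq> N"
  shows "lin_span (V\<lparr>carrier := N\<rparr>) T = lin_span V T"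
proof
  have T: "T \<subseteq> carrier V" using assms submoduleE(1)[OF submodule_N] by blast
  have "submodule (lin_span V T) complex_ring (V\<lparr>carrier := N\<rparr>)"
    unfolding submodule_restrict_iff
    using submodule_lin_span[OF T] lin_span_minimal[OF submodule_N assms] by blast
  then show "lin_span (V\<lparr>carrier := N\<rparr>) T \<subseteq> lin_span V T"
    using lin_span_superset unfolding lin_span_def[of "V\<lparr>carrier := N\<rparr>"] by blast
  show "lin_span V T \<subseteq> lin_span (V\<lparr>carrier := N\<rparr>) T"
    unfolding lin_span_def submodule_restrict_iff by blast
qed

lemma lie_module_restrict: "lie_module L (V\<lparr>carrier := N\<rparr>)"
proof -
  have N_carrier: "v \<in> carrier V" if "v \<in> N" for v
    using submoduleE(1)[OF submodule_N] that by blast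
  have act: "act V x v \<in> N" if "x \<in> carrier L" "v \<in> N" for x v
    using N that by (simp add: lie_submodule_def)
  show ?thesis
    by (intro lie_module.intro lie_module_axioms.intro module_restrict lie.lie_algebra_axioms)
      (simp_all add: N_carrier act act_add_left act_smult_left act_add_right act_smult_right
        act_lbracket a_minus_def restrict_minus)
qed

end

end

text \<open>
  The category \<open>W(0)\<close> is closed under submodules: the subspaces that witness local finiteness are
  intersected with \<open>N\<close>. Hence a simple object of \<open>W(0)\<close> is simple as a module.
\<close>

lemma cat_W0_submodule:
  assumes V: "cat_W0 V" and N: "lie_submodule virasoro V N"
  shows "cat_W0 (V\<lparr>carrier := N\<rparr>)"
proof -
  interpret lie_module virasoro V
    using V by (simp add: cat_W0_def cat_W_def)
  note sN = submoduleE(1)[OF submodule_N[OF N]]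
  have actN: "act V x v \<in> N" if "v \<in> N" for x v
    using N that by (simp add: lie_submodule_def)
  have "n_plus_locally_finite (V\<lparr>carrier := N\<rparr>)"
    unfolding n_plus_locally_finite_def
  proof
    fix v assume "v \<in> carrier (V\<lparr>carrier := N\<rparr>)"
    then have v: "v \<in> N" by simp
    then obtain S where S: "finite S" "S \<subseteq> carrier V" "v \<in> lin_span V S"
      and stable: "\<forall>x\<in>vir_n_plus. \<forall>u\<in>lin_span V S. act V x u \<in> lin_span V S"
      using V sN unfolding cat_W0_def cat_W_def n_plus_locally_finite_def by blast
    have "submodule (N \<inter> lin_span V S) complex_ring V"
      by (intro submodule_inter submodule_N[OF N] submodule_lin_span S)
    then obtain T where T: "finite T" "T \<subseteq> N \<inter> lin_span V S" "lin_span V T = N \<inter> lin_span V S"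
      using submodule_of_finite_span[OF S(1,2), of "N \<inter> lin_span V S"] by auto
    have "lin_span (V\<lparr>carrier := N\<rparr>) T = N \<inter> lin_span V S"
      using lin_span_restrict[OF N, of T] T by auto
    then show "\<exists>S. finite S \<and> S \<subseteq> carrier (V\<lparr>carrier := N\<rparr>) \<and> v \<in> lin_span (V\<lparr>carrier := N\<rparr>) S \<and>
        (\<forall>x\<in>vir_n_plus. \<forall>u\<in>lin_span (V\<lparr>carrier := N\<rparr>) S.
          rep.act (V\<lparr>carrier := N\<rparr>) x u \<in> lin_span (V\<lparr>carrier := N\<rparr>) S)"
      using T v S(3) stable actN by (intro exI[of _ T]) auto
  qed
  then show ?thesis
    using V sN lie_module_restrict[OF N] unfolding cat_W0_def cat_W_def by auto
qed

lemma simple_object_W0_simple: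
  assumes "simple_object_W0 V"
  shows "simple_lie_module virasoro V"
  using assms cat_W0_submodule
  unfolding simple_object_W0_def simple_lie_module_def cat_W0_def cat_W_def by blast

lemma vir_d_in_n_plus: "0 < k \<Longrightarrow> vir_d k \<in> vir_n_plus"
  by (auto simp: vir_n_plus_def lin_span_def)

context virasoro_module
begin

text \<open>
  Since \<open>[d\<^sub>k, d\<^sub>1] = (k - 1) d\<^sub>k\<^sub>+\<^sub>1\<close>, a product \<open>d\<^sub>1\<^sup>a d\<^sub>k d\<^sub>1\<^sup>b\<close> with large \<open>k\<close> is a combination of such
  products with smaller \<open>k\<close> and correspondingly larger \<open>a + b\<close>. Once \<open>k = 2\<close> is reached, one of the
  exponents is at least \<open>p\<close>, and \<open>d\<^sub>1\<close> to the power \<open>p\<close> vanishes on the span.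
\<close>

lemma high_modes_vanish:
  assumes S: "S \<subseteq> carrier V" and stable: "\<And>k u. 0 < k \<Longrightarrow> u \<in> lin_span V S \<Longrightarrow> act V (vir_d k) u \<in> lin_span V S"
    and nil: "\<And>u. u \<in> lin_span V S \<Longrightarrow> uact V (ud 1 ^ p) u = \<zero>\<^bsub>V\<^esub>"
    and k: "2 * p + 1 \<le> k" "2 \<le> k" and u: "u \<in> lin_span V S"
  shows "uact V (ud (int k)) u = \<zero>\<^bsub>V\<^esub>"
proof -
  let ?W = "lin_span V S"
  have carr: "u \<in> carrier V" if "u \<in> ?W" for u
    using submoduleE(1)[OF submodule_lin_span[OF S]] that by auto
  have st: "uact V (ud k) u \<in> ?W" if "0 < k" "u \<in> ?W" for k u
    using stable[OF that] carr[OF that(2)] by (simp add: uact_gen)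
  have pow: "uact V (ud 1 ^ n) u \<in> ?W" if "u \<in> ?W" for n u
    using that
  proof (induction n)
    case (Suc n)
    then show ?case
      using st[of 1 "uact V (ud 1 ^ n) u"] carr[OF that] by (simp add: uact_mult)
  qed (simp add: uact_one carr)
  have "uact V (ud 1 ^ a * ud (int k) * ud 1 ^ b) u = \<zero>\<^bsub>V\<^esub>"
    if "2 \<le> k" "2 * p + 1 \<le> a + b + k" "u \<in> ?W" for a b k u
    using that
  proof (induction k arbitrary: a b rule: nat_induct_at_least)
    case base
    note u = \<open>u \<in> ?W\<close>
    have "p \<le> a \<or> p \<le> b" using base by linarith
    then show ?case
    proof
      assume "p \<le> a"
      then have "ud 1 ^ a = ud 1 ^ (a - p) * ud 1 ^ p"
        by (simp flip: power_add)
      then show ?thesis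
        using nil[OF st[OF _ pow[OF u]], of 2 b] carr[OF u]
        by (simp add: uact_mult uact_closed uact_zero_right)
    next
      assume "p \<le> b"
      then have "ud 1 ^ b = ud 1 ^ (b - p) * ud 1 ^ p"
        by (simp flip: power_add)
      then show ?thesis
        using nil[OF u] carr[OF u] by (simp add: uact_mult uact_closed uact_zero_right)
    qed
  next
    case (Suc k)
    let ?c = "of_int (int k - 1) :: complex"
    have eq: "uscal ?c * ud (int (Suc k)) = ud (int k) * ud 1 - ud 1 * ud (int k)"
      using Suc.hyps unfolding uscal_of_int
      by (subst ud_commute[of "int k" 1]) (auto simp: add.commute)
    have "uscal ?c * (ud 1 ^ a * ud (int (Suc k)) * ud 1 ^ b)
        = ud 1 ^ a * (ud (int k) * ud 1 - ud 1 * ud (int k)) * ud 1 ^ b"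
      unfolding eq[symmetric] by (simp add: uscal_left_commute mult.assoc)
    also have "\<dots> = ud 1 ^ a * ud (int k) * ud 1 ^ Suc b + uscal (- 1) * (ud 1 ^ Suc a * ud (int k) * ud 1 ^ b)"
      unfolding power_Suc2[of _ a] by (simp add: algebra_simps uscal_minus)
    finally have "uact V (uscal ?c * (ud 1 ^ a * ud (int (Suc k)) * ud 1 ^ b)) u
        = uact V (ud 1 ^ a * ud (int k) * ud 1 ^ Suc b) u
          \<oplus>\<^bsub>V\<^esub> uact V (uscal (- 1)) (uact V (ud 1 ^ Suc a * ud (int k) * ud 1 ^ b) u)"
      using carr[OF Suc.prems(2)] by (simp only: uact_add_left uact_mult)
    also have "\<dots> = \<zero>\<^bsub>V\<^esub>"
      using Suc.IH[of a "Suc b"] Suc.IH[of "Suc a" b] Suc.prems by (simp add: uact_zero_right)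
    finally have "uact V (uscal (inverse ?c)) (uact V (uscal ?c * (ud 1 ^ a * ud (int (Suc k)) * ud 1 ^ b)) u) = \<zero>\<^bsub>V\<^esub>"
      by (simp add: uact_zero_right)
    then have "uact V (uscal (inverse ?c) * (uscal ?c * (ud 1 ^ a * ud (int (Suc k)) * ud 1 ^ b))) u = \<zero>\<^bsub>V\<^esub>"
      using carr[OF Suc.prems(2)] by (simp only: uact_mult)
    moreover have "?c \<noteq> 0"
      using Suc.hyps by simp
    then have "uscal (inverse ?c) * uscal ?c = 1"
      unfolding uscal_mult[symmetric] by simp
    ultimately show ?case
      by (simp only: mult.assoc[symmetric] mult_1)
  qed
  from this[of k 0 0 u] k u show ?thesis by simp
qed

text \<open>
  Local finiteness gives a nonzero vector killed by all \<open>d\<^sub>k\<close> with large \<open>k\<close>. The vectors killed by all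
  \<open>d\<^sub>k\<close> with \<open>k > m\<close> are stable under \<open>d\<^sub>m\<close>, which is locally nilpotent, so the last nonzero vector in
  \<open>w, d\<^sub>m w, d\<^sub>m d\<^sub>m w, \<dots>\<close> is killed by \<open>d\<^sub>m\<close> too; the bound descends to zero in this way.
\<close>

lemma obtain_singular_vector:
  assumes W0: "cat_W0 V" and "carrier V \<noteq> {\<zero>\<^bsub>V\<^esub>}"
  obtains w where "w \<in> carrier V" "w \<noteq> \<zero>\<^bsub>V\<^esub>" "\<And>k. 0 < k \<Longrightarrow> uact V (ud k) w = \<zero>\<^bsub>V\<^esub>"
proof -
  have nilp: "\<exists>m. \<forall>n\<ge>m. uact V (ud k ^ n) v = \<zero>\<^bsub>V\<^esub>" if "0 < k" "v \<in> carrier V" for k v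
    using W0 vir_d_in_n_plus[OF that(1)] that(2) unfolding cat_W0_def by (simp add: uact_power)
  obtain v where v: "v \<in> carrier V" "v \<noteq> \<zero>\<^bsub>V\<^esub>"
    using assms(2) M.zero_closed by blast
  obtain S where S: "finite S" "S \<subseteq> carrier V" "v \<in> lin_span V S"
    and stable: "\<forall>x\<in>vir_n_plus. \<forall>u\<in>lin_span V S. act V x u \<in> lin_span V S"
    using W0 v unfolding cat_W0_def cat_W_def n_plus_locally_finite_def by blast
  obtain m where m: "\<And>s n. s \<in> S \<Longrightarrow> m s \<le> n \<Longrightarrow> uact V (ud 1 ^ n) s = \<zero>\<^bsub>V\<^esub>"
    using nilp[of 1] S(2) by (metis subsetD zero_less_one)
  \<comment> \<open>A common exponent for the finitely many generators, since \<open>m s \<le> p\<close> for each of them.\<close>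
  define p where "p = (\<Sum>s\<in>S. m s)"
  let ?Z = "{u \<in> carrier V. uact V (ud 1 ^ p) u = \<zero>\<^bsub>V\<^esub>}"
  have "submodule ?Z complex_ring V"
  proof (rule submoduleI)
    show "\<ominus>\<^bsub>V\<^esub> u \<in> ?Z" if u: "u \<in> ?Z" for u
    proof -
      have "\<ominus>\<^bsub>V\<^esub> u = (- 1) \<odot>\<^bsub>V\<^esub> u"
        using smult_l_distr[of "- 1" 1 u] smult_one[of u] smult_l_null[of u] smult_closed[of "- 1" u] u
        by (intro M.minus_equality) auto
      then show ?thesis
        using u smult_closed[of "- 1" u] smult_r_null[of "- 1"] by (simp add: uact_smult_right)
    qed
    show "c \<odot>\<^bsub>V\<^esub> u \<in> ?Z" if "u \<in> ?Z" for c u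
      using that smult_closed[of c u] smult_r_null[of c] by (simp add: uact_smult_right)
  qed (auto simp: uact_zero_right uact_add_right)
  moreover have "S \<subseteq> ?Z"
    using S(2) m member_le_sum[OF _ _ S(1), of _ m] by (auto simp: p_def)
  ultimately have "lin_span V S \<subseteq> ?Z"
    by (rule lin_span_minimal)
  then have nil: "uact V (ud 1 ^ p) u = \<zero>\<^bsub>V\<^esub>" if "u \<in> lin_span V S" for u
    using that by blast
  have "\<exists>w\<in>carrier V. w \<noteq> \<zero>\<^bsub>V\<^esub> \<and> (\<forall>k\<ge>int (Suc n). uact V (ud k) w = \<zero>\<^bsub>V\<^esub>)"
    if "n \<le> 2 * p + 2" for n
    using that
  proof (induction rule: inc_induct)
    case base
    have "uact V (ud k) v = \<zero>\<^bsub>V\<^esub>" if "int (Suc (2 * p + 2)) \<le> k" for k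
      using high_modes_vanish[OF S(2) _ nil _ _ S(3), of "nat k"] stable vir_d_in_n_plus that by auto
    then show ?case using v by blast
  next
    case (step n)
    then obtain w where w: "w \<in> carrier V" "w \<noteq> \<zero>\<^bsub>V\<^esub>"
      and kill: "\<And>k. int (Suc (Suc n)) \<le> k \<Longrightarrow> uact V (ud k) w = \<zero>\<^bsub>V\<^esub>" by blast
    let ?d = "ud (int (Suc n))"
    note I = left_ideal_annihilator[OF w(1)]
    have kill_power: "ud k * ?d ^ i \<in> annihilator w" if "int (Suc (Suc n)) \<le> k" for i k
      using that
    proof (induction i arbitrary: k)
      case 0
      then show ?case using kill by (simp add: annihilator_def)
    next
      case (Suc i)
      have "ud k * ?d ^ Suc i = (ud k * ?d) * ?d ^ i"
        by (simp add: mult.assoc)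
      also have "\<dots> = ?d * (ud k * ?d ^ i) + of_int (k - int (Suc n)) * (ud (k + int (Suc n)) * ?d ^ i)"
        using Suc.prems by (subst ud_commute) (simp add: distrib_right mult.assoc)
      also have "\<dots> \<in> annihilator w"
        using left_ideal_add[OF I left_ideal_mult[OF I Suc.IH[OF Suc.prems]]
          left_ideal_mult[OF I Suc.IH[of "k + int (Suc n)"]]] Suc.prems by simp
      finally show ?case .
    qed
    define j where "j = (LEAST j. uact V (?d ^ j) w = \<zero>\<^bsub>V\<^esub>)"
    have "\<exists>j. uact V (?d ^ j) w = \<zero>\<^bsub>V\<^esub>"
      using nilp[of "int (Suc n)" w] w(1) by auto
    then have j: "uact V (?d ^ j) w = \<zero>\<^bsub>V\<^esub>" and least: "\<And>i. i < j \<Longrightarrow> uact V (?d ^ i) w \<noteq> \<zero>\<^bsub>V\<^esub>"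
      unfolding j_def by (rule LeastI_ex) (rule not_less_Least)
    have "j \<noteq> 0"
    proof
      assume "j = 0"
      then show False using j w by (simp add: uact_one)
    qed
    then obtain i where i: "j = Suc i"
      using not0_implies_Suc by blast
    let ?w = "uact V (?d ^ i) w"
    have "uact V (ud k) ?w = \<zero>\<^bsub>V\<^esub>" if "int (Suc n) \<le> k" for k
    proof (cases "k = int (Suc n)")
      case True
      then show ?thesis
        using j w(1) by (simp only: i power_Suc uact_mult)
    next
      case False
      then show ?thesis
        using kill_power[of k i] that w(1) by (simp add: annihilator_def uact_mult)
    qed
    then show ?case
      using least[of i] i w(1) uact_closed by blast
  qed
  from this[of 0] obtain w where "w \<in> carrier V" "w \<noteq> \<zero>\<^bsub>V\<^esub>" "\<And>k. 1 \<le> k \<Longrightarrow> uact V (ud k) w = \<zero>\<^bsub>V\<^esub>"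
    by auto
  then show ?thesis
    using that by (simp add: int_one_le_iff_zero_less)
qed

lemma obtain_highest_weight_vector:
  assumes "cat_W0 V" "simple_lie_module virasoro V"
  obtains w \<xi> h where "w \<in> carrier V" "w \<noteq> \<zero>\<^bsub>V\<^esub>" "\<And>k. 0 < k \<Longrightarrow> ud k \<in> annihilator w"
    "uz - uscal \<xi> \<in> annihilator w" "ud 0 - uscal h \<in> annihilator w"
proof -
  obtain w where w: "w \<in> carrier V" "w \<noteq> \<zero>\<^bsub>V\<^esub>" "\<And>k. 0 < k \<Longrightarrow> uact V (ud k) w = \<zero>\<^bsub>V\<^esub>"
    using obtain_singular_vector assms unfolding simple_lie_module_def by blast
  note P = cyclic_presentation_uact[OF assms(2) w(1,2)]
  have "maximal_left_ideal (annihilator w)"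
    using cyclic_presentation.simple_iff[OF P(1)] assms(2) by (simp add: P(2))
  then obtain \<xi> h u where u: "u \<notin> annihilator w" "(uz - uscal \<xi>) * u \<in> annihilator w"
    "(ud 0 - uscal h) * u \<in> annihilator w" "\<forall>k>0. ud k * u \<in> annihilator w"
    using exists_highest_weight_vector[of "annihilator w"] w(3) by (auto simp: annihilator_def)
  then show ?thesis
    using that[of "uact V u w" \<xi> h] w(1) by (simp add: annihilator_def uact_mult uact_closed)
qed

end

section \<open>The Verma module as a cyclic module\<close>

global_interpretation borel: lie_algebra vir_borel by (rule lie_algebra_vir_borel)

definition borel_character :: "complex \<Rightarrow> complex \<Rightarrow> vir \<Rightarrow> complex" where
  "borel_character \<xi> h x = Poly_Mapping.lookup x Zc * \<xi> + Poly_Mapping.lookup x (Dk 0) * h"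

lemma weight_rep_simps [simp]:
  "carrier (weight_rep \<xi> h) = UNIV" "u \<oplus>\<^bsub>weight_rep \<xi> h\<^esub> v = u + v" "c \<odot>\<^bsub>weight_rep \<xi> h\<^esub> v = c * v"
  "act (weight_rep \<xi> h) x v = borel_character \<xi> h x * v"
  by (simp_all add: weight_rep_def borel_character_def)

lemma uea_ideal_borel: "uea_ideal vir_borel \<subseteq> uea_ideal virasoro"
proof -
  let ?F = "free_algebra (carrier vir_borel)" and ?I = "uea_ideal virasoro \<inter> carrier (free_algebra (carrier vir_borel))"
  interpret F: ring ?F by (rule free_algebra_ring)
  have "ideal ?I ?F"
  proof (rule idealI[OF free_algebra_ring])
    show "subgroup ?I (add_monoid ?F)"
    proof (rule group.subgroupI[OF F.add.group_axioms])
      show "?I \<noteq> {}"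
        using vir.uea_ideal_closed(1) F.zero_closed by auto
      fix a assume a: "a \<in> ?I"
      then have "inv\<^bsub>add_monoid ?F\<^esub> a = - a"
        using free_algebra_minus[of a] by (simp add: a_inv_def)
      then show "inv\<^bsub>add_monoid ?F\<^esub> a \<in> ?I"
        using a by (simp add: free_algebra_closed vir.uea_ideal_closed)
    qed (auto simp: free_algebra_closed vir.uea_ideal_closed)
  qed (auto simp: free_algebra_closed vir.uea_ideal_closed)
  moreover have "uea_relations vir_borel \<subseteq> uea_relations virasoro"
    unfolding uea_relations_def by (simp only: vir_borel_simps virasoro_simps) blast
  then have "uea_relations vir_borel \<subseteq> ?I"
    using borel.uea_relations_carrier vir.uea_relations_in_ideal by blast
  ultimately show ?thesis
    using borel.uea_ideal_minimal by blast
qed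

lemma uea_inclusion_class: "uea_inclusion virasoro (uea_class vir_borel t) = uea_class virasoro t"
proof -
  have "uea_class virasoro s = uea_class virasoro t" if "s \<in> uea_class vir_borel t" for s
    using that uea_ideal_borel by (auto simp: borel.mem_uea_class vir.uea_class_eq_iff)
  moreover have "t \<in> uea_class vir_borel t"
    by (simp add: borel.mem_uea_class borel.uea_ideal_closed)
  ultimately show ?thesis
    unfolding uea_inclusion_def by blast
qed

definition uclass :: "vir_uea \<Rightarrow> (vir word \<Rightarrow>\<^sub>0 complex) set" where
  "uclass u = uea_class virasoro (rep_vir_uea u)"

lemma uclass_of: "uclass (uea_of t) = uea_class virasoro t"
proof -
  have "uea_of (rep_vir_uea (uea_of t)) = uea_of t"
    by (rule Quotient3_abs_rep[OF Quotient3_vir_uea])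
  then show ?thesis
    by (simp add: uclass_def vir.uea_class_eq_iff uea_of_eq_iff)
qed

lemma uclass_mult: "uclass a \<otimes>\<^bsub>uea virasoro\<^esub> uclass b = uclass (a * b)"
  by (cases a rule: obtain_uea_of; cases b rule: obtain_uea_of)
    (simp add: uclass_of vir.uea_class_mult times_vir_uea.abs_eq)

lemma uclass_add: "uclass a \<oplus>\<^bsub>uea virasoro\<^esub> uclass b = uclass (a + b)"
  by (cases a rule: obtain_uea_of; cases b rule: obtain_uea_of)
    (simp add: uclass_of vir.uea_class_add plus_vir_uea.abs_eq)

lemma carrier_uea_virasoro: "carrier (uea virasoro) = range uclass"
proof
  show "carrier (uea virasoro) \<subseteq> range uclass"
    unfolding vir.carrier_uea uclass_of[symmetric] by blast
  show "range uclass \<subseteq> carrier (uea virasoro)"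
    unfolding vir.carrier_uea uclass_def by auto
qed

lemma uclass_scal: "uclass (uscal c) = uea_class virasoro (scalar c)"
  and uclass_gen: "uclass (ugen x) = uea_class virasoro (gen x)"
  by (simp_all add: uscal_def ugen_def uclass_of)

text \<open>
  The carrier of the Verma module consists of the cosets of a subgroup \<open>K\<close> of the free abelian group
  \<open>F\<close> on the pairs \<open>(u, c)\<close> with \<open>u \<in> U(\<gg>)\<close> and \<open>c \<in> \<complex>\<close>. The aim is to present it by the map that takes
  \<open>u\<close> to the class of \<open>u \<otimes> 1\<close>.
\<close>

locale verma_module =
  fixes \<xi> h :: complex
begin

abbreviation "W \<equiv> weight_rep \<xi> h"
abbreviation "F \<equiv> free_Abelian_group (carrier (uea virasoro) \<times> (UNIV :: complex set))"
abbreviation "K \<equiv> tensor_kernel (uea vir_borel) (uea virasoro)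
  (\<lambda>u r. u \<otimes>\<^bsub>uea virasoro\<^esub> uea_inclusion virasoro r) W (uea_act W)"

interpretation W: lie_module vir_borel W
  by (rule lie_module_weight_rep)

text \<open>
  The generators of \<open>K\<close> with elements of \<open>U(\<gg>)\<close> in place of classes, and with the right action of
  the enveloping algebra of the Borel subalgebra expressed through representatives \<open>r\<close> in the free
  algebra.
\<close>

definition generators :: "((vir word \<Rightarrow>\<^sub>0 complex) set \<times> complex \<Rightarrow>\<^sub>0 int) set" where
  "generators =
    {frag_of (uclass (a + b), c) - frag_of (uclass a, c) - frag_of (uclass b, c) | a b c. True} \<union>
    {frag_of (uclass a, c + d) - frag_of (uclass a, c) - frag_of (uclass a, d) | a c d. True} \<union>
    {frag_of (uclass (a * uea_of r), c) - frag_of (uclass a, free_act W r c) | a r c.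
       r \<in> carrier (free_algebra (carrier vir_borel))}"

lemma K_eq: "K = generate F generators"
proof -
  let ?R = "carrier (free_algebra (carrier vir_borel))"
  have 1: "{frag_of (m \<oplus>\<^bsub>uea virasoro\<^esub> m', n) - frag_of (m, n) - frag_of (m', n) | m m' n.
         m \<in> carrier (uea virasoro) \<and> m' \<in> carrier (uea virasoro) \<and> n \<in> carrier W} =
    {frag_of (uclass (a + b), c) - frag_of (uclass a, c) - frag_of (uclass b, c) | a b c. True}"
    unfolding carrier_uea_virasoro
  proof (intro equalityI subsetI; elim CollectE exE conjE imageE)
    fix f m m' a b and n :: complex
    assume "f = frag_of (m \<oplus>\<^bsub>uea virasoro\<^esub> m', n) - frag_of (m, n) - frag_of (m', n)"
      "m = uclass a" "m' = uclass b"
    then have "f = frag_of (uclass (a + b), n) - frag_of (uclass a, n) - frag_of (uclass b, n)"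
      by (simp add: uclass_add)
    then show "f \<in> {frag_of (uclass (a + b), c) - frag_of (uclass a, c) - frag_of (uclass b, c) | a b c. True}"
      by blast
  next
    fix f a b and c :: complex
    assume "f = frag_of (uclass (a + b), c) - frag_of (uclass a, c) - frag_of (uclass b, c)"
    then have "f = frag_of (uclass a \<oplus>\<^bsub>uea virasoro\<^esub> uclass b, c) - frag_of (uclass a, c) - frag_of (uclass b, c)"
      by (simp add: uclass_add)
    then show "f \<in> {frag_of (m \<oplus>\<^bsub>uea virasoro\<^esub> m', n) - frag_of (m, n) - frag_of (m', n) | m m' n.
         m \<in> range uclass \<and> m' \<in> range uclass \<and> n \<in> carrier W}"
      unfolding weight_rep_simps(1) by blast
  qed
  have 2: "{frag_of (m, n \<oplus>\<^bsub>W\<^esub> n') - frag_of (m, n) - frag_of (m, n') | m n n'.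
         m \<in> carrier (uea virasoro) \<and> n \<in> carrier W \<and> n' \<in> carrier W} =
    {frag_of (uclass a, c + d) - frag_of (uclass a, c) - frag_of (uclass a, d) | a c d. True}"
    unfolding carrier_uea_virasoro by auto
  have bal: "uclass a \<otimes>\<^bsub>uea virasoro\<^esub> uea_inclusion virasoro (uea_class vir_borel r) = uclass (a * uea_of r)"
    "uea_act W (uea_class vir_borel r) c = free_act W r c" if "r \<in> ?R" for a r c
    using that W.uea_act_class[of r c] by (simp_all add: uea_inclusion_class uclass_of[symmetric] uclass_mult)
  have 3: "{frag_of (m \<otimes>\<^bsub>uea virasoro\<^esub> uea_inclusion virasoro r, n) - frag_of (m, uea_act W r n) | m r n.
         m \<in> carrier (uea virasoro) \<and> r \<in> carrier (uea vir_borel) \<and> n \<in> carrier W} =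
    {frag_of (uclass (a * uea_of r), c) - frag_of (uclass a, free_act W r c) | a r c. r \<in> ?R}"
    unfolding carrier_uea_virasoro borel.carrier_uea
  proof (intro equalityI subsetI; elim CollectE exE conjE imageE)
    fix f m r a t and n :: complex
    assume "f = frag_of (m \<otimes>\<^bsub>uea virasoro\<^esub> uea_inclusion virasoro r, n) - frag_of (m, uea_act W r n)"
      "m = uclass a" "r = uea_class vir_borel t" "t \<in> ?R"
    then have "f = frag_of (uclass (a * uea_of t), n) - frag_of (uclass a, free_act W t n)"
      by (simp add: bal)
    then show "f \<in> {frag_of (uclass (a * uea_of r), c) - frag_of (uclass a, free_act W r c) | a r c. r \<in> ?R}"
      using \<open>t \<in> ?R\<close> by blast
  next
    fix f a r and c :: complex
    assume "f = frag_of (uclass (a * uea_of r), c) - frag_of (uclass a, free_act W r c)" and r: "r \<in> ?R"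
    then have "f = frag_of (uclass a \<otimes>\<^bsub>uea virasoro\<^esub> uea_inclusion virasoro (uea_class vir_borel r), c)
        - frag_of (uclass a, uea_act W (uea_class vir_borel r) c)"
      by (simp add: bal)
    then show "f \<in> {frag_of (m \<otimes>\<^bsub>uea virasoro\<^esub> uea_inclusion virasoro r, n) - frag_of (m, uea_act W r n) | m r n.
         m \<in> range uclass \<and> r \<in> uea_class vir_borel ` ?R \<and> n \<in> carrier W}"
      unfolding weight_rep_simps(1) using r by blast
  qed
  show ?thesis
    unfolding tensor_kernel_def generators_def 1 2 3 by simp
qed

lemma uclass_carrier: "uclass a \<in> carrier (uea virasoro)"
  by (simp add: carrier_uea_virasoro)

lemma frag_of_carrier: "frag_of (uclass a, c) \<in> carrier F"
  by (simp add: uclass_carrier)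

lemma diff_carrier: "f \<in> carrier F \<Longrightarrow> g \<in> carrier F \<Longrightarrow> f - g \<in> carrier F"
  using keys_diff[of f g] by auto

lemma add_carrier: "f \<in> carrier F \<Longrightarrow> g \<in> carrier F \<Longrightarrow> f + g \<in> carrier F"
  using Poly_Mapping.keys_add[of f g] by auto

lemma generators_carrier: "generators \<subseteq> carrier F"
  unfolding generators_def using frag_of_carrier diff_carrier
  by (intro Un_least subsetI; clarify; blast)

lemma subgroup_K: "subgroup K F"
  unfolding K_eq by (rule group.generate_is_subgroup[OF group_free_Abelian_group generators_carrier])

lemma K_carrier: "f \<in> K \<Longrightarrow> f \<in> carrier F"
  using subgroup.subset[OF subgroup_K] by blast

lemma K_closed: "0 \<in> K" "f \<in> K \<Longrightarrow> g \<in> K \<Longrightarrow> f + g \<in> K" "f \<in> K \<Longrightarrow> - f \<in> K"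
  "f \<in> K \<Longrightarrow> g \<in> K \<Longrightarrow> f - g \<in> K"
proof -
  show 0: "0 \<in> K" using subgroup.one_closed[OF subgroup_K] by simp
  show add: "f \<in> K \<Longrightarrow> g \<in> K \<Longrightarrow> f + g \<in> K" for f g
    using subgroup.m_closed[OF subgroup_K, of f g] by simp
  show minus: "f \<in> K \<Longrightarrow> - f \<in> K" for f
    using subgroup.m_inv_closed[OF subgroup_K, of f] K_carrier[of f] by simp
  show "f \<in> K \<Longrightarrow> g \<in> K \<Longrightarrow> f - g \<in> K"
    using add[of f "- g"] minus[of g] by simp
qed

lemma K_induct [consumes 1, case_names zero add minus generator]:
  assumes "f \<in> K" and "P 0" and "\<And>f g. f \<in> K \<Longrightarrow> g \<in> K \<Longrightarrow> P f \<Longrightarrow> P g \<Longrightarrow> P (f + g)"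
    and "\<And>f. f \<in> K \<Longrightarrow> P f \<Longrightarrow> P (- f)" and "\<And>f. f \<in> generators \<Longrightarrow> P f"
  shows "P f"
  using assms(1) unfolding K_eq
proof (induction rule: generate.induct)
  case (inv f)
  then have "f \<in> K" unfolding K_eq by (rule generate.incl)
  then show ?case
    using assms(4)[of f] assms(5)[OF inv] K_carrier[of f] by simp
next
  case (eng f g)
  then show ?case using assms(3)[of f g] by (simp add: K_eq)
qed (use assms in auto)

lemma generators_in_K: "generators \<subseteq> K"
  unfolding K_eq by (auto intro: generate.incl)

lemma coset_eq_iff:
  assumes "f \<in> carrier F" "g \<in> carrier F"
  shows "K #>\<^bsub>F\<^esub> f = K #>\<^bsub>F\<^esub> g \<longleftrightarrow> f - g \<in> K"
proof -
  have mem: "x \<in> K #>\<^bsub>F\<^esub> y \<longleftrightarrow> x - y \<in> K" for x y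
  proof -
    have "x = (x - y) + y" by simp
    then show ?thesis
      unfolding r_coset_def by (auto intro!: bexI[of _ "x - y"])
  qed
  show ?thesis
  proof
    assume "K #>\<^bsub>F\<^esub> f = K #>\<^bsub>F\<^esub> g"
    then show "f - g \<in> K"
      using mem[of f f] mem[of f g] K_closed(1) by simp
  next
    assume fg: "f - g \<in> K"
    have "x - f \<in> K \<longleftrightarrow> x - g \<in> K" for x
      using K_closed(2)[of "x - f" "f - g"] K_closed(4)[of "x - g" "f - g"] fg by auto
    then show "K #>\<^bsub>F\<^esub> f = K #>\<^bsub>F\<^esub> g"
      by (auto simp: mem)
  qed
qed

definition left_mult :: "vir_uea \<Rightarrow> ((vir word \<Rightarrow>\<^sub>0 complex) set \<times> complex \<Rightarrow>\<^sub>0 int) \<Rightarrow>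
    ((vir word \<Rightarrow>\<^sub>0 complex) set \<times> complex \<Rightarrow>\<^sub>0 int)" where
  "left_mult a = frag_extend (\<lambda>(u, w). frag_of (uclass a \<otimes>\<^bsub>uea virasoro\<^esub> u, w))"

lemma left_mult_simps:
  "left_mult a (frag_of (uclass b, c)) = frag_of (uclass (a * b), c)"
  "left_mult a (f + g) = left_mult a f + left_mult a g"
  "left_mult a (f - g) = left_mult a f - left_mult a g"
  "left_mult a (- f) = - left_mult a f" "left_mult a 0 = 0"
  by (simp_all add: left_mult_def uclass_mult frag_extend_add frag_extend_diff frag_extend_minus)

text \<open>
  Left multiplication takes generators to generators, as it commutes with right multiplication.
\<close>

lemma left_mult_K: "f \<in> K \<Longrightarrow> left_mult a f \<in> K"
proof (induction rule: K_induct)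
  case (generator f)
  then consider b d c where "f = frag_of (uclass (b + d), c) - frag_of (uclass b, c) - frag_of (uclass d, c)"
    | b c d where "f = frag_of (uclass b, c + d) - frag_of (uclass b, c) - frag_of (uclass b, d)"
    | b r c where "f = frag_of (uclass (b * uea_of r), c) - frag_of (uclass b, free_act W r c)"
        "r \<in> carrier (free_algebra (carrier vir_borel))"
    unfolding generators_def by blast
  then have "left_mult a f \<in> generators"
  proof cases
    case 1
    then show ?thesis
      unfolding generators_def by (auto simp: left_mult_simps distrib_left)
  next
    case 2
    then show ?thesis
      unfolding generators_def by (auto simp: left_mult_simps)
  next
    case (3 b r c)
    have "left_mult a f = frag_of (uclass (a * b * uea_of r), c) - frag_of (uclass (a * b), free_act W r c)"
      using 3(1) by (simp add: left_mult_simps mult.assoc)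
    then show ?thesis
      unfolding generators_def using 3(2) by blast
  qed
  then show ?case using generators_in_K by blast
qed (auto simp: left_mult_simps K_closed)

lemma left_mult_carrier: "f \<in> carrier F \<Longrightarrow> left_mult a f \<in> carrier F"
proof -
  assume "f \<in> carrier F"
  then have "Poly_Mapping.keys f \<subseteq> carrier (uea virasoro) \<times> (UNIV :: complex set)" by simp
  then show ?thesis
  proof (induction f rule: free_Abelian_group_induct[consumes 1, case_names zero diff of])
    case (of p)
    then obtain b c where "p = (uclass b, c)"
      unfolding carrier_uea_virasoro by auto
    then show ?case by (simp only: left_mult_simps frag_of_carrier)
  next
    case (diff f g)
    then show ?case using diff_carrier by (simp only: left_mult_simps)
  qed (simp add: left_mult_simps)
qed

lemma lmult_coset:
  assumes f: "f \<in> carrier F"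
  shows "(\<Union>g\<in>K #>\<^bsub>F\<^esub> f. K #>\<^bsub>F\<^esub> frag_extend (\<lambda>(u, w). frag_of (uclass a \<otimes>\<^bsub>uea virasoro\<^esub> u, w)) g)
    = K #>\<^bsub>F\<^esub> left_mult a f"
proof -
  have same: "K #>\<^bsub>F\<^esub> left_mult a g = K #>\<^bsub>F\<^esub> left_mult a f" if g: "g \<in> K #>\<^bsub>F\<^esub> f" for g
  proof -
    obtain k where k: "k \<in> K" "g = k + f"
      using g by (auto simp: r_coset_def)
    then have "left_mult a g - left_mult a f \<in> K"
      using left_mult_K by (simp add: left_mult_simps)
    moreover have "g \<in> carrier F"
      unfolding k(2) using K_carrier[OF k(1)] f by (rule add_carrier)
    ultimately show ?thesis
      using coset_eq_iff left_mult_carrier f by blast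
  qed
  have "f \<in> K #>\<^bsub>F\<^esub> f"
    using K_closed(1) by (force simp: r_coset_def)
  then show ?thesis
    unfolding left_mult_def[symmetric] using same by blast
qed

definition verma_map :: "vir_uea \<Rightarrow> verma_carrier" where
  "verma_map a = K #>\<^bsub>F\<^esub> frag_of (uclass a, 1)"

lemma verma_simps:
  "carrier (verma \<xi> h) = rcosets\<^bsub>F\<^esub> K" "\<zero>\<^bsub>verma \<xi> h\<^esub> = K"
  "A \<oplus>\<^bsub>verma \<xi> h\<^esub> B = A <#>\<^bsub>F\<^esub> B"
  "c \<odot>\<^bsub>verma \<xi> h\<^esub> A =
    (\<Union>g\<in>A. K #>\<^bsub>F\<^esub> frag_extend (\<lambda>(u, w). frag_of (uclass (uscal c) \<otimes>\<^bsub>uea virasoro\<^esub> u, w)) g)"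
  "act (verma \<xi> h) x A =
    (\<Union>g\<in>A. K #>\<^bsub>F\<^esub> frag_extend (\<lambda>(u, w). frag_of (uclass (ugen x) \<otimes>\<^bsub>uea virasoro\<^esub> u, w)) g)"
  by (simp_all add: verma_def induced_rep_def Let_def tensor_product_def FactGroup_def
      uclass_scal uclass_gen)

lemma relation_add: "frag_of (uclass (a + b), c) - frag_of (uclass a, c) - frag_of (uclass b, c) \<in> K"
  using generators_in_K unfolding generators_def by blast

lemma relation_balanced:
  "r \<in> carrier (free_algebra (carrier vir_borel)) \<Longrightarrow>
    frag_of (uclass (a * uea_of r), c) - frag_of (uclass a, free_act W r c) \<in> K"
  using generators_in_K unfolding generators_def by blast

lemma relation_scal: "frag_of (uclass (a * uscal c), 1) - frag_of (uclass a, c) \<in> K"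
  using relation_balanced[of "scalar c" a 1] W.free_act_scalar[of 1 c]
  by (simp add: scalar_carrier uscal_def)

text \<open>
  In \<open>u x \<otimes> 1 = u \<otimes> x \<cdot> 1\<close> the right-hand side is a scalar multiple of \<open>u \<otimes> 1\<close>.
\<close>

lemma relation_gen:
  assumes "x \<in> carrier vir_borel"
  shows "frag_of (uclass (a * ugen x), 1) - frag_of (uclass (a * uscal (borel_character \<xi> h x)), 1) \<in> K"
proof -
  have "frag_of (uclass (a * ugen x), 1) - frag_of (uclass a, borel_character \<xi> h x) \<in> K"
    using relation_balanced[of "gen x" a 1] W.free_act_gen[OF assms, of 1] assms
    by (simp add: gen_carrier ugen_def)
  from K_closed(4)[OF this relation_scal[of a "borel_character \<xi> h x"]] show ?thesis by simp
qed

text \<open>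
  Every tensor is of the form \<open>u \<otimes> 1\<close>, because \<open>\<complex>\<close> is one-dimensional.
\<close>

lemma coset_representative:
  assumes "f \<in> carrier F"
  shows "\<exists>a. f - frag_of (uclass a, 1) \<in> K"
proof -
  have "Poly_Mapping.keys f \<subseteq> carrier (uea virasoro) \<times> (UNIV :: complex set)"
    using assms by simp
  then show ?thesis
  proof (induction f rule: free_Abelian_group_induct[consumes 1, case_names zero diff of])
    case zero
    have "- (frag_of (uclass (0 + 0), 1) - frag_of (uclass 0, 1) - frag_of (uclass 0, 1)) \<in> K"
      by (intro K_closed(3) relation_add)
    then show ?case
      using K_closed(3) by (intro exI[of _ 0]) simp
  next
    case (diff f g)
    then obtain a b where ab: "f - frag_of (uclass a, 1) \<in> K" "g - frag_of (uclass b, 1) \<in> K" by blast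
    have "frag_of (uclass (a - b + b), 1) - frag_of (uclass (a - b), 1) - frag_of (uclass b, 1) \<in> K"
      by (rule relation_add)
    from K_closed(2)[OF K_closed(4)[OF ab] this] show ?case
      by (intro exI[of _ "a - b"]) simp
  next
    case (of p)
    then obtain a c where "p = (uclass a, c)"
      unfolding carrier_uea_virasoro by auto
    then show ?case
      using K_closed(3)[OF relation_scal[of a c]] by auto
  qed
qed

lemma coset_add:
  assumes "f \<in> carrier F" "g \<in> carrier F"
  shows "(K #>\<^bsub>F\<^esub> f) <#>\<^bsub>F\<^esub> (K #>\<^bsub>F\<^esub> g) = K #>\<^bsub>F\<^esub> (f + g)"
proof -
  have "K \<lhd> F"
    by (rule comm_group.normal_iff_subgroup[OF abelian_free_Abelian_group, THEN iffD2, OF subgroup_K])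
  from normal.rcos_sum[OF this assms] show ?thesis by simp
qed

lemma zero_coset: "frag_of (uclass 0, 1) \<in> K"
  using K_closed(3)[OF relation_add[of 0 0 1]] by simp

lemma coset_zero: "K #>\<^bsub>F\<^esub> 0 = K"
  by (simp add: r_coset_def)

lemma verma_map_eq_K: "verma_map a = K \<longleftrightarrow> frag_of (uclass a, 1) \<in> K"
proof -
  have "verma_map a = K #>\<^bsub>F\<^esub> 0 \<longleftrightarrow> frag_of (uclass a, 1) - 0 \<in> K"
    unfolding verma_map_def by (rule coset_eq_iff[OF frag_of_carrier]) simp
  then show ?thesis by (simp add: coset_zero)
qed

sublocale cyclic_presentation "verma \<xi> h" verma_map
proof
  show "range verma_map = carrier (verma \<xi> h)"
  proof
    show "range verma_map \<subseteq> carrier (verma \<xi> h)"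
      unfolding verma_simps RCOSETS_def verma_map_def using frag_of_carrier by blast
    show "carrier (verma \<xi> h) \<subseteq> range verma_map"
    proof
      fix A assume "A \<in> carrier (verma \<xi> h)"
      then obtain f where f: "f \<in> carrier F" "A = K #>\<^bsub>F\<^esub> f"
        unfolding verma_simps RCOSETS_def by blast
      obtain a where "f - frag_of (uclass a, 1) \<in> K"
        using coset_representative[OF f(1)] by blast
      then have "A = verma_map a"
        unfolding verma_map_def f(2) using coset_eq_iff[OF f(1) frag_of_carrier] by blast
      then show "A \<in> range verma_map" by blast
    qed
  qed
  show "verma_map 0 = \<zero>\<^bsub>verma \<xi> h\<^esub>"
    by (simp add: verma_simps verma_map_eq_K zero_coset)
  fix a b c x
  have "frag_of (uclass (a + b), 1) - (frag_of (uclass a, 1) + frag_of (uclass b, 1)) \<in> K"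
    using relation_add[of a b 1] by (simp add: diff_diff_eq)
  then show "verma_map (a + b) = verma_map a \<oplus>\<^bsub>verma \<xi> h\<^esub> verma_map b"
    unfolding verma_simps verma_map_def coset_add[OF frag_of_carrier frag_of_carrier]
    using coset_eq_iff[OF frag_of_carrier add_carrier[OF frag_of_carrier frag_of_carrier]] by blast
  show "verma_map (uscal c * a) = c \<odot>\<^bsub>verma \<xi> h\<^esub> verma_map a" "verma_map (ugen x * a) = act (verma \<xi> h) x (verma_map a)"
    unfolding verma_simps verma_map_def lmult_coset[OF frag_of_carrier] left_mult_simps by (rule refl)+
qed

lemma kernel_verma: "kernel = {a. frag_of (uclass a, 1) \<in> K}"
  unfolding kernel_def verma_simps verma_map_eq_K ..

lemma kernel_borel:
  assumes "x \<in> carrier vir_borel"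
  shows "ugen x - uscal (borel_character \<xi> h x) \<in> kernel"
proof -
  have "verma_map (1 * ugen x) = verma_map (1 * uscal (borel_character \<xi> h x))"
    unfolding verma_map_def using relation_gen[OF assms, of 1] coset_eq_iff[OF frag_of_carrier frag_of_carrier] by blast
  then show ?thesis
    using eq_iff by (simp add: kernel_def)
qed

lemma kernel_highest_weight_ideal: "highest_weight_ideal kernel \<xi> h"
proof
  show "left_ideal kernel" by (rule left_ideal_kernel)
  have mem: "vir_d k \<in> carrier vir_borel" if "0 \<le> k" for k
    using that by (auto simp: carrier_vir_borel)
  show all_pos: "ud k \<in> kernel" if "0 < k" for k
    using kernel_borel[OF mem, of k] that by (simp add: borel_character_def lookup_single when_def)
  show w: "ud 0 - uscal h \<in> kernel"
    using kernel_borel[OF mem, of 0] by (simp add: borel_character_def lookup_single when_def)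
  have "vir_z \<in> carrier vir_borel"
    by (auto simp: carrier_vir_borel)
  from kernel_borel[OF this] show "uz - uscal \<xi> \<in> kernel"
    by (simp add: borel_character_def lookup_single when_def)
  fix u assume u: "u \<in> kernel"
  have "u * ud 0 = u * (ud 0 - uscal h) + uscal h * u"
    by (simp add: right_diff_distrib uscal_central)
  then show "u * ud 0 \<in> kernel"
    using left_idealD(2,3)[OF left_ideal_kernel] u w by simp
qed

end

text \<open>
  A vector with annihilator \<open>I\<close> spans a copy of the one-dimensional module of the Borel subalgebra
  from which the Verma module is induced.
\<close>

lemma borel_acts_by_character:
  assumes I: "left_ideal I" and all_pos: "\<And>k. 0 < k \<Longrightarrow> ud k \<in> I"
    and z: "uz - uscal \<xi> \<in> I" and d: "ud 0 - uscal h \<in> I" and x: "x \<in> carrier vir_borel"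
  shows "ugen x - uscal (borel_character \<xi> h x) \<in> I"
proof -
  define \<phi> where "\<phi> a = (case a of Zc \<Rightarrow> \<xi> | Dk k \<Rightarrow> if k = 0 then h else 0)" for a
  have "ugen (Poly_Mapping.single a 1) - uscal (\<phi> a) \<in> I" if "a \<in> Poly_Mapping.keys x" for a
    using x that all_pos z d unfolding carrier_vir_borel \<phi>_def
    by (cases a) (auto simp: order_le_less)
  then have "(\<Sum>a\<in>Poly_Mapping.keys x. uscal (Poly_Mapping.lookup x a) *
      (ugen (Poly_Mapping.single a 1) - uscal (\<phi> a))) \<in> I"
    by (intro left_ideal_sum[OF I] left_ideal_mult[OF I])
  moreover have "(\<Sum>a\<in>Poly_Mapping.keys x. uscal (Poly_Mapping.lookup x a) * ugen (Poly_Mapping.single a 1)) = ugen x"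
  proof -
    have sum: "ugen (\<Sum>a\<in>A. f a) = (\<Sum>a\<in>A. ugen (f a))" for f :: "vir_index \<Rightarrow> vir" and A
      by (induction A rule: infinite_finite_induct) (simp_all add: ugen_add)
    show ?thesis
      by (subst (3) vir_expansion) (simp add: sum ugen_smult)
  qed
  moreover have "(\<Sum>a\<in>Poly_Mapping.keys x. uscal (Poly_Mapping.lookup x a) * uscal (\<phi> a))
      = uscal (borel_character \<xi> h x)"
  proof -
    have "(\<Sum>a\<in>Poly_Mapping.keys x. Poly_Mapping.lookup x a * \<phi> a)
        = (\<Sum>a\<in>Poly_Mapping.keys x \<union> {Zc, Dk 0}. Poly_Mapping.lookup x a * \<phi> a)"
      by (rule sum.mono_neutral_left) (auto simp: in_keys_iff)
    also have "\<dots> = (\<Sum>a\<in>{Zc, Dk 0}. Poly_Mapping.lookup x a * \<phi> a)"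
      by (rule sum.mono_neutral_right) (auto simp: \<phi>_def split: vir_index.splits)
    also have "\<dots> = borel_character \<xi> h x"
      by (simp add: \<phi>_def borel_character_def)
    finally show ?thesis
      by (simp only: uscal_mult[symmetric] uscal_sum[symmetric])
  qed
  ultimately show ?thesis
    by (simp add: right_diff_distrib sum_subtractf)
qed

text \<open>
  The universal property of the Verma module, on the level of kernels. The additive map that sends
  \<open>(u, c)\<close> to \<open>u (c w)\<close> kills \<open>K\<close>, the balancing relation because \<open>w\<close> is a highest weight vector; so
  \<open>u \<otimes> 1 = 0\<close> implies \<open>u w = 0\<close>.
\<close>

lemma (in virasoro_module) verma_kernel_annihilates:
  assumes w: "w \<in> carrier V" and all_pos: "\<And>k. 0 < k \<Longrightarrow> ud k \<in> annihilator w"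
    and z: "uz - uscal \<xi> \<in> annihilator w" and d: "ud 0 - uscal h \<in> annihilator w"
  shows "cyclic_presentation.kernel (verma \<xi> h) (verma_module.verma_map \<xi> h) \<subseteq> annihilator w"
proof -
  interpret Verma: verma_module \<xi> h .
  interpret W: lie_module vir_borel "weight_rep \<xi> h"
    by (rule lie_module_weight_rep)
  have cw: "c \<odot>\<^bsub>V\<^esub> w \<in> carrier V" for c
    using smult_closed[of c w] w by simp
  have gen: "act V x (c \<odot>\<^bsub>V\<^esub> w) = (borel_character \<xi> h x * c) \<odot>\<^bsub>V\<^esub> w" if "x \<in> carrier vir_borel" for x c
  proof -
    have "ugen x - uscal (borel_character \<xi> h x) \<in> annihilator w"
      by (rule borel_acts_by_character[OF left_ideal_annihilator[OF w] all_pos z d that])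
    then have "uact V ((ugen x - uscal (borel_character \<xi> h x)) + uscal (borel_character \<xi> h x)) w
        = borel_character \<xi> h x \<odot>\<^bsub>V\<^esub> w"
      using w cw by (subst uact_add_left) (simp_all add: annihilator_def uact_scal)
    then have "act V x w = borel_character \<xi> h x \<odot>\<^bsub>V\<^esub> w"
      using w by (simp add: uact_gen)
    then show ?thesis
      using act_smult_right[of x w c] w smult_assoc1[of c "borel_character \<xi> h x" w] by (simp add: mult.commute)
  qed
  have "set xs \<subseteq> carrier vir_borel \<Longrightarrow>
      foldr (act V) xs (c \<odot>\<^bsub>V\<^esub> w) = (foldr (act (weight_rep \<xi> h)) xs c) \<odot>\<^bsub>V\<^esub> w" for xs c
    by (induction xs) (simp_all add: gen)
  then have word: "word_act V u (c \<odot>\<^bsub>V\<^esub> w) = word_act (weight_rep \<xi> h) u c \<odot>\<^bsub>V\<^esub> w"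
    if "set (letters u) \<subseteq> carrier vir_borel" for u c
    using that by (simp add: word_act_def)
  have free: "free_act V r (c \<odot>\<^bsub>V\<^esub> w) = free_act (weight_rep \<xi> h) r c \<odot>\<^bsub>V\<^esub> w"
    if "r \<in> carrier (free_algebra (carrier vir_borel))" for r c
    using that
  proof (induction r rule: free_algebra_induct)
    case (single u e)
    then show ?case
      using free_act_single[of u "c \<odot>\<^bsub>V\<^esub> w" e] W.free_act_single[of u c e] cw word
        smult_assoc1[of e _ w] w by simp
  next
    case (add a b)
    then show ?case
      using free_act_add_left[of a b "c \<odot>\<^bsub>V\<^esub> w"] W.free_act_add_left[of a b c] cw w
        smult_l_distr[of "free_act (weight_rep \<xi> h) a c" "free_act (weight_rep \<xi> h) b c" w] by simp
  qed
  have uea: "uea_act V (uclass a) v = uact V a v" if "v \<in> carrier V" for a v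
    using that uea_act_class[of _ v] by (cases a rule: obtain_uea_of) (simp add: uclass_of uact_of)
  let ?f = "\<lambda>(u, c). uea_act V u (c \<odot>\<^bsub>V\<^esub> w)"
  have "?f ` (carrier (uea virasoro) \<times> UNIV) \<subseteq> carrier (add_monoid V)"
    using cw uea uact_closed by (auto simp: carrier_uea_virasoro)
  then obtain H where H: "H \<in> hom Verma.F (add_monoid V)"
    and Hf: "\<And>x. x \<in> carrier (uea virasoro) \<times> UNIV \<Longrightarrow> H (frag_of x) = ?f x"
    using comm_group.free_Abelian_group_universal[OF M.a_comm_group,
        of ?f "carrier (uea virasoro) \<times> UNIV"] by blast
  interpret H: group_hom Verma.F "add_monoid V" H
    using H M.add.group_axioms by (intro group_hom.intro group_hom_axioms.intro) auto
  have H_of: "H (frag_of (uclass a, c)) = uact V a (c \<odot>\<^bsub>V\<^esub> w)" for a c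
    using Hf[of "(uclass a, c)"] cw uea Verma.uclass_carrier by simp
  have H_add: "H (f + g) = H f \<oplus>\<^bsub>V\<^esub> H g" if "f \<in> carrier Verma.F" "g \<in> carrier Verma.F" for f g
    using H.hom_mult[OF that] by simp
  have H_minus: "H (- f) = \<ominus>\<^bsub>V\<^esub> H f" if "f \<in> carrier Verma.F" for f
    using H.hom_inv[OF that] that by (simp add: a_inv_def)
  have H_zero: "H 0 = \<zero>\<^bsub>V\<^esub>"
    using H.hom_one by simp
  have H_closed: "H f \<in> carrier V" if "f \<in> carrier Verma.F" for f
    using H.hom_closed[OF that] by simp
  have H_diff: "H (f - g) = H f \<ominus>\<^bsub>V\<^esub> H g" if "f \<in> carrier Verma.F" "g \<in> carrier Verma.F" for f g
  proof -
    have "H (f - g) \<oplus>\<^bsub>V\<^esub> H g = H f"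
      using H_add[OF Verma.diff_carrier[OF that] that(2)] by simp
    then show ?thesis
      using H_closed[OF that(1)] H_closed[OF that(2)] H_closed[OF Verma.diff_carrier[OF that]]
      by (metis M.a_assoc M.a_inv_closed M.minus_eq M.r_neg M.r_zero)
  qed
  have H_K: "H f = \<zero>\<^bsub>V\<^esub>" if "f \<in> Verma.K" for f
    using that
  proof (induction rule: Verma.K_induct)
    case (add f g)
    then show ?case using Verma.K_carrier by (simp only: H_add M.l_zero M.zero_closed)
  next
    case (minus f)
    moreover have "\<ominus>\<^bsub>V\<^esub> \<zero>\<^bsub>V\<^esub> = \<zero>\<^bsub>V\<^esub>"
      using M.minus_equality[of "\<zero>\<^bsub>V\<^esub>" "\<zero>\<^bsub>V\<^esub>"] by simp
    ultimately show ?case using Verma.K_carrier by (simp only: H_minus)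
  next
    case (generator f)
    then consider a b c where "f = frag_of (uclass (a + b), c) - frag_of (uclass a, c) - frag_of (uclass b, c)"
      | a c e where "f = frag_of (uclass a, c + e) - frag_of (uclass a, c) - frag_of (uclass a, e)"
      | a r c where "f = frag_of (uclass (a * uea_of r), c) - frag_of (uclass a, free_act (weight_rep \<xi> h) r c)"
          "r \<in> carrier (free_algebra (carrier vir_borel))"
      unfolding Verma.generators_def by blast
    then show ?case
    proof cases
      case (1 a b c)
      have "H f = uact V (a + b) (c \<odot>\<^bsub>V\<^esub> w) \<ominus>\<^bsub>V\<^esub> (uact V a (c \<odot>\<^bsub>V\<^esub> w) \<oplus>\<^bsub>V\<^esub> uact V b (c \<odot>\<^bsub>V\<^esub> w))"
        unfolding 1 diff_diff_eq
        by (simp only: H_diff H_add H_of Verma.frag_of_carrier Verma.add_carrier)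
      then show ?thesis
        using cw by (simp add: uact_add_left uact_closed a_minus_def M.r_neg)
    next
      case (2 a c e)
      have "H f = uact V a ((c + e) \<odot>\<^bsub>V\<^esub> w) \<ominus>\<^bsub>V\<^esub> (uact V a (c \<odot>\<^bsub>V\<^esub> w) \<oplus>\<^bsub>V\<^esub> uact V a (e \<odot>\<^bsub>V\<^esub> w))"
        unfolding 2 diff_diff_eq
        by (simp only: H_diff H_add H_of Verma.frag_of_carrier Verma.add_carrier)
      moreover have "(c + e) \<odot>\<^bsub>V\<^esub> w = c \<odot>\<^bsub>V\<^esub> w \<oplus>\<^bsub>V\<^esub> e \<odot>\<^bsub>V\<^esub> w"
        using smult_l_distr[of c e w] w by simp
      ultimately show ?thesis
        using cw by (simp add: uact_add_right uact_closed a_minus_def M.r_neg)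
    next
      case (3 a r c)
      have "H f = uact V (a * uea_of r) (c \<odot>\<^bsub>V\<^esub> w) \<ominus>\<^bsub>V\<^esub> uact V a (free_act (weight_rep \<xi> h) r c \<odot>\<^bsub>V\<^esub> w)"
        unfolding 3(1) by (simp only: H_diff H_of Verma.frag_of_carrier)
      then show ?thesis
        using cw free[OF 3(2)] by (simp add: uact_mult uact_of uact_closed a_minus_def M.r_neg)
    qed
  qed (rule H_zero)
  show ?thesis
  proof
    fix a assume "a \<in> Verma.kernel"
    then have "H (frag_of (uclass a, 1)) = \<zero>\<^bsub>V\<^esub>"
      by (intro H_K) (simp add: Verma.kernel_verma)
    then show "a \<in> annihilator w"
      using smult_one[OF w] by (simp add: H_of annihilator_def)
  qed
qed

section \<open>Simple objects of \<open>W(0)\<close>\<close>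

text \<open>
  A maximal left ideal above the kernel of the Verma module defines a simple quotient. By
  \<open>maximal_left_ideal_unique\<close> there is only one such ideal, which identifies the definite
  description in \<^const>\<open>verma_simple_quotient\<close>.
\<close>

lemma verma_simple_quotient_presentation:
  assumes max: "maximal_left_ideal I"
    and ker: "cyclic_presentation.kernel (verma \<xi> h) (verma_module.verma_map \<xi> h) \<subseteq> I"
  shows "\<exists>g. cyclic_presentation (verma_simple_quotient \<xi> h) g \<and>
    cyclic_presentation.kernel (verma_simple_quotient \<xi> h) g = I"
proof -
  interpret verma_module \<xi> h .
  interpret highest_weight_ideal kernel \<xi> h
    by (rule kernel_highest_weight_ideal)
  define N where "N = verma_map ` I"
  have I: "left_ideal I"
    using max by (simp add: maximal_left_ideal_def)
  have N: "lie_submodule virasoro (verma \<xi> h) N"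
    unfolding N_def using I by (rule lie_submodule_image)
  have vimage_N: "verma_map -` N = I"
    unfolding N_def using I ker by (rule vimage_image)
  have simple: "simple_lie_module virasoro (quotient_rep (verma \<xi> h) N') \<longleftrightarrow> maximal_left_ideal (verma_map -` N')"
    if "lie_submodule virasoro (verma \<xi> h) N'" for N'
    using cyclic_presentation.simple_iff[OF quotient_presentation(1)[OF that]] quotient_presentation(2)[OF that] by simp
  have "(THE N. lie_submodule virasoro (verma \<xi> h) N \<and>
      simple_lie_module virasoro (quotient_rep (verma \<xi> h) N)) = N"
  proof (rule the_equality)
    show "lie_submodule virasoro (verma \<xi> h) N \<and> simple_lie_module virasoro (quotient_rep (verma \<xi> h) N)"
      using N max by (simp add: simple vimage_N)
  next
    fix N' assume N': "lie_submodule virasoro (verma \<xi> h) N' \<and>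
      simple_lie_module virasoro (quotient_rep (verma \<xi> h) N')"
    then have "verma_map -` N' = I"
      using maximal_left_ideal_unique[OF _ _ max ker] simple left_ideal_vimage(2) by blast
    then show "N' = N"
      using image_vimage[OF lie_submodule_subset] N' unfolding N_def by blast
  qed
  then show ?thesis
    using quotient_presentation[OF N] vimage_N unfolding verma_simple_quotient_def by auto
qed

theorem proposition3p11:
  fixes V :: "(vir, 'v) rep"
  assumes "simple_object_W0 V"
  shows "\<exists>\<xi> h. lie_module_isomorphic virasoro V (verma_simple_quotient \<xi> h)"
proof -
  have W0: "cat_W0 V" and simple: "simple_lie_module virasoro V"
    using assms simple_object_W0_simple by (simp_all add: simple_object_W0_def)
  interpret virasoro_module V
    using simple by (simp add: virasoro_module_def simple_lie_module_def)
  obtain w \<xi> h where w: "w \<in> carrier V" "w \<noteq> \<zero>\<^bsub>V\<^esub>" "\<And>k. 0 < k \<Longrightarrow> ud k \<in> annihilator w"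
    "uz - uscal \<xi> \<in> annihilator w" "ud 0 - uscal h \<in> annihilator w"
    using obtain_highest_weight_vector[OF W0 simple] by blast
  note P = cyclic_presentation_uact[OF simple w(1,2)]
  have "maximal_left_ideal (annihilator w)"
    using cyclic_presentation.simple_iff[OF P(1)] simple by (simp add: P(2))
  moreover have "cyclic_presentation.kernel (verma \<xi> h) (verma_module.verma_map \<xi> h) \<subseteq> annihilator w"
    using w by (intro verma_kernel_annihilates)
  ultimately obtain g where Q: "cyclic_presentation (verma_simple_quotient \<xi> h) g"
    "cyclic_presentation.kernel (verma_simple_quotient \<xi> h) g = annihilator w"
    using verma_simple_quotient_presentation by blast
  then have "lie_module_isomorphic virasoro V (verma_simple_quotient \<xi> h)"
    by (intro cyclic_presentation_isomorphic[OF P(1) Q(1)]) (simp add: P(2) Q(2))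
  then show ?thesis by blast
qed

end
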